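(* Let $d\geqslant 1$ and $b\in\mathcal C^1(\mathbb T^d)$ (with values in $\mathbb R^d$). There exist constants $c_1,c_2,\gamma_0>0$, a distance $\rho$ on $\mathbb T^d$ equivalent to the Euclidean distance, and a constant $C>0$, all depending only on $b$ and $d$, such that the following holds for every killing rate $\lambda:\mathbb T^d\to[0,\infty)$ that is Lipschitz with constant $L_\lambda$. For $\gamma\in(0,\gamma_0]$ set $$\kappa=c_1-c_2L_\lambda e^{\gamma\|\lambda\|_\infty}.$$ Then, with $\rho_N(x,y)=\sum_{i=1}^N\rho(x_i,y_i)$ for $x,y\in\mathbb T^{dN}$: (i) for all $\gamma\in(0,\gamma_0]$, all integers $N\geqslant1$ and all $\mu,\nu\in\mathcal P(\mathbb T^{dN})$, $$\mathcal W_{\rho_N}(\mu R_{N,\gamma},\nu R_{N,\gamma})\leqslant(1-\gamma\kappa)\,\mathcal W_{\rho_N}(\mu,\nu);$$ (ii) for all $\gamma\in(0,\gamma_0]$, all integers $N\geqslant 1$, $m\geqslant0$ and all $\mu,\nu\in\mathcal P(\mathbb T^{dN})$, $$\mathcal W_1(\mu R_{N,\gamma}^m,\nu R_{N,\gamma}^m)\leqslant CN(1-\gamma\kappa)^m.$$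
   Context: $\mathbb T^d=\mathbb R^d/\mathbb Z^d$ is the flat torus; $\mathcal P(F)$ is the set of Borel probability measures on $F$. For a distance $\rho$ on $F$, $\mathcal W_\rho(\mu,\nu)=\inf\{\mathbb E(\rho(X,Y)): X\sim\mu,\ Y\sim\nu\}$; $\mathcal W_1$ is the case of the Euclidean distance $|x-y|$. For a Markov kernel $Q$, $\mu Q$ denotes the image of $\mu$. For a time step $\gamma>0$, let $K$ be the Markov kernel on $\mathbb T^d$ given by $Kf(x)=(2\pi)^{-d/2}\int_{\mathbb R^d}f(x+\gamma b(x)+\sqrt\gamma y)e^{-|y|^2/2}dy$, and $p(z)=1-e^{-\gamma\lambda(z)}$. For $\mu\in\mathcal P(\mathbb T^d)$ let $Q_\mu$ be the Markov kernel on $\mathbb T^d$ such that $Q_\mu(x,\cdot)$ is the law of $X_H$, where $(X_k,U_k)_{k\in\mathbb N}$ are independent random variables with, for every $k$, $X_k$ and $U_k$ independent, $U_k$ uniform on $[0,1]$, $X_0\sim K(x,\cdot)$, $X_k\sim\mu K$ for $k\geqslant1$, and $H=\inf\{k\in\mathbb N: U_k\geqslant p(X_k)\}$ (almost surely finite). For $x=(x_1,\dots,x_N)\in\mathbb T^{dN}$ let $\pi(x)=\frac1N\sum_{i=1}^N\delta_{x_i}$. The kernel $R_{N,\gamma}$ on $\mathbb T^{dN}$ is $R_{N,\gamma}(x,\cdot)=Q_{\pi(x)}(x_1,\cdot)\otimes\cdots\otimes Q_{\pi(x)}(x_N,\cdot)$. *)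

theory Defs
  imports "HOL-Probability.Probability"
begin

section \<open>The flat torus\<close>

definition int_lattice :: "(real ^ 'n::finite) set" where
  "int_lattice = {k. \<forall>i. k $ i \<in> \<int>}"

lemma int_lattice_0 [simp]: "0 \<in> int_lattice"
  by (simp add: int_lattice_def)

lemma int_lattice_nonempty [simp]: "int_lattice \<noteq> {}"
  using int_lattice_0 by blast

lemma int_lattice_minus [simp]: "- k \<in> int_lattice \<longleftrightarrow> k \<in> int_lattice"
  by (simp add: int_lattice_def)

lemma int_lattice_add: "k \<in> int_lattice \<Longrightarrow> l \<in> int_lattice \<Longrightarrow> k + l \<in> int_lattice"
  by (simp add: int_lattice_def)

lemma int_lattice_diff: "k \<in> int_lattice \<Longrightarrow> l \<in> int_lattice \<Longrightarrow> k - l \<in> int_lattice"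
  by (simp add: int_lattice_def)

lemma closed_int_lattice: "closed (int_lattice :: (real ^ 'n::finite) set)"
proof -
  have "closed {k :: real ^ 'n. k $ i \<in> \<int>}" for i
    using closed_vimage[OF closed_Ints, of "\<lambda>k :: real ^ 'n. k $ i"]
    by (simp add: vimage_def continuous_on_component)
  then show ?thesis
    unfolding int_lattice_def by (rule closed_Collect_all)
qed

quotient_type (overloaded) 'n torus = "real ^ 'n::finite" / "\<lambda>x y. x - y \<in> int_lattice"
  morphisms rep_torus to_torus
proof (rule equivpI)
  show "reflp (\<lambda>x y :: real ^ 'n. x - y \<in> int_lattice)"
    by (simp add: reflp_def)
  show "symp (\<lambda>x y :: real ^ 'n. x - y \<in> int_lattice)"
    unfolding symp_def by (metis int_lattice_minus minus_diff_eq)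
  show "transp (\<lambda>x y :: real ^ 'n. x - y \<in> int_lattice)"
    unfolding transp_def using int_lattice_add by fastforce
qed

lemma infdist_lattice_cong:
  fixes u v :: "real ^ 'n::finite"
  assumes "u - v \<in> int_lattice"
  shows "infdist u int_lattice = infdist v int_lattice"
proof -
  have le: "infdist u int_lattice \<le> infdist v int_lattice"
    if "u - v \<in> int_lattice" for u v :: "real ^ 'n"
  proof -
    obtain k where k: "k \<in> int_lattice" "infdist v int_lattice = dist v k"
      using infdist_attains_inf[OF closed_int_lattice, of v] by auto
    have "infdist u int_lattice \<le> dist u (k + (u - v))"
      using that k by (intro infdist_le int_lattice_add)
    also have "\<dots> = dist v k"
      by (simp add: dist_norm algebra_simps)
    finally show ?thesis using k by simp
  qed
  have "v - u \<in> int_lattice"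
    using assms by (metis int_lattice_minus minus_diff_eq)
  with assms show ?thesis by (intro antisym le)
qed

text \<open>
  The distance on the torus is the one induced by the Euclidean norm: between the classes of
  \<open>x\<close> and \<open>y\<close> it is the infimum of \<open>norm (x - y - k)\<close> over integer vectors \<open>k\<close>.
\<close>

instantiation torus :: (finite) metric_space
begin

lift_definition dist_torus :: "'a torus \<Rightarrow> 'a torus \<Rightarrow> real"
  is "\<lambda>x y. infdist (x - y) int_lattice"
proof -
  fix x x' y y' :: "real ^ 'a"
  assume "x - x' \<in> int_lattice" "y - y' \<in> int_lattice"
  then have "(x - x') - (y - y') \<in> int_lattice" by (rule int_lattice_diff)
  then show "infdist (x - y) int_lattice = infdist (x' - y') int_lattice"
    by (intro infdist_lattice_cong) (simp add: algebra_simps)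
qed

definition uniformity_torus :: "('a torus \<times> 'a torus) filter" where
  "uniformity_torus = (INF e\<in>{0 <..}. principal {(x, y). dist x y < e})"

definition open_torus :: "'a torus set \<Rightarrow> bool" where
  "open_torus U = (\<forall>x\<in>U. \<forall>\<^sub>F (x', y) in uniformity. x' = x \<longrightarrow> y \<in> U)"

instance
proof
  show "dist x y = 0 \<longleftrightarrow> x = y" for x y :: "'a torus"
    by transfer (simp add: in_closed_iff_infdist_zero[OF closed_int_lattice])
  show "dist x y \<le> dist x z + dist y z" for x y z :: "'a torus"
  proof transfer
    fix x y z :: "real ^ 'a"
    obtain k where k: "k \<in> int_lattice" "infdist (x - z) int_lattice = dist (x - z) k"
      using infdist_attains_inf[OF closed_int_lattice, of "x - z"] by auto
    obtain l where l: "l \<in> int_lattice" "infdist (y - z) int_lattice = dist (y - z) l"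
      using infdist_attains_inf[OF closed_int_lattice, of "y - z"] by auto
    have "infdist (x - y) int_lattice \<le> dist (x - y) (k - l)"
      using k l by (intro infdist_le int_lattice_diff)
    also have "\<dots> = norm ((x - z - k) - (y - z - l))"
      by (simp add: dist_norm algebra_simps)
    also have "\<dots> \<le> norm (x - z - k) + norm (y - z - l)"
      by (rule norm_triangle_ineq4)
    finally show "infdist (x - y) int_lattice
        \<le> infdist (x - z) int_lattice + infdist (y - z) int_lattice"
      using k l by (simp add: dist_norm)
  qed
qed (fact uniformity_torus_def open_torus_def)+

end

lift_definition torus_shift :: "'n::finite torus \<Rightarrow> real ^ 'n \<Rightarrow> 'n torus" is "\<lambda>x v. x + v"
  by simp

definition torus_C1 :: "('n::finite torus \<Rightarrow> real ^ 'n) \<Rightarrow> bool" where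
  "torus_C1 b \<longleftrightarrow> (\<exists>D :: real ^ 'n \<Rightarrow> (real ^ 'n) \<Rightarrow>\<^sub>L (real ^ 'n).
      (\<forall>x. ((\<lambda>y. b (to_torus y)) has_derivative blinfun_apply (D x)) (at x)) \<and>
      continuous_on UNIV D)"

text \<open>
  Points of the \<open>N\<close>-fold product of the torus are the extensional functions on \<open>{..<N}\<close>.
  The torus is second countable, so the product \<open>\<sigma>\<close>-algebra is the Borel one.
\<close>

definition torus_power :: "nat \<Rightarrow> (nat \<Rightarrow> 'n::finite torus) measure" where
  "torus_power N = (\<Pi>\<^sub>M i\<in>{..<N}. borel)"

definition sum_dist :: "nat \<Rightarrow> ('a \<Rightarrow> 'a \<Rightarrow> real) \<Rightarrow> (nat \<Rightarrow> 'a) \<Rightarrow> (nat \<Rightarrow> 'a) \<Rightarrow> real" where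
  "sum_dist N \<rho> x y = (\<Sum>i<N. \<rho> (x i) (y i))"

definition euclid_dist :: "nat \<Rightarrow> (nat \<Rightarrow> 'a::metric_space) \<Rightarrow> (nat \<Rightarrow> 'a) \<Rightarrow> real" where
  "euclid_dist N x y = L2_set (\<lambda>i. dist (x i) (y i)) {..<N}"

definition equivalent_dist :: "('a::metric_space \<Rightarrow> 'a \<Rightarrow> real) \<Rightarrow> bool" where
  "equivalent_dist \<rho> \<longleftrightarrow>
     (\<exists>a>0. \<exists>A>0. \<forall>x y. a * dist x y \<le> \<rho> x y \<and> \<rho> x y \<le> A * dist x y)"

section \<open>Wasserstein distances\<close>

definition couplings :: "'a measure \<Rightarrow> 'a measure \<Rightarrow> ('a \<times> 'a) measure set" where
  "couplings \<mu> \<nu> = {\<pi> \<in> space (prob_algebra (\<mu> \<Otimes>\<^sub>M \<nu>)). distr \<pi> \<mu> fst = \<mu> \<and> distr \<pi> \<nu> snd = \<nu>}"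

text \<open>
  This real-valued definition is meant for bounded measurable costs, as are all the distances
  above when \<open>\<rho>\<close> is equivalent to the distance of the (compact) torus. Then every coupling
  has a finite cost, and for probability measures the infimum is over a nonempty set
  (it contains the product coupling) that is bounded below.
\<close>

definition wasserstein :: "('a \<Rightarrow> 'a \<Rightarrow> real) \<Rightarrow> 'a measure \<Rightarrow> 'a measure \<Rightarrow> real" where
  "wasserstein \<rho> \<mu> \<nu> = (INF \<pi>\<in>couplings \<mu> \<nu>. \<integral>z. \<rho> (fst z) (snd z) \<partial>\<pi>)"

section \<open>The Markov kernels\<close>

definition std_gaussian :: "(real ^ 'n::finite) measure" where
  "std_gaussian = density lborel
     (\<lambda>y. ennreal ((2 * pi) powr (- (real CARD('n) / 2)) * exp (- (norm y)\<^sup>2 / 2)))"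

definition euler_kernel ::
    "('n::finite torus \<Rightarrow> real ^ 'n) \<Rightarrow> real \<Rightarrow> 'n torus \<Rightarrow> 'n torus measure" where
  "euler_kernel b \<gamma> x =
     distr std_gaussian borel (\<lambda>y. torus_shift x (\<gamma> *\<^sub>R b x + sqrt \<gamma> *\<^sub>R y))"

definition sup_norm :: "('a \<Rightarrow> real) \<Rightarrow> real" where
  "sup_norm f = (SUP z. \<bar>f z\<bar>)"

definition kill_prob :: "('a \<Rightarrow> real) \<Rightarrow> real \<Rightarrow> 'a \<Rightarrow> real" where
  "kill_prob l \<gamma> z = 1 - exp (- \<gamma> * l z)"

text \<open>
  \<open>trial_space b \<gamma> \<mu> x\<close> is the canonical space of the sequence \<open>(X k, U k)\<close>, where the two
  components of \<open>\<omega> k\<close> are \<open>X k\<close> and \<open>U k\<close>. The image of \<open>\<mu>\<close> under a kernel is the Giry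
  monad \<open>bind\<close>. In \<open>survival_index\<close> the infimum is almost surely over a nonempty set.
\<close>

definition trial_space :: "('n::finite torus \<Rightarrow> real ^ 'n) \<Rightarrow> real \<Rightarrow> 'n torus measure \<Rightarrow>
    'n torus \<Rightarrow> (nat \<Rightarrow> 'n torus \<times> real) measure" where
  "trial_space b \<gamma> \<mu> x = (\<Pi>\<^sub>M k\<in>UNIV.
     (if k = 0 then euler_kernel b \<gamma> x else \<mu> \<bind> euler_kernel b \<gamma>)
       \<Otimes>\<^sub>M uniform_measure lborel {0..1})"

definition survival_index :: "('a \<Rightarrow> real) \<Rightarrow> real \<Rightarrow> (nat \<Rightarrow> 'a \<times> real) \<Rightarrow> nat" where
  "survival_index l \<gamma> \<omega> = Inf {k. snd (\<omega> k) \<ge> kill_prob l \<gamma> (fst (\<omega> k))}"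

definition resample_kernel :: "('n::finite torus \<Rightarrow> real ^ 'n) \<Rightarrow> ('n torus \<Rightarrow> real) \<Rightarrow> real \<Rightarrow>
    'n torus measure \<Rightarrow> 'n torus \<Rightarrow> 'n torus measure" where
  "resample_kernel b l \<gamma> \<mu> x =
     distr (trial_space b \<gamma> \<mu> x) borel (\<lambda>\<omega>. fst (\<omega> (survival_index l \<gamma> \<omega>)))"

definition empirical_measure :: "nat \<Rightarrow> (nat \<Rightarrow> 'a::topological_space) \<Rightarrow> 'a measure" where
  "empirical_measure N x = distr (uniform_count_measure {..<N}) borel x"

definition particle_kernel :: "('n::finite torus \<Rightarrow> real ^ 'n) \<Rightarrow> ('n torus \<Rightarrow> real) \<Rightarrow> real \<Rightarrow>
    nat \<Rightarrow> (nat \<Rightarrow> 'n torus) \<Rightarrow> (nat \<Rightarrow> 'n torus) measure" where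
  "particle_kernel b l \<gamma> N x =
     (\<Pi>\<^sub>M i\<in>{..<N}. resample_kernel b l \<gamma> (empirical_measure N x) (x i))"

definition particle_step :: "('n::finite torus \<Rightarrow> real ^ 'n) \<Rightarrow> ('n torus \<Rightarrow> real) \<Rightarrow> real \<Rightarrow>
    nat \<Rightarrow> (nat \<Rightarrow> 'n torus) measure \<Rightarrow> (nat \<Rightarrow> 'n torus) measure" where
  "particle_step b l \<gamma> N \<mu> = \<mu> \<bind> particle_kernel b l \<gamma> N"

end

theory Submission
  imports Defs
begin

text \<open>
  The distance is \<open>\<rho>(x, y) = \<Phi>\<^sub>0(s |x - y|)\<close>, where \<open>\<Phi>\<^sub>0\<close> is the standard normal distribution function
  minus \<open>1/2\<close>. Under the coupling of two Gaussian steps by reflection (with coalescence on the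
  overlap of the densities), the signed distance \<open>r\<close> of the two points becomes a Gaussian
  variable with mean \<open>r\<close> and variance \<open>4\<gamma>\<close>, as seen by odd functions. Since \<open>\<Phi>\<^sub>0\<close> is itself a
  Gaussian distribution function, the mean of \<open>\<Phi>\<^sub>0(s r)\<close> after the step is exactly
  \<open>\<Phi>\<^sub>0(s r / sqrt (1 + 4 s\<^sup>2 \<gamma>))\<close>. With \<open>s\<^sup>2\<close> larger than the Lipschitz constant of the drift this beats the
  expansion factor \<open>1 + \<gamma> L\<close>, and as \<open>\<Phi>\<^sub>0\<close> is concave and the torus is bounded, one step contracts
  \<open>\<rho>\<close> by a factor \<open>1 - c \<gamma>\<close>.

  For the resampling, the trials of the two systems use the same uniform variables and the same
  indices of the resampled particles, and are coupled as above. Since \<open>\<lambda>\<close> is Lipschitz on a bounded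
  space, all killing probabilities lie in an interval of length \<open>O(\<gamma> L)\<close> below
  \<open>P = 1 - exp (- \<gamma> \<parallel>\<lambda>\<parallel>)\<close>; the mass lost by a particle at the first trial and the mass regained by
  resampling compensate up to this order, and the number of trials produces the factor
  \<open>1 / (1 - P) = exp (\<gamma> \<parallel>\<lambda>\<parallel>)\<close>.
\<close>

section \<open>Coordinates on the torus\<close>

text \<open>The obstacle is that P need not be small, so the resampling term must not be estimated
  separately. What makes the compensation exact is the additivity of the cost. A resampled trial
  costs on average 1/N of the total, whichever particle is moved, so summing over the particles
  counts the total 1 + P/(1 - P) = 1/(1 - P) times. Each time it carries the weight 1 - P + \<delta>
  + \<theta>: at most 1 - P + \<delta> for acceptance by both, with \<delta> = \<gamma> L d and d
  the dimension, a crude bound of the diameter; and \<theta> = \<gamma> L A for acceptance by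
  exactly one, where dist \<le> A \<rho>. The quotient is 1 + (\<delta> + \<theta>) exp (\<gamma>
  \<parallel>\<lambda>\<parallel>), whence c2 = A + d.

  A second constraint is measurability. An arbitrary coupling of the initial laws is extended by a
  kernel on pairs of states, so the coupled step, including the shortest displacement between two
  torus points, has to be a jointly measurable function of both states and one noise. Hence the
  explicit section of the torus and the description of all laws as images of noise spaces.\<close>

lemma dist_to_torus: "dist (to_torus u) (to_torus v) = infdist (u - v) int_lattice"
  by transfer simp

lemma dist_to_torus_le: "dist (to_torus u) (to_torus v) \<le> dist u v"
  unfolding dist_to_torus using infdist_le[OF int_lattice_0, of "u - v"] by (simp add: dist_norm)

lemma to_torus_eq_iff: "to_torus u = to_torus v \<longleftrightarrow> u - v \<in> int_lattice"
  using torus.abs_eq_iff by blast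

lemma continuous_on_to_torus: "continuous_on A to_torus"
  by (rule continuous_on_iff[THEN iffD2]) (meson dist_to_torus_le le_less_trans)

lemma measurable_to_torus [measurable]: "to_torus \<in> borel \<rightarrow>\<^sub>M borel"
  by (intro borel_measurable_continuous_onI continuous_on_to_torus)

text \<open>\<open>rep_torus\<close> is an arbitrary choice of representatives, about whose
  measurability nothing is known. Fractional parts do not depend on that choice and give the
  canonical section with values in the half-open unit cube.\<close>

definition torus_section :: "'n::finite torus \<Rightarrow> real ^ 'n" where
  "torus_section x = (\<chi> i. frac (rep_torus x $ i))"

lemma to_torus_rep: "to_torus (rep_torus x) = x"
  by (meson Quotient3_abs_rep Quotient3_torus)

lemma torus_section_bounds: "0 \<le> torus_section x $ i" "torus_section x $ i < 1"
  by (auto simp: torus_section_def frac_lt_1)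

lemma to_torus_section [simp]: "to_torus (torus_section x) = x"
proof -
  have "to_torus (torus_section x) = to_torus (rep_torus x)"
    by (simp add: to_torus_eq_iff int_lattice_def torus_section_def frac_def)
  then show ?thesis by (simp add: to_torus_rep)
qed

lemma torus_section_to_torus: "torus_section (to_torus u) $ i = frac (u $ i)"
proof -
  have "rep_torus (to_torus u) - u \<in> int_lattice"
    by (simp add: to_torus_rep flip: to_torus_eq_iff)
  then have "rep_torus (to_torus u) $ i - u $ i \<in> \<int>" by (simp add: int_lattice_def)
  then obtain k where "rep_torus (to_torus u) $ i = u $ i + of_int k"
    by (metis Ints_cases diff_add_cancel add.commute)
  then show ?thesis by (simp add: torus_section_def frac_def)
qed

text \<open>The infimum over the lattice is attained, so subtracting the optimal lattice vector from
  any representative of \<open>z\<close> gives a lift as close to \<open>u\<close> as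
  \<open>z\<close> is to the class of \<open>u\<close>.\<close>

lemma torus_near_lift:
  assumes "dist z (to_torus u) < e"
  obtains w where "z = to_torus w" "dist w u < e"
proof -
  obtain k where k: "k \<in> int_lattice" "infdist (rep_torus z - u) int_lattice = dist (rep_torus z - u) k"
    using infdist_attains_inf[OF closed_int_lattice, of "rep_torus z - u"] by auto
  have "z = to_torus (rep_torus z - k)"
    using k(1) by (subst (1) to_torus_rep[symmetric]) (simp add: to_torus_eq_iff)
  moreover have "dist (rep_torus z - k) u < e"
    using assms k(2) dist_to_torus[of "rep_torus z" u]
    by (simp add: to_torus_rep dist_norm algebra_simps)
  ultimately show thesis by (rule that)
qed

text \<open>The section jumps only where a coordinate crosses an integer. Excluding the value 0
  avoids the jump: within the distance of the coordinate to both ends 0 and \<open>t\<close>, lifts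
  stay in that interval, where \<open>frac\<close> is the identity.\<close>

lemma open_torus_section_less:
  fixes i :: "'n::finite"
  assumes "t \<le> 1"
  shows "open {z. 0 < torus_section z $ i \<and> torus_section z $ i < t}"
  unfolding open_dist
proof safe
  fix x :: "'n torus" assume x: "0 < torus_section x $ i" "torus_section x $ i < t"
  define u e where "u = torus_section x" and "e = min (u $ i) (t - u $ i)"
  have "0 < torus_section z $ i \<and> torus_section z $ i < t" if "dist z x < e" for z
  proof -
    obtain w where w: "z = to_torus w" "dist w u < e"
      using torus_near_lift[of z u e] \<open>dist z x < e\<close> by (auto simp: u_def)
    have "\<bar>w $ i - u $ i\<bar> < e"
      using w(2) component_le_norm_cart[of "w - u" i] by (simp add: dist_norm)
    then have "0 < w $ i" "w $ i < t" by (auto simp: e_def)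
    moreover from this have "frac (w $ i) = w $ i" using \<open>t \<le> 1\<close> by (simp add: frac_eq)
    ultimately show ?thesis by (simp add: w torus_section_to_torus)
  qed
  moreover have "0 < e" using x by (simp add: e_def u_def)
  ultimately show "\<exists>e>0. \<forall>y. dist y x < e \<longrightarrow> y \<in> {z. 0 < torus_section z $ i \<and> torus_section z $ i < t}"
    by blast
qed

lemma measurable_torus_section_component [measurable]:
  "(\<lambda>x :: 'n::finite torus. torus_section x $ i) \<in> borel_measurable borel"
  unfolding borel_measurable_iff_less
proof safe
  fix t :: real
  consider "t \<le> 0" | "0 < t" "t \<le> 1" | "1 < t" by linarith
  then have "{w :: 'n torus. torus_section w $ i < t} \<in> sets borel"
  proof cases
    case 1
    then have "{w :: 'n torus. torus_section w $ i < t} = {}"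
      by (auto simp: not_less intro: order_trans torus_section_bounds)
    then show ?thesis by simp
  next
    case 2
    \<comment> \<open>Coordinates of the section lie in the interval from 0 to 1, with 1 excluded,
      so the complement on the right is exactly the set where the coordinate vanishes.\<close>
    have "{w :: 'n torus. torus_section w $ i < t} =
        {z. 0 < torus_section z $ i \<and> torus_section z $ i < t} \<union>
        - {z. 0 < torus_section z $ i \<and> torus_section z $ i < 1}"
      using 2 torus_section_bounds[where i = i] by (auto simp: not_less antisym)
    also have "\<dots> \<in> sets borel"
      using 2 by (intro sets.Un borel_open borel_comp open_torus_section_less) auto
    finally show ?thesis .
  next
    case 3
    then have "{w :: 'n torus. torus_section w $ i < t} = UNIV"
      by (auto intro: less_trans torus_section_bounds)
    then show ?thesis by simp
  qed
  then show "{w \<in> space borel. torus_section (w :: 'n torus) $ i < t} \<in> sets borel" by simp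
qed

lemma borel_measurable_vec_lambda:
  fixes f :: "'a \<Rightarrow> real ^ 'n"
  assumes "\<And>i. (\<lambda>x. f x $ i) \<in> borel_measurable M"
  shows "f \<in> borel_measurable M"
  using assms by (subst borel_measurable_euclidean_space) (auto simp: Basis_vec_def inner_axis)

lemma measurable_torus_section [measurable]: "torus_section \<in> borel \<rightarrow>\<^sub>M borel"
  by (rule borel_measurable_vec_lambda) measurable

text \<open>The shortest vector leading from \<open>y\<close> to \<open>x\<close>: minimising over
  the lattice decouples into coordinates, where rounding solves it. Unlike an abstract choice of a
  minimiser, this formula is Borel in both points.\<close>

definition torus_disp :: "'n::finite torus \<Rightarrow> 'n torus \<Rightarrow> real ^ 'n" where
  "torus_disp x y = (\<chi> i. (torus_section x $ i - torus_section y $ i) -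
     of_int (round (torus_section x $ i - torus_section y $ i)))"

lemma measurable_torus_disp [measurable (raw)]:
  assumes [measurable]: "f \<in> M \<rightarrow>\<^sub>M borel" "g \<in> M \<rightarrow>\<^sub>M borel"
  shows "(\<lambda>x. torus_disp (f x) (g x)) \<in> M \<rightarrow>\<^sub>M borel"
  by (rule borel_measurable_vec_lambda) (simp add: torus_disp_def round_def)

lemma torus_shift_to_torus: "torus_shift (to_torus u) v = to_torus (u + v)"
  by transfer simp

lemma torus_shift_eq: "torus_shift x v = to_torus (torus_section x + v)"
  by (metis to_torus_section torus_shift_to_torus)

lemma measurable_torus_shift [measurable (raw)]:
  assumes [measurable]: "f \<in> M \<rightarrow>\<^sub>M borel" "g \<in> M \<rightarrow>\<^sub>M borel"
  shows "(\<lambda>x. torus_shift (f x) (g x)) \<in> M \<rightarrow>\<^sub>M borel"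
  unfolding torus_shift_eq by measurable

lemma torus_shift_shift: "torus_shift (torus_shift x u) v = torus_shift x (u + v)"
  by (simp add: torus_shift_eq[of x] torus_shift_to_torus add.assoc)

lemma dist_torus_shift_le: "dist (torus_shift x u) (torus_shift x v) \<le> norm (u - v)"
  unfolding torus_shift_eq using dist_to_torus_le[of "torus_section x + u" "torus_section x + v"]
  by (simp add: dist_norm)

lemma torus_shift_disp [simp]: "torus_shift y (torus_disp x y) = x"
proof -
  have "to_torus (torus_section y + torus_disp x y) = to_torus (torus_section x)"
    by (rule to_torus_eq_iff[THEN iffD2]) (simp add: int_lattice_def torus_disp_def)
  then show ?thesis by (simp add: torus_shift_eq)
qed

lemma norm_torus_disp: "norm (torus_disp x y) = dist x y"
proof (rule antisym)
  let ?u = "torus_section x - torus_section y"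
  have eq: "dist x y = infdist ?u int_lattice"
    using dist_to_torus[of "torus_section x" "torus_section y"] by simp
  obtain k where k: "k \<in> int_lattice" "infdist ?u int_lattice = dist ?u k"
    using infdist_attains_inf[OF closed_int_lattice, of ?u] by auto
  have "norm (torus_disp x y) \<le> norm (?u - k)"
  proof (rule norm_le_componentwise_cart)
    fix i
    obtain m where "k $ i = of_int m" using k(1) by (auto simp: int_lattice_def elim!: Ints_cases)
    then show "norm (torus_disp x y $ i) \<le> norm ((?u - k) $ i)"
      using round_diff_minimal[of "?u $ i" m] by (simp add: torus_disp_def)
  qed
  then show "norm (torus_disp x y) \<le> dist x y" by (simp add: eq k dist_norm)
  show "dist x y \<le> norm (torus_disp x y)"
    using dist_torus_shift_le[of y "torus_disp x y" 0] by (simp add: torus_shift_eq[of y 0])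
qed

lemma torus_disp_component: "\<bar>torus_disp x y $ i\<bar> \<le> 1 / 2"
  using of_int_round_abs_le[of "torus_section x $ i - torus_section y $ i"]
  by (simp add: torus_disp_def abs_minus_commute)

text \<open>A crude bound of the diameter. It limits the range on which the slope of
  \<open>Phi0\<close> has to be bounded below, and it controls the oscillation of the killing
  rate.\<close>

lemma dist_torus_le_card: "dist x (y :: 'n::finite torus) \<le> real CARD('n)"
proof -
  have "norm (torus_disp x y) \<le> (\<Sum>i\<in>UNIV. \<bar>torus_disp x y $ i\<bar>)" by (rule norm_le_l1_cart)
  also have "\<dots> \<le> (\<Sum>i\<in>(UNIV :: 'n set). 1)"
    by (intro sum_mono order_trans[OF torus_disp_component]) simp
  finally show ?thesis by (simp add: norm_torus_disp)
qed

lemma measurable_dist_torus [measurable (raw)]: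
  fixes f g :: "'a \<Rightarrow> 'n::finite torus"
  assumes [measurable]: "f \<in> M \<rightarrow>\<^sub>M borel" "g \<in> M \<rightarrow>\<^sub>M borel"
  shows "(\<lambda>x. dist (f x) (g x)) \<in> borel_measurable M"
  unfolding norm_torus_disp[symmetric] by measurable

text \<open>By periodicity, a bound of the derivative on one compact box is global. The lift
  \<open>torus_section y\<close> lies in the unit cube and
  \<open>torus_section y + torus_disp x y\<close> is within 1/2 of it in each coordinate, so both
  are in the convex box with sides from -1 to 2, and their difference has norm exactly
  \<open>dist x y\<close>.\<close>

lemma torus_C1_lipschitz:
  fixes b :: "'n::finite torus \<Rightarrow> real ^ 'n"
  assumes "torus_C1 b"
  obtains L where "0 \<le> L" "\<And>x y. norm (b x - b y) \<le> L * dist x y"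
proof -
  obtain D :: "real ^ 'n \<Rightarrow> (real ^ 'n) \<Rightarrow>\<^sub>L (real ^ 'n)"
    where D: "\<And>x. ((\<lambda>y. b (to_torus y)) has_derivative blinfun_apply (D x)) (at x)"
      and cont: "continuous_on UNIV D"
    using assms unfolding torus_C1_def by blast
  let ?Q = "cbox (\<chi> i. -1) (\<chi> i. 2) :: (real ^ 'n) set"
  have "compact (D ` ?Q)"
    by (intro compact_continuous_image continuous_on_subset[OF cont]) auto
  then obtain L where L: "\<And>x. x \<in> ?Q \<Longrightarrow> norm (D x) \<le> L"
    using compact_imp_bounded bounded_iff by (metis imageI)
  have "norm (b x - b y) \<le> max L 0 * dist x y" for x y
  proof -
    let ?u = "torus_section y + torus_disp x y" and ?v = "torus_section y"
    have comp: "?v $ i \<ge> 0" "?v $ i < 1" "\<bar>torus_disp x y $ i\<bar> \<le> 1 / 2" for i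
      by (fact torus_section_bounds torus_disp_component)+
    have u: "- 1 \<le> ?u $ i \<and> ?u $ i \<le> 2" "- 1 \<le> ?v $ i \<and> ?v $ i \<le> 2" for i
      using comp[of i] unfolding vector_add_component by arith+
    have uv: "?u \<in> ?Q" "?v \<in> ?Q"
      using u by (simp_all add: mem_box_cart)
    have "norm (b (to_torus ?u) - b (to_torus ?v)) \<le> max L 0 * norm (?u - ?v)"
    proof (rule differentiable_bound[OF convex_box(1)])
      show "onorm (blinfun_apply (D z)) \<le> max L 0" if "z \<in> ?Q" for z
        using L[OF that] by (simp add: norm_blinfun.rep_eq)
    qed (use uv D has_derivative_at_withinI in \<open>blast+\<close>)
    then show ?thesis
      by (simp add: norm_torus_disp flip: torus_shift_eq)
  qed
  then show thesis by (intro that[of "max L 0"]) auto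
qed

section \<open>Reflection coupling of Gaussian measures\<close>

definition mirror :: "'a::euclidean_space \<Rightarrow> 'a \<Rightarrow> 'a" where
  "mirror h z = z - (2 * (z \<bullet> h) / (h \<bullet> h)) *\<^sub>R h"

lemma mirror_add: "mirror h (x + y) = mirror h x + mirror h y"
  by (simp add: mirror_def inner_add_left add_divide_distrib distrib_left algebra_simps)

lemma mirror_mirror [simp]: "mirror h (mirror h x) = x"
  by (cases "h = 0") (simp_all add: mirror_def inner_diff_left algebra_simps)

lemma mirror_self [simp]: "mirror h h = - h"
  by (cases "h = 0") (simp_all add: mirror_def scaleR_2)

lemma norm_mirror [simp]: "norm (mirror h x) = norm x"
proof (cases "h = 0")
  case False
  have "mirror h x \<bullet> mirror h x = x \<bullet> x"
    using False by (simp add: mirror_def inner_diff_left inner_diff_right field_simps inner_commute)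
  then show ?thesis by (simp add: norm_eq_sqrt_inner)
qed (simp add: mirror_def)

lemma mirror_inner: "mirror h x \<bullet> y = x \<bullet> mirror h y"
  by (simp add: mirror_def inner_diff_left inner_diff_right inner_commute)

text \<open>The hyperplane orthogonal to \<open>x - y\<close> bisects the angle between vectors of
  equal length. This gives an isometry from any unit vector to a coordinate vector without
  constructing a rotation.\<close>

lemma mirror_swap:
  assumes "norm x = norm y"
  shows "mirror (x - y) x = y"
proof (cases "x = y")
  case False
  have xx: "x \<bullet> x = y \<bullet> y" using assms by (simp add: norm_eq)
  have d: "(x - y) \<bullet> (x - y) = 2 * (x \<bullet> (x - y))"
    by (simp add: inner_diff_left inner_diff_right inner_commute xx)
  have "(x - y) \<bullet> (x - y) \<noteq> 0" using False by simp
  with d have "2 * (x \<bullet> (x - y)) / ((x - y) \<bullet> (x - y)) = 1" by (metis divide_self)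
  then show ?thesis unfolding mirror_def by (simp only: scaleR_one) simp
qed (simp add: mirror_def)

lemma measurable_mirror [measurable (raw)]:
  fixes f g :: "'b \<Rightarrow> 'a::euclidean_space"
  assumes [measurable]: "f \<in> borel_measurable M" "g \<in> borel_measurable M"
  shows "(\<lambda>x. mirror (f x) (g x)) \<in> borel_measurable M"
  unfolding mirror_def by measurable

lemma nn_integral_lborel_plus:
  fixes f :: "'a::euclidean_space \<Rightarrow> ennreal"
  assumes [measurable]: "f \<in> borel_measurable borel"
  shows "(\<integral>\<^sup>+x. f (x + c) \<partial>lborel) = (\<integral>\<^sup>+x. f x \<partial>lborel)"
proof -
  have "(\<integral>\<^sup>+x. f x \<partial>lborel) = (\<integral>\<^sup>+x. f x \<partial>distr lborel borel ((+) c))"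
    by (simp add: lborel_distr_plus)
  also have "\<dots> = (\<integral>\<^sup>+x. f (x + c) \<partial>lborel)"
    by (subst nn_integral_distr) (simp_all add: add.commute)
  finally show ?thesis by simp
qed

lemma nn_integral_lborel_uminus:
  fixes f :: "'a::euclidean_space \<Rightarrow> ennreal"
  assumes [measurable]: "f \<in> borel_measurable borel"
  shows "(\<integral>\<^sup>+x. f (- x) \<partial>lborel) = (\<integral>\<^sup>+x. f x \<partial>lborel)"
  by (subst (2) lborel_affine[of "-1" 0]) (simp_all add: nn_integral_density nn_integral_distr)

text \<open>
  The image of Lebesgue measure is translation invariant, so by Fubini's theorem it is a multiple
  of Lebesgue measure; the unit ball shows that the factor is one.
\<close>

lemma nn_integral_lborel_mirror:
  fixes f :: "'a::euclidean_space \<Rightarrow> ennreal"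
  assumes [measurable]: "f \<in> borel_measurable borel"
  shows "(\<integral>\<^sup>+x. f (mirror h x) \<partial>lborel) = (\<integral>\<^sup>+x. f x \<partial>lborel)"
proof -
  let ?T = "mirror h"
  define g :: "'a \<Rightarrow> ennreal" where "g = indicator (ball 0 1)"
  have [measurable]: "g \<in> borel_measurable borel" unfolding g_def by (intro borel_measurable_indicator) auto
  have gT: "g (?T x) = g x" for x by (simp add: g_def indicator_def)
  define c where "c = (\<integral>\<^sup>+x. g x \<partial>lborel)"
  have c: "c = emeasure lborel (ball (0 :: 'a) 1)" by (simp add: c_def g_def)
  have fin: "c \<noteq> \<infinity>" using emeasure_lborel_ball_finite[of "0 :: 'a" 1] by (simp add: c)
  have "\<not> negligible (ball (0 :: 'a) 1)" by (simp add: open_not_negligible)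
  then have pos: "c \<noteq> 0"
    by (simp add: c negligible_iff_null_sets null_sets_completion_iff null_sets_def)
  have "(\<integral>\<^sup>+x. f (?T x) \<partial>lborel) * c = (\<integral>\<^sup>+x. f (?T x) * (\<integral>\<^sup>+y. g (y + ?T x) \<partial>lborel) \<partial>lborel)"
    by (simp add: nn_integral_lborel_plus c_def nn_integral_multc)
  also have "\<dots> = (\<integral>\<^sup>+x. \<integral>\<^sup>+y. f (?T x) * g (y + ?T x) \<partial>lborel \<partial>lborel)"
    by (simp add: nn_integral_cmult)
  also have "\<dots> = (\<integral>\<^sup>+y. \<integral>\<^sup>+x. f (?T x) * g (y + ?T x) \<partial>lborel \<partial>lborel)"
    by (rule lborel_pair.Fubini') measurable
  \<comment> \<open>With T the reflection, replacing x by x + T (- y) turns T x into T x - y and y +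
    T x into T x, so \<open>y\<close> moves from the argument of \<open>g\<close> to that of
    \<open>f\<close>. Since the ball is invariant under T, what remains of the other factor is
    \<open>g x\<close>.\<close>
  also have "\<dots> = (\<integral>\<^sup>+y. \<integral>\<^sup>+x. f (?T (x + ?T (- y))) * g (y + ?T (x + ?T (- y))) \<partial>lborel \<partial>lborel)"
    by (subst nn_integral_lborel_plus[where f = "\<lambda>x. f (?T x) * g (_ + ?T x)"]) simp_all
  also have "\<dots> = (\<integral>\<^sup>+y. \<integral>\<^sup>+x. f (?T x - y) * g x \<partial>lborel \<partial>lborel)"
    by (simp add: mirror_add gT)
  also have "\<dots> = (\<integral>\<^sup>+x. \<integral>\<^sup>+y. f (?T x - y) * g x \<partial>lborel \<partial>lborel)"
    by (rule lborel_pair.Fubini') measurable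
  also have "\<dots> = (\<integral>\<^sup>+x. (\<integral>\<^sup>+y. f (- y + ?T x) \<partial>lborel) * g x \<partial>lborel)"
    by (simp add: nn_integral_multc)
  also have "(\<lambda>x. \<integral>\<^sup>+y. f (- y + ?T x) \<partial>lborel) = (\<lambda>x. \<integral>\<^sup>+y. f y \<partial>lborel)"
    by (subst nn_integral_lborel_uminus[where f = "\<lambda>y. f (y + _)"])
       (simp_all add: nn_integral_lborel_plus)
  also have "(\<integral>\<^sup>+x. (\<integral>\<^sup>+y. f y \<partial>lborel) * g x \<partial>lborel) = (\<integral>\<^sup>+y. f y \<partial>lborel) * c"
    by (simp add: nn_integral_cmult c_def)
  finally have "c * (\<integral>\<^sup>+x. f (?T x) \<partial>lborel) = c * (\<integral>\<^sup>+x. f x \<partial>lborel)"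
    by (simp only: mult.commute)
  then show ?thesis using fin pos unfolding ennreal_mult_cancel_left by auto
qed

section \<open>The standard Gaussian measure and its one-dimensional projections\<close>

definition gauss_density :: "real ^ 'n::finite \<Rightarrow> real" where
  "gauss_density y = (2 * pi) powr (- (real CARD('n) / 2)) * exp (- (norm y)\<^sup>2 / 2)"

lemma gauss_density_nonneg [simp]: "0 \<le> gauss_density y"
  by (simp add: gauss_density_def)

lemma measurable_gauss_density [measurable]: "gauss_density \<in> borel_measurable borel"
  unfolding gauss_density_def[abs_def] by measurable

lemma std_gaussian_eq: "std_gaussian = density lborel (\<lambda>y. ennreal (gauss_density y))"
  by (simp add: std_gaussian_def gauss_density_def)

lemma sets_std_gaussian [simp, measurable_cong]: "sets std_gaussian = sets borel"
  by (simp add: std_gaussian_def)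

lemma space_std_gaussian [simp]: "space std_gaussian = UNIV"
  by (simp add: std_gaussian_def)

lemma gauss_density_prod: "gauss_density y = (\<Prod>i\<in>Basis. std_normal_density (y \<bullet> i))"
proof -
  have *: "- (\<Sum>i\<in>Basis. (y \<bullet> i)\<^sup>2) / 2 = (\<Sum>i\<in>Basis. - (y \<bullet> i)\<^sup>2 / 2)"
    by (simp add: sum_negf sum_divide_distrib)
  have "(\<Prod>i\<in>Basis. std_normal_density (y \<bullet> i)) =
      (1 / sqrt (2 * pi)) ^ CARD('a) * exp (- (\<Sum>i\<in>Basis. (y \<bullet> i)\<^sup>2) / 2)"
    unfolding std_normal_density_def prod.distrib * exp_sum[OF finite_Basis]
    by (simp only: prod_constant DIM_cart DIM_real mult_1_right)
  also have "(\<Sum>i\<in>Basis. (y \<bullet> i)\<^sup>2) = (norm y)\<^sup>2"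
    unfolding power2_norm_eq_inner euclidean_inner[of y y] by (simp add: power2_eq_square)
  also have "(1 / sqrt (2 * pi)) = (2 * pi) powr (- (1 / 2))"
    unfolding powr_minus_divide by (subst powr_half_sqrt) simp_all
  also have "((2 * pi) powr (- (1 / 2))) ^ CARD('a) = ((2 * pi) powr (- (1 / 2))) powr real CARD('a)"
    by (rule powr_realpow[symmetric]) simp
  also have "\<dots> = (2 * pi) powr (- (real CARD('a) / 2))"
    unfolding powr_powr by (rule arg_cong) simp
  finally show ?thesis by (simp add: gauss_density_def)
qed

lemma nn_integral_std_normal: "(\<integral>\<^sup>+x. ennreal (std_normal_density x) \<partial>lborel) = 1"
  by (subst nn_integral_eq_integral) auto

text \<open>The density is a product over coordinates, so the integral factorises and every
  coordinate other than \<open>c\<close> contributes one.\<close>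

lemma nn_integral_std_gaussian_Basis:
  fixes f :: "real \<Rightarrow> ennreal" and c :: "real ^ 'n::finite"
  assumes [measurable]: "f \<in> borel_measurable borel" and c: "c \<in> Basis"
  shows "(\<integral>\<^sup>+z. f (z \<bullet> c) \<partial>std_gaussian) = (\<integral>\<^sup>+t. ennreal (std_normal_density t) * f t \<partial>lborel)"
proof -
  let ?g = "\<lambda>i t. ennreal (std_normal_density t) * (if i = c then f t else 1)"
  have *: "ennreal (gauss_density z) * f (z \<bullet> c) = (\<Prod>i\<in>Basis. ?g i (z \<bullet> i))" for z
    using c by (simp add: gauss_density_prod prod_ennreal[symmetric] prod.distrib)
  have "(\<integral>\<^sup>+z. f (z \<bullet> c) \<partial>std_gaussian) = (\<integral>\<^sup>+z. (\<Prod>i\<in>Basis. ?g i (z \<bullet> i)) \<partial>lborel)"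
    by (simp add: std_gaussian_eq nn_integral_density * )
  also have "\<dots> = (\<Prod>i\<in>Basis. \<integral>\<^sup>+t. ?g i t \<partial>lborel)"
    by (rule nn_integral_lborel_prod) auto
  also have "\<dots> = (\<integral>\<^sup>+t. ?g c t \<partial>lborel) * (\<Prod>i\<in>Basis - {c}. \<integral>\<^sup>+t. ?g i t \<partial>lborel)"
    using c by (simp add: prod.remove)
  also have "(\<Prod>i\<in>Basis - {c}. \<integral>\<^sup>+t. ?g i t \<partial>lborel) = 1"
    by (intro prod.neutral) (simp add: nn_integral_std_normal)
  finally show ?thesis by simp
qed

lemma nn_integral_std_gaussian_mirror:
  fixes f :: "real ^ 'n::finite \<Rightarrow> ennreal"
  assumes [measurable]: "f \<in> borel_measurable borel"
  shows "(\<integral>\<^sup>+z. f (mirror h z) \<partial>std_gaussian) = (\<integral>\<^sup>+z. f z \<partial>std_gaussian)"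
proof -
  have "(\<integral>\<^sup>+z. f (mirror h z) \<partial>std_gaussian) =
      (\<integral>\<^sup>+z. ennreal (gauss_density (mirror h z)) * f (mirror h z) \<partial>lborel)"
    by (simp add: std_gaussian_eq nn_integral_density gauss_density_def)
  also have "\<dots> = (\<integral>\<^sup>+z. f z \<partial>std_gaussian)"
    by (subst nn_integral_lborel_mirror) (simp_all add: std_gaussian_eq nn_integral_density)
  finally show ?thesis .
qed

text \<open>Reflecting \<open>e\<close> onto a basis vector preserves the measure, so the projection
  onto any unit direction has the law of a coordinate.\<close>

lemma nn_integral_std_gaussian_inner:
  fixes f :: "real \<Rightarrow> ennreal" and e :: "real ^ 'n::finite"
  assumes [measurable]: "f \<in> borel_measurable borel" and e: "norm e = 1"
  shows "(\<integral>\<^sup>+z. f (z \<bullet> e) \<partial>std_gaussian) = (\<integral>\<^sup>+t. f t \<partial>std_normal_distribution)"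
proof -
  obtain c :: "real ^ 'n" where c: "c \<in> Basis" using nonempty_Basis by blast
  have "(\<integral>\<^sup>+z. f (z \<bullet> e) \<partial>std_gaussian) = (\<integral>\<^sup>+z. f (mirror (e - c) z \<bullet> e) \<partial>std_gaussian)"
    by (subst nn_integral_std_gaussian_mirror) simp_all
  also have "\<dots> = (\<integral>\<^sup>+z. f (z \<bullet> c) \<partial>std_gaussian)"
    using c e by (simp add: mirror_inner mirror_swap)
  also have "\<dots> = (\<integral>\<^sup>+t. f t \<partial>std_normal_distribution)"
    using c by (simp add: nn_integral_std_gaussian_Basis nn_integral_density)
  finally show ?thesis .
qed

lemma prob_space_std_gaussian: "prob_space (std_gaussian :: (real ^ 'n::finite) measure)"
proof
  obtain c :: "real ^ 'n" where c: "c \<in> Basis" using nonempty_Basis by blast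
  show "emeasure (std_gaussian :: (real ^ 'n) measure) (space std_gaussian) = 1"
    using nn_integral_std_gaussian_Basis[of "\<lambda>_. 1" c] c by (simp add: nn_integral_std_normal)
qed

lemma distr_std_gaussian_inner:
  fixes e :: "real ^ 'n::finite"
  assumes "norm e = 1"
  shows "distr std_gaussian borel (\<lambda>z. z \<bullet> e) = std_normal_distribution"
proof (rule measure_eqI)
  fix A assume "A \<in> sets (distr std_gaussian borel (\<lambda>z. z \<bullet> e))"
  then have A [measurable]: "A \<in> sets borel" by simp
  have "emeasure (distr std_gaussian borel (\<lambda>z. z \<bullet> e)) A = (\<integral>\<^sup>+z. indicator A (z \<bullet> e) \<partial>std_gaussian)"
    by (subst nn_integral_indicator[symmetric], simp, subst nn_integral_distr) simp_all
  also have "\<dots> = emeasure std_normal_distribution A"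
    by (subst nn_integral_std_gaussian_inner[OF _ assms]) simp_all
  finally show "emeasure (distr std_gaussian borel (\<lambda>z. z \<bullet> e)) A = emeasure std_normal_distribution A" .
qed simp

section \<open>The coalescing reflection of the noise\<close>

abbreviation unit_unif :: "real measure" where
  "unit_unif \<equiv> uniform_measure lborel {0..1}"

lemma prob_space_unit_unif: "prob_space unit_unif"
  by (rule prob_space_uniform_measure) auto

lemma sets_unit_unif [measurable_cong]: "sets unit_unif = sets borel"
  by simp

lemma nn_integral_unit_threshold:
  assumes "0 \<le> r" "r \<le> 1"
  shows "(\<integral>\<^sup>+u. (if u \<le> r then a else b) \<partial>unit_unif) = ennreal r * a + ennreal (1 - r) * b"
proof -
  have div1: "x / 1 = x" for x :: ennreal by (simp add: divide_ennreal_def)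
  have "(\<integral>\<^sup>+u. (if u \<le> r then a else b) \<partial>unit_unif) =
      (\<integral>\<^sup>+u. (if u \<le> r then a else b) * indicator {0..1} u \<partial>lborel)"
    by (subst nn_integral_uniform_measure) (auto simp: div1)
  also have "\<dots> = (\<integral>\<^sup>+u. a * indicator {0..r} u + b * indicator {r<..1} u \<partial>lborel)"
    using assms by (intro nn_integral_cong) (auto simp: indicator_def)
  also have "\<dots> = ennreal r * a + ennreal (1 - r) * b"
    using assms by (subst nn_integral_add) (auto simp: nn_integral_cmult_indicator mult.commute)
  finally show ?thesis .
qed

text \<open>The noise of the second chain when \<open>z\<close> is that of the first and
  \<open>h\<close> is the rescaled gap between the means. The exponential is the ratio of the
  Gaussian densities at \<open>z + h\<close> and \<open>z\<close>. Choosing \<open>z + h\<close>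
  makes the chains meet; otherwise the noise is reflected. A ratio above one means that they meet
  almost surely, as \<open>u\<close> is uniform on the unit interval.\<close>

definition reflect_noise :: "'a::euclidean_space \<Rightarrow> 'a \<Rightarrow> real \<Rightarrow> 'a" where
  "reflect_noise h z u = (if u \<le> exp (- (z \<bullet> h) - (norm h)\<^sup>2 / 2) then z + h else mirror h z)"

lemma measurable_reflect_noise [measurable (raw)]:
  fixes f g :: "'b \<Rightarrow> 'a::euclidean_space"
  assumes [measurable]: "f \<in> borel_measurable M" "g \<in> borel_measurable M" "k \<in> borel_measurable M"
  shows "(\<lambda>x. reflect_noise (f x) (g x) (k x)) \<in> borel_measurable M"
  unfolding reflect_noise_def by measurable

lemma gauss_density_shift:
  "gauss_density (z + h) = gauss_density z * exp (- (z \<bullet> h) - (norm h)\<^sup>2 / 2)"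
proof -
  have "- (norm (z + h))\<^sup>2 / 2 = - (norm z)\<^sup>2 / 2 + (- (z \<bullet> h) - (norm h)\<^sup>2 / 2)"
    by (simp add: power2_norm_eq_inner inner_add_left inner_add_right inner_commute field_simps)
  then show ?thesis by (simp only: gauss_density_def exp_add mult.assoc)
qed

text \<open>
  The mass that stays put when \<open>z\<close> is moved to \<open>z + h\<close> is the overlap of the two densities; the
  mirror image exchanges the remaining parts.
\<close>

lemma nn_integral_reflect_noise:
  fixes f :: "real ^ 'n::finite \<Rightarrow> ennreal"
  assumes [measurable]: "f \<in> borel_measurable borel"
  shows "(\<integral>\<^sup>+z. \<integral>\<^sup>+u. f (reflect_noise h z u) \<partial>unit_unif \<partial>std_gaussian) = (\<integral>\<^sup>+z. f z \<partial>std_gaussian)"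
proof -
  define m where "m z = min 1 (exp (- (z \<bullet> h) - (norm h)\<^sup>2 / 2))" for z
  let ?\<phi> = gauss_density
  have [measurable]: "m \<in> borel_measurable borel" unfolding m_def by measurable
  have m: "0 \<le> m z" "m z \<le> 1" for z by (auto simp: m_def)
  have pm: "?\<phi> z * m z = min (?\<phi> z) (?\<phi> (z + h))" for z
    unfolding m_def gauss_density_shift by (simp add: min_mult_distrib_left)
  have inner: "(\<integral>\<^sup>+u. f (reflect_noise h z u) \<partial>unit_unif) =
      ennreal (m z) * f (z + h) + ennreal (1 - m z) * f (mirror h z)" for z
  proof -
    have "(\<integral>\<^sup>+u. f (reflect_noise h z u) \<partial>unit_unif) =
        (\<integral>\<^sup>+u. (if u \<le> m z then f (z + h) else f (mirror h z)) \<partial>unit_unif)"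
      by (intro nn_integral_cong_AE AE_uniform_measureI) (auto simp: reflect_noise_def m_def)
    then show ?thesis using m by (simp add: nn_integral_unit_threshold)
  qed
  have "(\<integral>\<^sup>+z. \<integral>\<^sup>+u. f (reflect_noise h z u) \<partial>unit_unif \<partial>std_gaussian) =
      (\<integral>\<^sup>+z. ennreal (min (?\<phi> z) (?\<phi> (z + h))) * f (z + h) +
        ennreal (?\<phi> z - min (?\<phi> z) (?\<phi> (z + h))) * f (mirror h z) \<partial>lborel)"
    unfolding inner std_gaussian_eq
    by (subst nn_integral_density)
       (auto simp: distrib_left mult.assoc[symmetric] ennreal_mult'[symmetric] right_diff_distrib pm
             intro!: nn_integral_cong)
  also have "\<dots> = (\<integral>\<^sup>+z. ennreal (min (?\<phi> z) (?\<phi> (z + h))) * f (z + h) \<partial>lborel) +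
      (\<integral>\<^sup>+z. ennreal (?\<phi> z - min (?\<phi> z) (?\<phi> (z + h))) * f (mirror h z) \<partial>lborel)"
    by (rule nn_integral_add) measurable
  also have "(\<integral>\<^sup>+z. ennreal (min (?\<phi> z) (?\<phi> (z + h))) * f (z + h) \<partial>lborel) =
      (\<integral>\<^sup>+z. ennreal (min (?\<phi> (z - h)) (?\<phi> z)) * f z \<partial>lborel)"
    by (subst nn_integral_lborel_plus[symmetric, where c = h]) simp_all
  \<comment> \<open>The reflection preserves norms and sends \<open>h\<close> to \<open>- h\<close>,
    so the leftover density at \<open>z\<close> equals the one at \<open>mirror h z\<close> with the
    opposite shift. The whole integrand thereby becomes a function of
    \<open>mirror h z\<close>.\<close>
  also have "(\<integral>\<^sup>+z. ennreal (?\<phi> z - min (?\<phi> z) (?\<phi> (z + h))) * f (mirror h z) \<partial>lborel) =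
      (\<integral>\<^sup>+z. ennreal (?\<phi> (mirror h z) - min (?\<phi> (mirror h z - h)) (?\<phi> (mirror h z))) * f (mirror h z) \<partial>lborel)"
  proof -
    have "mirror h z - h = mirror h (z + h)" for z by (simp add: mirror_add)
    then show ?thesis by (simp add: gauss_density_def min.commute)
  qed
  also have "\<dots> = (\<integral>\<^sup>+z. ennreal (?\<phi> z - min (?\<phi> (z - h)) (?\<phi> z)) * f z \<partial>lborel)"
    by (subst nn_integral_lborel_mirror) simp_all
  also have "(\<integral>\<^sup>+z. ennreal (min (?\<phi> (z - h)) (?\<phi> z)) * f z \<partial>lborel) + \<dots> =
      (\<integral>\<^sup>+z. ennreal (?\<phi> z) * f z \<partial>lborel)"
    by (subst nn_integral_add[symmetric])
       (auto simp: distrib_right[symmetric] ennreal_plus[symmetric] simp del: ennreal_plus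
             intro!: nn_integral_cong)
  also have "\<dots> = (\<integral>\<^sup>+z. f z \<partial>std_gaussian)" by (simp add: std_gaussian_eq nn_integral_density)
  finally show ?thesis .
qed

lemma distr_reflect_noise:
  "distr (std_gaussian \<Otimes>\<^sub>M unit_unif) borel (\<lambda>(z, u). reflect_noise h z u) = (std_gaussian :: (real ^ 'n::finite) measure)"
proof (rule measure_eqI)
  interpret U: prob_space unit_unif by (rule prob_space_unit_unif)
  let ?D = "distr (std_gaussian \<Otimes>\<^sub>M unit_unif) borel (\<lambda>(z, u). reflect_noise h z u)"
  fix A :: "(real ^ 'n) set" assume "A \<in> sets ?D"
  then have A [measurable]: "A \<in> sets borel" by simp
  have "emeasure ?D A = (\<integral>\<^sup>+w. indicator A (reflect_noise h (fst w) (snd w)) \<partial>(std_gaussian \<Otimes>\<^sub>M unit_unif))"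
    by (subst nn_integral_indicator[symmetric], simp, subst nn_integral_distr) (simp_all add: split_beta')
  also have "\<dots> = (\<integral>\<^sup>+z. \<integral>\<^sup>+u. indicator A (reflect_noise h z u) \<partial>unit_unif \<partial>std_gaussian)"
    by (subst U.nn_integral_fst[symmetric]) simp_all
  also have "\<dots> = emeasure std_gaussian A"
    by (subst nn_integral_reflect_noise) simp_all
  finally show "emeasure ?D A = emeasure std_gaussian A" .
qed simp

section \<open>The centred normal distribution function\<close>

definition Phi0 :: "real \<Rightarrow> real" where
  "Phi0 t = cdf std_normal_distribution t - 1 / 2"

interpretation std_normal: real_distribution std_normal_distribution
  by (rule real_dist_normal_dist)

lemma measure_std_normal:
  assumes [measurable]: "A \<in> sets borel"
  shows "measure std_normal_distribution A = (LINT x|lborel. std_normal_density x * indicator A x)"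
proof -
  have "measure std_normal_distribution A = (LINT x|std_normal_distribution. indicator A x)" by simp
  also have "\<dots> = (LINT x|lborel. std_normal_density x * indicator A x)"
    by (subst integral_density) (simp_all add: normal_density_nonneg)
  finally show ?thesis .
qed

lemma integrable_std_normal_bounded:
  fixes f :: "real \<Rightarrow> real"
  assumes [measurable]: "f \<in> borel_measurable borel" and "\<And>x. \<bar>f x\<bar> \<le> B"
  shows "integrable lborel (\<lambda>x. std_normal_density x * f x)"
proof (rule Bochner_Integration.integrable_bound)
  show "integrable lborel (\<lambda>x. B * std_normal_density x)" by simp
  show "AE x in lborel. norm (std_normal_density x * f x) \<le> norm (B * std_normal_density x)"
    using assms(2) by (auto simp: abs_mult mult.commute[of B] intro!: AE_I2 mult_left_mono intro: order_trans[OF _ abs_ge_self])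
qed simp

lemma Phi0_minus: "Phi0 (- t) = - Phi0 t"
proof -
  let ?\<phi> = std_normal_density
  have int: "integrable lborel (\<lambda>x. ?\<phi> x * indicator A x)" if "A \<in> sets borel" for A
    using that by (intro integrable_std_normal_bounded[where B = 1]) (auto simp: indicator_def)
  have "measure std_normal_distribution {..- t} = (LINT x|lborel. ?\<phi> x * indicator {t..} x)"
    unfolding measure_std_normal[OF lessThan_borel] measure_std_normal[OF atMost_borel]
    by (subst lborel_integral_real_affine[where c = "-1" and t = 0])
       (auto simp: std_normal_density_def indicator_def intro!: Bochner_Integration.integral_cong)
  moreover have "measure std_normal_distribution {..t} = (LINT x|lborel. ?\<phi> x * indicator {..t} x)"
    by (rule measure_std_normal) simp
  moreover have "(LINT x|lborel. ?\<phi> x * indicator {t..} x) + (LINT x|lborel. ?\<phi> x * indicator {..t} x) =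
      (LINT x|lborel. ?\<phi> x * indicator {t..} x + ?\<phi> x * indicator {..t} x)"
    by (intro Bochner_Integration.integral_add[symmetric] int) auto
  \<comment> \<open>The two half-lines overlap only in the null set consisting of \<open>t\<close>,
    so their probabilities add up to the total mass.\<close>
  moreover have "\<dots> = (LINT x|lborel. ?\<phi> x)"
    using AE_lborel_singleton[of t]
    by (intro integral_cong_AE) (auto simp: indicator_def elim!: eventually_mono)
  ultimately show ?thesis by (simp add: Phi0_def cdf_def)
qed

lemma Phi0_0 [simp]: "Phi0 0 = 0"
  using Phi0_minus[of 0] by simp

lemma has_derivative_Phi0: "(Phi0 has_real_derivative std_normal_density t) (at t)"
proof -
  let ?\<phi> = std_normal_density
  let ?a = "t - 1" and ?b = "t + 1"
  have "((\<lambda>u. LBINT y=ereal ?a..ereal u. ?\<phi> y) has_vector_derivative ?\<phi> t) (at t within {?a..?b})"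
    by (rule interval_integral_FTC2) (auto simp: std_normal_density_def intro!: continuous_intros)
  then have "((\<lambda>u. LBINT y=ereal ?a..ereal u. ?\<phi> y) has_real_derivative ?\<phi> t) (at t within {?a..?b})"
    by (simp add: has_real_derivative_iff_has_vector_derivative)
  then have "((\<lambda>u. (LBINT y=ereal ?a..ereal u. ?\<phi> y) + Phi0 ?a) has_real_derivative ?\<phi> t + 0) (at t within {?a..?b})"
    by (intro DERIV_add) auto
  then have D: "((\<lambda>u. (LBINT y=ereal ?a..ereal u. ?\<phi> y) + Phi0 ?a) has_real_derivative ?\<phi> t) (at t)"
    by (subst (asm) at_within_interior) (auto simp: interior_cbox)
  have "(LBINT y=ereal ?a..ereal u. ?\<phi> y) + Phi0 ?a = Phi0 u" if "?a < u" for u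
  proof -
    have "(LBINT y=ereal ?a..ereal u. ?\<phi> y) = measure std_normal_distribution {?a<..u}"
      using that by (simp add: interval_integral_Ioc measure_std_normal set_lebesgue_integral_def mult.commute)
    then show ?thesis using std_normal.cdf_diff_eq[OF that] by (simp add: Phi0_def)
  qed
  then show ?thesis
    by (intro has_field_derivative_transform_within_open[OF D, of "{?a<..}"]) auto
qed

lemma std_normal_density_mono: "0 \<le> s \<Longrightarrow> s \<le> t \<Longrightarrow> std_normal_density t \<le> std_normal_density s"
  by (simp add: std_normal_density_def divide_right_mono power_mono)

lemma std_normal_density_le_1: "std_normal_density t \<le> 1"
proof -
  have "1 \<le> sqrt (2 * pi)" using pi_gt3 by (simp add: real_le_rsqrt)
  then have "1 / sqrt (2 * pi) * exp (- t\<^sup>2 / 2) \<le> 1 * 1"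
    by (intro mult_mono) (auto simp: divide_le_eq_1)
  then show ?thesis by (simp add: std_normal_density_def)
qed

lemma Phi0_strict_mono: "s < t \<Longrightarrow> Phi0 s < Phi0 t"
  by (rule DERIV_pos_imp_increasing) (auto intro!: exI has_derivative_Phi0 normal_density_pos)

lemma Phi0_mono: "s \<le> t \<Longrightarrow> Phi0 s \<le> Phi0 t"
  using Phi0_strict_mono[of s t] by (cases "s = t") auto

lemma Phi0_bounds: "\<bar>Phi0 t\<bar> \<le> 1 / 2"
  using std_normal.cdf_bounded_prob[of t] std_normal.cdf_nonneg[of t] by (simp add: Phi0_def abs_if)

lemma Phi0_nonneg: "0 \<le> t \<Longrightarrow> 0 \<le> Phi0 t"
  using Phi0_mono[of 0 t] by simp

lemma measurable_Phi0 [measurable]: "Phi0 \<in> borel_measurable borel"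
  by (rule borel_measurable_mono) (auto simp: mono_def Phi0_mono)

text \<open>Concavity on the half-line: the increment over a window of length \<open>t\<close>
  decreases as the window moves to the right, because the density does. This is the source of the
  triangle inequality for the cost.\<close>

lemma Phi0_subadditive:
  assumes "0 \<le> s" "0 \<le> t"
  shows "Phi0 (s + t) \<le> Phi0 s + Phi0 t"
proof -
  have "Phi0 (s + t) - Phi0 s \<le> Phi0 (0 + t) - Phi0 0"
  proof (rule DERIV_nonpos_imp_nonincreasing[OF assms(1)])
    fix x assume "0 \<le> x" "x \<le> s"
    have "((\<lambda>x. Phi0 (x + t) - Phi0 x) has_real_derivative
        std_normal_density (x + t) * 1 - std_normal_density x) (at x)"
      by (intro DERIV_diff has_derivative_Phi0 DERIV_chain2[OF has_derivative_Phi0])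
         (auto intro!: derivative_eq_intros)
    then show "\<exists>y. ((\<lambda>x. Phi0 (x + t) - Phi0 x) has_real_derivative y) (at x) \<and> y \<le> 0"
      using std_normal_density_mono[of x "x + t"] \<open>0 \<le> x\<close> assms by (intro exI conjI) auto
  qed
  then show ?thesis by simp
qed

lemma Phi0_increment:
  assumes "0 \<le> s" "s \<le> t"
  shows "std_normal_density t * (t - s) \<le> Phi0 t - Phi0 s" "Phi0 t - Phi0 s \<le> t - s"
proof -
  have "\<exists>z. s \<le> z \<and> z \<le> t \<and> Phi0 t - Phi0 s = (t - s) * std_normal_density z"
  proof (cases "s = t")
    case False
    then have "s < t" using assms by simp
    from MVT2[OF this has_derivative_Phi0] show ?thesis by (auto intro: less_imp_le)
  qed auto
  then obtain z where z: "s \<le> z" "z \<le> t" "Phi0 t - Phi0 s = (t - s) * std_normal_density z" by blast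
  show "std_normal_density t * (t - s) \<le> Phi0 t - Phi0 s"
    using z assms std_normal_density_mono[of z t] by (simp add: mult.commute mult_left_mono)
  show "Phi0 t - Phi0 s \<le> t - s"
    using z assms std_normal_density_le_1[of z] by (simp add: mult_left_le)
qed

text \<open>The loss \<open>Phi0 t - Phi0 (\<theta> * t)\<close> is at least the density at
  \<open>D\<close> times \<open>(1 - \<theta>) * t\<close>, and \<open>Phi0 t \<le> t\<close> makes
  it proportional to \<open>Phi0 t\<close>. The bound \<open>D\<close> is essential:
  \<open>Phi0\<close> flattens at infinity, so no uniform factor below one holds on the whole
  half-line.\<close>

lemma Phi0_contraction:
  assumes "0 \<le> \<theta>" "\<theta> \<le> 1" "0 \<le> t" "t \<le> D"
  shows "Phi0 (\<theta> * t) \<le> (1 - (1 - \<theta>) * std_normal_density D) * Phi0 t"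
proof -
  have "(1 - \<theta>) * std_normal_density D * Phi0 t \<le> (1 - \<theta>) * std_normal_density D * t"
    using Phi0_increment(2)[of 0 t] assms by (intro mult_left_mono) auto
  also have "\<dots> \<le> (1 - \<theta>) * std_normal_density t * t"
    using assms by (intro mult_right_mono mult_left_mono std_normal_density_mono) auto
  also have "\<dots> = std_normal_density t * (t - \<theta> * t)" by (simp add: algebra_simps)
  also have "\<dots> \<le> Phi0 t - Phi0 (\<theta> * t)"
    using assms by (intro Phi0_increment) (auto simp: mult_left_le_one_le)
  finally show ?thesis by (simp add: algebra_simps)
qed

section \<open>Gaussian averages of the distribution function\<close>

lemma emeasure_std_normal_atMost: "emeasure std_normal_distribution {..t} = ennreal (Phi0 t + 1 / 2)"
  by (simp add: Phi0_def cdf_def std_normal.emeasure_eq_measure)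

lemma normal_density_scale:
  assumes "0 < s"
  shows "s * normal_density 0 s (s * x) = std_normal_density x"
proof -
  have "sqrt (2 * pi * s\<^sup>2) = s * sqrt (2 * pi)" using assms by (simp add: real_sqrt_mult)
  moreover have "(s * x)\<^sup>2 / (2 * s\<^sup>2) = x\<^sup>2 / 2" using assms by (simp add: power_mult_distrib)
  ultimately show ?thesis using assms by (simp add: normal_density_def)
qed

text \<open>
  If \<open>\<xi>\<close> and \<open>\<eta>\<close> are independent standard normal variables, then \<open>\<eta> - \<beta> \<xi>\<close> has variance
  \<open>1 + \<beta>\<^sup>2\<close>.
\<close>

lemma integral_Phi0_affine:
  assumes "0 < \<beta>"
  shows "(LINT x|std_normal_distribution. Phi0 (\<alpha> + \<beta> * x)) = Phi0 (\<alpha> / sqrt (1 + \<beta>\<^sup>2))"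
proof -
  let ?\<phi> = std_normal_density
  define s where "s = sqrt (1 + \<beta>\<^sup>2)"
  have s: "0 < s" by (auto simp: s_def intro: add_pos_nonneg)
  \<comment> \<open>The right-hand side is a convolution of centred normal densities with deviations
    1 and \<beta>; substituting - \<beta> x for the integration variable gives the product on the
    left.\<close>
  have inner: "(\<integral>\<^sup>+x. ennreal (?\<phi> (t + \<beta> * x) * ?\<phi> x) \<partial>lborel) = ennreal (normal_density 0 s t)" for t
  proof -
    have "ennreal (normal_density 0 s t) =
        (\<integral>\<^sup>+y. ennreal (normal_density 0 1 (t - y) * normal_density 0 \<beta> y) \<partial>lborel)"
      using fun_cong[OF conv_normal_density_zero_mean[of 1 \<beta>], of t] assms by (simp add: s_def)
    also have "\<dots> = ennreal \<beta> * (\<integral>\<^sup>+x. ennreal (?\<phi> (t + \<beta> * x) * normal_density 0 \<beta> (\<beta> * x)) \<partial>lborel)"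
      using assms by (subst nn_integral_real_affine[where c = "- \<beta>" and t = 0])
        (auto simp: normal_density_def)
    also have "\<dots> = (\<integral>\<^sup>+x. ennreal (?\<phi> (t + \<beta> * x) * (\<beta> * normal_density 0 \<beta> (\<beta> * x))) \<partial>lborel)"
      using assms by (subst nn_integral_cmult[symmetric])
        (auto simp: ennreal_mult'[symmetric] mult_ac)
    finally show ?thesis using assms by (simp add: normal_density_scale)
  qed
  have tail: "(\<integral>\<^sup>+t. ennreal (normal_density 0 s t) * indicator {..\<alpha>} t \<partial>lborel) =
      emeasure std_normal_distribution {..\<alpha> / s}"
  proof -
    have "(\<integral>\<^sup>+t. ennreal (normal_density 0 s t) * indicator {..\<alpha>} t \<partial>lborel) =
        ennreal s * (\<integral>\<^sup>+x. ennreal (normal_density 0 s (s * x)) * indicator {..\<alpha>} (s * x) \<partial>lborel)"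
      using s by (subst nn_integral_real_affine[where c = s and t = 0]) auto
    also have "\<dots> = (\<integral>\<^sup>+x. ennreal (s * normal_density 0 s (s * x)) * indicator {..\<alpha>} (s * x) \<partial>lborel)"
      using s by (subst nn_integral_cmult[symmetric]) (auto simp: ennreal_mult' mult_ac)
    also have "\<dots> = (\<integral>\<^sup>+x. ennreal (?\<phi> x) * indicator {..\<alpha> / s} x \<partial>lborel)"
      unfolding normal_density_scale[OF s] using s
      by (simp add: indicator_def pos_le_divide_eq mult.commute)
    also have "\<dots> = emeasure std_normal_distribution {..\<alpha> / s}" by (simp add: emeasure_density)
    finally show ?thesis .
  qed
  \<comment> \<open>Adding 1/2 turns \<open>Phi0\<close> back into the probability of a half-line,
    so the double integral below has a nonnegative integrand and its order can be exchanged. The 1/2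
    cancels at the end because the total mass is one.\<close>
  have tail_x: "ennreal (Phi0 (\<alpha> + \<beta> * x) + 1 / 2) =
      (\<integral>\<^sup>+t. ennreal (?\<phi> t) * indicator {..\<alpha>} (t - \<beta> * x) \<partial>lborel)" for x
    unfolding emeasure_std_normal_atMost[symmetric]
    by (subst emeasure_density) (auto simp: indicator_def intro!: nn_integral_cong)
  have "(\<integral>\<^sup>+x. ennreal (Phi0 (\<alpha> + \<beta> * x) + 1 / 2) \<partial>std_normal_distribution) =
      (\<integral>\<^sup>+x. ennreal (?\<phi> x) * (\<integral>\<^sup>+t. ennreal (?\<phi> t) * indicator {..\<alpha>} (t - \<beta> * x) \<partial>lborel) \<partial>lborel)"
    unfolding tail_x by (rule nn_integral_density) measurable
  also have "\<dots> = (\<integral>\<^sup>+x. ennreal (?\<phi> x) *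
      (\<integral>\<^sup>+t. ennreal (?\<phi> (t + \<beta> * x)) * indicator {..\<alpha>} (t + \<beta> * x - \<beta> * x) \<partial>lborel) \<partial>lborel)"
    by (subst nn_integral_lborel_plus[where f = "\<lambda>t. ennreal (?\<phi> t) * indicator {..\<alpha>} (t - \<beta> * _)"]) simp_all
  also have "\<dots> = (\<integral>\<^sup>+x. \<integral>\<^sup>+t. ennreal (?\<phi> (t + \<beta> * x) * ?\<phi> x) * indicator {..\<alpha>} t \<partial>lborel \<partial>lborel)"
    by (subst nn_integral_cmult[symmetric])
       (auto simp: ennreal_mult' mult_ac intro!: nn_integral_cong)
  also have "\<dots> = (\<integral>\<^sup>+t. \<integral>\<^sup>+x. ennreal (?\<phi> (t + \<beta> * x) * ?\<phi> x) * indicator {..\<alpha>} t \<partial>lborel \<partial>lborel)"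
    by (rule lborel_pair.Fubini') measurable
  also have "\<dots> = emeasure std_normal_distribution {..\<alpha> / s}"
    by (simp add: nn_integral_multc inner tail)
  also have "\<dots> = ennreal (Phi0 (\<alpha> / s) + 1 / 2)" by (rule emeasure_std_normal_atMost)
  finally have *: "(\<integral>\<^sup>+x. ennreal (Phi0 (\<alpha> + \<beta> * x) + 1 / 2) \<partial>std_normal_distribution) =
      ennreal (Phi0 (\<alpha> / s) + 1 / 2)" .
  have nn: "0 \<le> Phi0 x + 1 / 2" for x using Phi0_bounds[of x] by (simp add: abs_le_iff)
  have "(LINT x|std_normal_distribution. Phi0 (\<alpha> + \<beta> * x) + 1 / 2) = Phi0 (\<alpha> / s) + 1 / 2"
    by (rule integral_eq_nn_integral[THEN trans]) (auto simp: * nn)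
  moreover have "integrable std_normal_distribution (\<lambda>x. Phi0 (\<alpha> + \<beta> * x))"
    by (rule std_normal.integrable_const_bound[where B = 1])
       (auto intro!: AE_I2 order_trans[OF Phi0_bounds])
  ultimately show ?thesis using std_normal.prob_space by (simp add: s_def)
qed

text \<open>The weight is the conditional probability of not meeting. It vanishes where a + 2 x
  \<le> 0, and elsewhere it turns the density \<phi>(x) into \<phi>(x) - \<phi>(x + a). The map x
  \<mapsto> - a - x flips the sign of a + 2 x and carries \<phi>(x + a) to \<phi>(x), so by oddness
  of \<open>Phi0\<close> the subtracted term supplies the missing half-line. What results is the
  average of \<open>Phi0 (c * (a + 2 * x))\<close> over the whole line.\<close>

lemma integral_reflected_Phi0:
  assumes "0 < a" "0 < c"
  shows "(LINT x|std_normal_distribution. (1 - min 1 (exp (- (x * a) - a\<^sup>2 / 2))) * Phi0 (c * \<bar>a + 2 * x\<bar>)) =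
    Phi0 (c * a / sqrt (1 + 4 * c\<^sup>2))"
proof -
  let ?\<phi> = std_normal_density
  let ?P = "{x :: real. 0 < a + 2 * x}" and ?M = "{x :: real. a + 2 * x < 0}"
  define k where "k x = Phi0 (c * (a + 2 * x))" for x
  have [measurable]: "k \<in> borel_measurable borel" unfolding k_def by measurable
  have k: "\<bar>k x\<bar> \<le> 1" for x using Phi0_bounds[of "c * (a + 2 * x)"] by (simp add: k_def)
  have kP: "integrable lborel (\<lambda>x. ?\<phi> x * (indicator ?P x * k x))"
   and kM: "integrable lborel (\<lambda>x. ?\<phi> x * (indicator ?M x * k x))"
    by (intro integrable_std_normal_bounded[where B = 1]; auto simp: indicator_def k)+
  have shift: "?\<phi> (x + a) = ?\<phi> x * exp (- (x * a) - a\<^sup>2 / 2)" for x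
    by (simp add: std_normal_density_def mult_exp_exp power2_eq_square field_simps)
  have r: "exp (- (x * a) - a\<^sup>2 / 2) < 1 \<longleftrightarrow> 0 < a + 2 * x" for x
  proof -
    have "- (x * a) - a\<^sup>2 / 2 = - (a * (a + 2 * x)) / 2" by (simp add: power2_eq_square algebra_simps)
    then show ?thesis using assms(1) by (simp add: zero_less_mult_iff)
  qed
  have kS: "integrable lborel (\<lambda>x. ?\<phi> (x + a) * (indicator ?P x * k x))"
  proof -
    have "integrable lborel (\<lambda>x. ?\<phi> x * (indicator ?P (x - a) * k (x - a)))"
      by (rule integrable_std_normal_bounded[where B = 1]) (auto simp: indicator_def k)
    from lborel_integrable_real_affine[OF this, of 1 a] show ?thesis by (simp add: add.commute)
  qed
  have "(LINT x|std_normal_distribution. (1 - min 1 (exp (- (x * a) - a\<^sup>2 / 2))) * Phi0 (c * \<bar>a + 2 * x\<bar>)) =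
      (LINT x|lborel. ?\<phi> x * ((1 - min 1 (exp (- (x * a) - a\<^sup>2 / 2))) * Phi0 (c * \<bar>a + 2 * x\<bar>)))"
    by (subst integral_density) auto
  also have "\<dots> = (LINT x|lborel. ?\<phi> x * (indicator ?P x * k x) - ?\<phi> (x + a) * (indicator ?P x * k x))"
  proof (intro Bochner_Integration.integral_cong refl)
    fix x
    show "?\<phi> x * ((1 - min 1 (exp (- (x * a) - a\<^sup>2 / 2))) * Phi0 (c * \<bar>a + 2 * x\<bar>)) =
        ?\<phi> x * (indicator ?P x * k x) - ?\<phi> (x + a) * (indicator ?P x * k x)"
    proof (cases "0 < a + 2 * x")
      case True
      then have "min 1 (exp (- (x * a) - a\<^sup>2 / 2)) = exp (- (x * a) - a\<^sup>2 / 2)" using r[of x] by simp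
      then show ?thesis using True unfolding shift by (simp add: k_def left_diff_distrib right_diff_distrib)
    next
      case False
      then show ?thesis using r[of x] by (simp add: not_less min_absorb1)
    qed
  qed
  also have "\<dots> = (LINT x|lborel. ?\<phi> x * (indicator ?P x * k x)) -
      (LINT x|lborel. ?\<phi> (x + a) * (indicator ?P x * k x))"
    by (rule Bochner_Integration.integral_diff[OF kP kS])
  also have "(LINT x|lborel. ?\<phi> (x + a) * (indicator ?P x * k x)) =
      (LINT x|lborel. - (?\<phi> x * (indicator ?M x * k x)))"
  proof -
    have "?\<phi> (- a + - 1 * x + a) * (indicator ?P (- a + - 1 * x) * k (- a + - 1 * x)) =
        - (?\<phi> x * (indicator ?M x * k x))" for x
    proof -
      have "c * (a + 2 * (- a + - 1 * x)) = - (c * (a + 2 * x))" by (simp add: algebra_simps)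
      then have "k (- a + - 1 * x) = - k x" by (simp only: k_def Phi0_minus)
      then show ?thesis by (auto simp: indicator_def std_normal_density_def)
    qed
    then show ?thesis
      by (subst lborel_integral_real_affine[where c = "-1" and t = "- a"]) simp_all
  qed
  also have "(LINT x|lborel. ?\<phi> x * (indicator ?P x * k x)) - \<dots> =
      (LINT x|lborel. ?\<phi> x * (indicator ?P x * k x) + ?\<phi> x * (indicator ?M x * k x))"
    using kP kM by simp
  also have "\<dots> = (LINT x|lborel. ?\<phi> x * k x)"
  proof (intro Bochner_Integration.integral_cong refl)
    fix x
    have "k x = 0" if "a + 2 * x = 0" using that by (simp add: k_def)
    then show "?\<phi> x * (indicator ?P x * k x) + ?\<phi> x * (indicator ?M x * k x) = ?\<phi> x * k x"
      by (cases "a + 2 * x" "0 :: real" rule: linorder_cases) auto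
  qed
  also have "\<dots> = (LINT x|std_normal_distribution. Phi0 (c * a + 2 * c * x))"
    by (subst integral_density) (auto simp: k_def algebra_simps)
  also have "\<dots> = Phi0 (c * a / sqrt (1 + 4 * c\<^sup>2))"
    using assms by (subst integral_Phi0_affine) (auto simp: power_mult_distrib)
  finally show ?thesis .
qed

lemma integral_unit_threshold:
  assumes "0 \<le> r" "r \<le> 1" "0 \<le> a" "0 \<le> (b :: real)"
  shows "(LINT u|unit_unif. (if u \<le> r then a else b)) = r * a + (1 - r) * b"
proof -
  have "(\<integral>\<^sup>+u. ennreal (if u \<le> r then a else b) \<partial>unit_unif) = ennreal (r * a + (1 - r) * b)"
    using nn_integral_unit_threshold[OF assms(1,2), of "ennreal a" "ennreal b"] assms
    by (simp add: if_distrib[of ennreal] ennreal_mult' cong: if_cong)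
  moreover have "0 \<le> r * a + (1 - r) * b" using assms by simp
  moreover have "(LINT u|unit_unif. (if u \<le> r then a else b)) =
      enn2real (\<integral>\<^sup>+u. ennreal (if u \<le> r then a else b) \<partial>unit_unif)"
    using assms by (intro integral_eq_nn_integral) auto
  ultimately show ?thesis by (simp only: enn2real_ennreal)
qed

text \<open>Chains that do not meet are separated by a multiple of \<open>h\<close>, so the cost
  depends on the noise only through its component along the unit vector \<open>e\<close>, and the
  problem becomes one-dimensional. For \<open>h = 0\<close> there is no direction, but then both
  choices of the noise coincide.\<close>

lemma integral_Phi0_reflect_noise:
  fixes h :: "real ^ 'n::finite"
  assumes c: "0 < c"
  shows "(LINT w|(std_gaussian \<Otimes>\<^sub>M unit_unif). Phi0 (c * norm (h + fst w - reflect_noise h (fst w) (snd w)))) =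
    Phi0 (c * norm h / sqrt (1 + 4 * c\<^sup>2))"
proof (cases "h = 0")
  case True
  then have "norm (h + z - reflect_noise h z u) = 0" for z u
    by (simp add: reflect_noise_def mirror_def)
  then show ?thesis using True by simp
next
  case False
  define a e where "a = norm h" and "e = h /\<^sub>R norm h"
  have a: "0 < a" and e: "norm e = 1" "h = a *\<^sub>R e" using False by (auto simp: a_def e_def)
  interpret G: prob_space "std_gaussian :: (real ^ 'n) measure" by (rule prob_space_std_gaussian)
  interpret U: prob_space unit_unif by (rule prob_space_unit_unif)
  interpret P: pair_prob_space "std_gaussian :: (real ^ 'n) measure" unit_unif ..
  let ?F = "\<lambda>w. Phi0 (c * norm (h + fst w - reflect_noise h (fst w) (snd w)))"
  have norm_far: "norm (h + z - mirror h z) = \<bar>a + 2 * (z \<bullet> e)\<bar>" for z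
  proof -
    have ee: "e \<bullet> e = 1" using e(1) by (simp add: norm_eq_1)
    have "z \<bullet> h = a * (z \<bullet> e)" "h \<bullet> h = a * a" by (simp_all add: e(2) ee)
    then have "2 * (z \<bullet> h) / (h \<bullet> h) * a = 2 * (z \<bullet> e)" using a by simp
    then have "(2 * (z \<bullet> h) / (h \<bullet> h)) *\<^sub>R h = (2 * (z \<bullet> e)) *\<^sub>R e"
      by (subst (4) e(2)) simp
    then have "h + z - mirror h z = (a + 2 * (z \<bullet> e)) *\<^sub>R e"
      by (subst (1) e(2)) (simp add: mirror_def scaleR_add_left)
    then show ?thesis using e(1) by simp
  qed
  have int: "integrable (std_gaussian \<Otimes>\<^sub>M unit_unif) ?F"
    by (rule P.P.integrable_const_bound[where B = 1])
       (auto intro!: AE_I2 order_trans[OF Phi0_bounds])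
  have inner: "(LINT u|unit_unif. ?F (z, u)) =
      (1 - min 1 (exp (- ((z \<bullet> e) * a) - a\<^sup>2 / 2))) * Phi0 (c * \<bar>a + 2 * (z \<bullet> e)\<bar>)" for z
  proof -
    let ?r = "exp (- ((z \<bullet> e) * a) - a\<^sup>2 / 2)"
    have zh: "z \<bullet> h = (z \<bullet> e) * a" "norm h = a" by (simp add: e(2)) (simp add: a_def)
    have "(LINT u|unit_unif. ?F (z, u)) =
        (LINT u|unit_unif. (if u \<le> min 1 ?r then 0 else Phi0 (c * \<bar>a + 2 * (z \<bullet> e)\<bar>)))"
    proof (rule integral_cong_AE)
      show "AE u in unit_unif. ?F (z, u) = (if u \<le> min 1 ?r then 0 else Phi0 (c * \<bar>a + 2 * (z \<bullet> e)\<bar>))"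
        by (intro AE_uniform_measureI AE_I2) (auto simp: reflect_noise_def zh norm_far)
    qed simp_all
    also have "\<dots> = (1 - min 1 ?r) * Phi0 (c * \<bar>a + 2 * (z \<bullet> e)\<bar>)"
      using c by (subst integral_unit_threshold) (auto intro!: Phi0_nonneg)
    finally show ?thesis .
  qed
  have "(LINT w|(std_gaussian \<Otimes>\<^sub>M unit_unif). ?F w) =
      (LINT z|std_gaussian. (1 - min 1 (exp (- ((z \<bullet> e) * a) - a\<^sup>2 / 2))) * Phi0 (c * \<bar>a + 2 * (z \<bullet> e)\<bar>))"
    unfolding inner[symmetric] by (rule P.integral_fst'[symmetric, OF int])
  also have "\<dots> = (LINT x|(distr std_gaussian borel (\<lambda>z. z \<bullet> e)).
      (1 - min 1 (exp (- (x * a) - a\<^sup>2 / 2))) * Phi0 (c * \<bar>a + 2 * x\<bar>))"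
    by (subst integral_distr) simp_all
  also have "\<dots> = Phi0 (c * a / sqrt (1 + 4 * c\<^sup>2))"
    unfolding distr_std_gaussian_inner[OF e(1)] by (rule integral_reflected_Phi0[OF a c])
  finally show ?thesis by (simp add: a_def)
qed

section \<open>One Euler step\<close>

definition euler_step :: "('n::finite torus \<Rightarrow> real ^ 'n) \<Rightarrow> real \<Rightarrow> 'n torus \<Rightarrow> real ^ 'n \<Rightarrow> 'n torus" where
  "euler_step b \<gamma> x z = torus_shift x (\<gamma> *\<^sub>R b x + sqrt \<gamma> *\<^sub>R z)"

text \<open>The difference of the means of the two Euler steps, taken in the vector space along the
  lift of \<open>x\<close> nearest to \<open>y\<close>. \<open>coupled_noise\<close> divides it by
  \<open>sqrt \<gamma>\<close> because the noise is scaled by that factor.\<close>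

definition mean_gap :: "('n::finite torus \<Rightarrow> real ^ 'n) \<Rightarrow> real \<Rightarrow> 'n torus \<Rightarrow> 'n torus \<Rightarrow> real ^ 'n" where
  "mean_gap b \<gamma> x y = torus_disp x y + \<gamma> *\<^sub>R (b x - b y)"

definition coupled_noise ::
    "('n::finite torus \<Rightarrow> real ^ 'n) \<Rightarrow> real \<Rightarrow> 'n torus \<Rightarrow> 'n torus \<Rightarrow> (real ^ 'n) \<times> real \<Rightarrow> real ^ 'n" where
  "coupled_noise b \<gamma> x y w = reflect_noise ((1 / sqrt \<gamma>) *\<^sub>R mean_gap b \<gamma> x y) (fst w) (snd w)"

lemma measurable_euler_step:
  assumes [measurable]: "b \<in> borel \<rightarrow>\<^sub>M borel" "f \<in> M \<rightarrow>\<^sub>M borel" "g \<in> M \<rightarrow>\<^sub>M borel"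
  shows "(\<lambda>w. euler_step b \<gamma> (f w) (g w)) \<in> M \<rightarrow>\<^sub>M borel"
  unfolding euler_step_def by measurable

lemma measurable_coupled_noise:
  assumes [measurable]: "b \<in> borel \<rightarrow>\<^sub>M borel" "f \<in> M \<rightarrow>\<^sub>M borel" "g \<in> M \<rightarrow>\<^sub>M borel"
    "h \<in> M \<rightarrow>\<^sub>M borel \<Otimes>\<^sub>M borel"
  shows "(\<lambda>w. coupled_noise b \<gamma> (f w) (g w) (h w)) \<in> M \<rightarrow>\<^sub>M borel"
  unfolding coupled_noise_def mean_gap_def by measurable

lemma euler_kernel_eq: "euler_kernel b \<gamma> x = distr std_gaussian borel (euler_step b \<gamma> x)"
  by (simp add: euler_kernel_def euler_step_def[abs_def])

lemma distr_euler_step_fst: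
  assumes [measurable]: "b \<in> borel \<rightarrow>\<^sub>M borel"
  shows "distr (std_gaussian \<Otimes>\<^sub>M unit_unif) borel (\<lambda>w. euler_step b \<gamma> x (fst w)) = euler_kernel b \<gamma> x"
proof -
  interpret U: prob_space unit_unif by (rule prob_space_unit_unif)
  note measurable_euler_step[measurable]
  have "distr (distr (std_gaussian \<Otimes>\<^sub>M unit_unif) std_gaussian fst) borel (euler_step b \<gamma> x) =
      distr (std_gaussian \<Otimes>\<^sub>M unit_unif) borel (\<lambda>w. euler_step b \<gamma> x (fst w))"
    by (subst distr_distr) (simp_all add: comp_def)
  then show ?thesis by (simp add: U.distr_pair_fst euler_kernel_eq)
qed

lemma distr_euler_step_coupled:
  assumes [measurable]: "b \<in> borel \<rightarrow>\<^sub>M borel"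
  shows "distr (std_gaussian \<Otimes>\<^sub>M unit_unif) borel (\<lambda>w. euler_step b \<gamma> y (coupled_noise b \<gamma> x y w)) =
    euler_kernel b \<gamma> y"
proof -
  note measurable_euler_step[measurable]
  have "euler_kernel b \<gamma> y = distr (distr (std_gaussian \<Otimes>\<^sub>M unit_unif) borel
      (\<lambda>(z, u). reflect_noise ((1 / sqrt \<gamma>) *\<^sub>R mean_gap b \<gamma> x y) z u)) borel (euler_step b \<gamma> y)"
    by (simp add: distr_reflect_noise euler_kernel_eq)
  also have "\<dots> = distr (std_gaussian \<Otimes>\<^sub>M unit_unif) borel (\<lambda>w. euler_step b \<gamma> y (coupled_noise b \<gamma> x y w))"
    by (subst distr_distr) (simp_all add: comp_def coupled_noise_def split_beta')
  finally show ?thesis by simp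
qed

section \<open>The contracting cost and its one-step estimate\<close>

definition torus_cost :: "real \<Rightarrow> 'n::finite torus \<Rightarrow> 'n torus \<Rightarrow> real" where
  "torus_cost s x y = Phi0 (s * dist x y)"

lemma torus_cost_bounds:
  assumes "0 \<le> s"
  shows "0 \<le> torus_cost s x y" "torus_cost s x y \<le> 1"
  using Phi0_nonneg[of "s * dist x y"] Phi0_bounds[of "s * dist x y"] assms by (auto simp: torus_cost_def)

lemma measurable_torus_cost [measurable (raw)]:
  fixes f g :: "'a \<Rightarrow> 'n::finite torus"
  assumes [measurable]: "f \<in> M \<rightarrow>\<^sub>M borel" "g \<in> M \<rightarrow>\<^sub>M borel"
  shows "(\<lambda>x. torus_cost s (f x) (g x)) \<in> borel_measurable M"
  unfolding torus_cost_def by measurable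

lemma Metric_space_torus_cost:
  assumes s: "0 < s"
  shows "Metric_space UNIV (torus_cost s)"
proof
  fix x y z :: "'a torus"
  show "0 \<le> torus_cost s x y" using s by (simp add: torus_cost_bounds)
  show "torus_cost s x y = torus_cost s y x" by (simp add: torus_cost_def dist_commute)
  show "torus_cost s x y = 0 \<longleftrightarrow> x = y"
    using s Phi0_strict_mono[of 0 "s * dist x y"] by (cases "x = y") (auto simp: torus_cost_def)
  have "torus_cost s x z \<le> Phi0 (s * dist x y + s * dist y z)"
    using s dist_triangle[of x z y] unfolding torus_cost_def
    by (intro Phi0_mono) (simp flip: distrib_left)
  also have "\<dots> \<le> torus_cost s x y + torus_cost s y z"
    using s unfolding torus_cost_def by (intro Phi0_subadditive) auto
  finally show "torus_cost s x z \<le> torus_cost s x y + torus_cost s y z" .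
qed

text \<open>Up to the diameter bound, the slope of \<open>Phi0\<close> lies between the density at
  \<open>s * CARD('n)\<close> and one.\<close>

lemma torus_cost_equiv:
  fixes x y :: "'n::finite torus" and s :: real
  assumes s: "0 < s"
  shows "std_normal_density (s * real CARD('n)) * s * dist x y \<le> torus_cost s x y"
    "torus_cost s x y \<le> s * dist x y"
proof -
  have le: "s * dist x y \<le> s * real CARD('n)" using s dist_torus_le_card[of x y] by simp
  have "std_normal_density (s * real CARD('n)) * (s * dist x y) \<le> std_normal_density (s * dist x y) * (s * dist x y - 0)"
    using s le by (auto intro!: mult_right_mono std_normal_density_mono)
  also have "\<dots> \<le> Phi0 (s * dist x y) - Phi0 0"
    using s by (intro Phi0_increment) auto
  finally show "std_normal_density (s * real CARD('n)) * s * dist x y \<le> torus_cost s x y"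
    by (simp add: torus_cost_def mult.assoc)
  show "torus_cost s x y \<le> s * dist x y"
    using Phi0_increment(2)[of 0 "s * dist x y"] s by (simp add: torus_cost_def)
qed

lemma equivalent_dist_torus_cost:
  assumes s: "0 < s"
  shows "equivalent_dist (torus_cost s :: 'n::finite torus \<Rightarrow> 'n torus \<Rightarrow> real)"
  unfolding equivalent_dist_def using s torus_cost_equiv[OF s, where 'n = 'n]
  by (intro exI[of _ "std_normal_density (s * real CARD('n)) * s"] exI[of _ s] conjI allI)
     (auto simp: normal_density_pos)

text \<open>Both new points are shifts of the same point \<open>y\<close>, so the norm of the
  difference of the shifts bounds their distance. The distance may be smaller through another
  lattice translate; as the cost is increasing in the distance, an upper bound suffices.\<close>

lemma dist_euler_step_le:
  assumes "0 < \<gamma>"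
  shows "dist (euler_step b \<gamma> x z) (euler_step b \<gamma> y z') \<le>
    sqrt \<gamma> * norm ((1 / sqrt \<gamma>) *\<^sub>R mean_gap b \<gamma> x y + z - z')"
proof -
  have "euler_step b \<gamma> x z = torus_shift y (torus_disp x y + (\<gamma> *\<^sub>R b x + sqrt \<gamma> *\<^sub>R z))"
    by (simp add: euler_step_def flip: torus_shift_shift)
  then have "dist (euler_step b \<gamma> x z) (euler_step b \<gamma> y z') \<le>
      norm (torus_disp x y + (\<gamma> *\<^sub>R b x + sqrt \<gamma> *\<^sub>R z) - (\<gamma> *\<^sub>R b y + sqrt \<gamma> *\<^sub>R z'))"
    unfolding euler_step_def[of _ _ y] by (simp only: dist_torus_shift_le)
  also have "torus_disp x y + (\<gamma> *\<^sub>R b x + sqrt \<gamma> *\<^sub>R z) - (\<gamma> *\<^sub>R b y + sqrt \<gamma> *\<^sub>R z') =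
      sqrt \<gamma> *\<^sub>R ((1 / sqrt \<gamma>) *\<^sub>R mean_gap b \<gamma> x y + z - z')"
    using assms by (simp add: mean_gap_def algebra_simps)
  finally show ?thesis using assms by simp
qed

lemma integral_torus_cost_coupled_le:
  fixes b :: "'n::finite torus \<Rightarrow> real ^ 'n"
  assumes [measurable]: "b \<in> borel \<rightarrow>\<^sub>M borel" and s: "0 < s" and \<gamma>: "0 < \<gamma>"
  shows "(LINT w|(std_gaussian \<Otimes>\<^sub>M unit_unif).
      torus_cost s (euler_step b \<gamma> x (fst w)) (euler_step b \<gamma> y (coupled_noise b \<gamma> x y w))) \<le>
    Phi0 (s * norm (mean_gap b \<gamma> x y) / sqrt (1 + 4 * s\<^sup>2 * \<gamma>))"
proof -
  interpret G: prob_space "std_gaussian :: (real ^ 'n) measure" by (rule prob_space_std_gaussian)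
  interpret U: prob_space unit_unif by (rule prob_space_unit_unif)
  interpret P: pair_prob_space "std_gaussian :: (real ^ 'n) measure" unit_unif ..
  note measurable_euler_step[measurable] measurable_coupled_noise[measurable]
  define h where "h = (1 / sqrt \<gamma>) *\<^sub>R mean_gap b \<gamma> x y"
  let ?c = "s * sqrt \<gamma>"
  have "(LINT w|(std_gaussian \<Otimes>\<^sub>M unit_unif).
      torus_cost s (euler_step b \<gamma> x (fst w)) (euler_step b \<gamma> y (coupled_noise b \<gamma> x y w))) \<le>
      (LINT w|(std_gaussian \<Otimes>\<^sub>M unit_unif). Phi0 (?c * norm (h + fst w - reflect_noise h (fst w) (snd w))))"
  proof (rule integral_mono)
    show "integrable (std_gaussian \<Otimes>\<^sub>M unit_unif) (\<lambda>w.
        torus_cost s (euler_step b \<gamma> x (fst w)) (euler_step b \<gamma> y (coupled_noise b \<gamma> x y w)))"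
      using s by (intro P.P.integrable_const_bound[where B = 1]) (auto simp: torus_cost_bounds)
    show "integrable (std_gaussian \<Otimes>\<^sub>M unit_unif) (\<lambda>w.
        Phi0 (?c * norm (h + fst w - reflect_noise h (fst w) (snd w))))"
      by (rule P.P.integrable_const_bound[where B = 1]) (auto intro!: AE_I2 order_trans[OF Phi0_bounds])
    fix w :: "(real ^ 'n) \<times> real"
    have "s * dist (euler_step b \<gamma> x (fst w)) (euler_step b \<gamma> y (coupled_noise b \<gamma> x y w)) \<le>
        s * (sqrt \<gamma> * norm (h + fst w - coupled_noise b \<gamma> x y w))"
      using s dist_euler_step_le[OF \<gamma>, of b x "fst w" y "coupled_noise b \<gamma> x y w"] by (simp add: h_def)
    then show "torus_cost s (euler_step b \<gamma> x (fst w)) (euler_step b \<gamma> y (coupled_noise b \<gamma> x y w)) \<le>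
        Phi0 (?c * norm (h + fst w - reflect_noise h (fst w) (snd w)))"
      unfolding torus_cost_def by (intro Phi0_mono) (simp add: coupled_noise_def h_def mult.assoc)
  qed
  also have "\<dots> = Phi0 (?c * norm h / sqrt (1 + 4 * ?c\<^sup>2))"
    using s \<gamma> by (intro integral_Phi0_reflect_noise) simp
  also have "?c * norm h = s * norm (mean_gap b \<gamma> x y)" using \<gamma> by (simp add: h_def)
  also have "4 * ?c\<^sup>2 = 4 * s\<^sup>2 * \<gamma>" using \<gamma> by (simp add: power_mult_distrib)
  finally show ?thesis .
qed

text \<open>After squaring, the variance gains 4 (L + 1) \<gamma> while the drift loses only 2 L
  \<gamma> at first order. The hypothesis on \<gamma> is chosen so that
  \<open>\<gamma> * (4 + 4 * L + L\<^sup>2) \<le> 1\<close>, which absorbs the second-order terms;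
  finally 1 - \<gamma> \<le> (1 - \<gamma>/2)^2.\<close>

lemma one_step_factor:
  assumes L: "0 \<le> (L :: real)" and \<gamma>: "0 < \<gamma>" "\<gamma> \<le> 1 / (L + 2)\<^sup>2"
  shows "(1 + \<gamma> * L) / sqrt (1 + 4 * (L + 1) * \<gamma>) \<le> 1 - \<gamma> / 2" "\<gamma> \<le> 1"
proof -
  have "\<gamma> * (L + 2)\<^sup>2 \<le> 1" using \<gamma> L by (simp add: field_simps)
  moreover have "\<gamma> * (L + 2)\<^sup>2 = \<gamma> * (4 + 4 * L + L\<^sup>2)" by (simp add: power2_eq_square algebra_simps)
  ultimately have g: "\<gamma> * (4 + 4 * L + L\<^sup>2) \<le> 1" by simp
  moreover have "\<gamma> * 1 \<le> \<gamma> * (4 + 4 * L + L\<^sup>2)" using \<gamma> L by (intro mult_left_mono) auto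
  ultimately show \<gamma>1: "\<gamma> \<le> 1" by simp
  have "(1 + \<gamma> * L)\<^sup>2 = 1 + \<gamma> * (2 * L + \<gamma> * L\<^sup>2)" by (simp add: power2_eq_square algebra_simps)
  also have "2 * L + \<gamma> * L\<^sup>2 \<le> 4 * (L + 1) - 1 - 4 * (L + 1) * \<gamma>" using g L by (simp add: algebra_simps)
  also have "1 + \<gamma> * (4 * (L + 1) - 1 - 4 * (L + 1) * \<gamma>) = (1 + 4 * (L + 1) * \<gamma>) * (1 - \<gamma>)"
    by (simp add: algebra_simps)
  also have "\<dots> \<le> (1 + 4 * (L + 1) * \<gamma>) * (1 - \<gamma> / 2)\<^sup>2"
    using L \<gamma> by (intro mult_left_mono) (auto simp: power2_eq_square algebra_simps)
  finally have "(1 + \<gamma> * L)\<^sup>2 \<le> (1 + 4 * (L + 1) * \<gamma>) * (1 - \<gamma> / 2)\<^sup>2"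
    using \<gamma> by (simp add: mult_left_mono)
  then have "sqrt ((1 + \<gamma> * L)\<^sup>2) \<le> sqrt ((1 + 4 * (L + 1) * \<gamma>) * (1 - \<gamma> / 2)\<^sup>2)"
    by (rule real_sqrt_le_mono)
  then have "1 + \<gamma> * L \<le> sqrt (1 + 4 * (L + 1) * \<gamma>) * (1 - \<gamma> / 2)"
    using L \<gamma> \<gamma>1 by (simp add: real_sqrt_mult)
  then show "(1 + \<gamma> * L) / sqrt (1 + 4 * (L + 1) * \<gamma>) \<le> 1 - \<gamma> / 2"
    using L \<gamma> by (subst pos_divide_le_eq) (auto simp: mult.commute intro: add_pos_nonneg)
qed

text \<open>Since \<open>s\<^sup>2 = L + 1\<close>, the denominator from the Gaussian average is the
  one in \<open>one_step_factor\<close>, so the argument of \<open>Phi0\<close> shrinks by 1 -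
  \<gamma>/2. \<open>Phi0_contraction\<close>, on the range given by the diameter bound, turns this
  into a factor on the cost: half the density at \<open>s * CARD('n)\<close> is the rate c1.\<close>

lemma coupled_step_contraction:
  fixes b :: "'n::finite torus \<Rightarrow> real ^ 'n"
  assumes b: "b \<in> borel \<rightarrow>\<^sub>M borel" and L: "0 \<le> L" "\<And>x y. norm (b x - b y) \<le> L * dist x y"
    and \<gamma>: "0 < \<gamma>" "\<gamma> \<le> 1 / (L + 2)\<^sup>2"
  defines "s \<equiv> sqrt (L + 1)"
  shows "(LINT w|(std_gaussian \<Otimes>\<^sub>M unit_unif).
      torus_cost s (euler_step b \<gamma> x (fst w)) (euler_step b \<gamma> y (coupled_noise b \<gamma> x y w))) \<le>
    (1 - std_normal_density (s * real CARD('n)) / 2 * \<gamma>) * torus_cost s x y"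
proof -
  have s: "0 < s" "s\<^sup>2 = L + 1" using L(1) by (auto simp: s_def)
  have "norm (mean_gap b \<gamma> x y) \<le> norm (torus_disp x y) + norm (\<gamma> *\<^sub>R (b x - b y))"
    unfolding mean_gap_def by (rule norm_triangle_ineq)
  also have "\<dots> \<le> dist x y + \<gamma> * (L * dist x y)"
    using L(2)[of x y] \<gamma>(1) by (simp add: norm_torus_disp)
  finally have gap: "norm (mean_gap b \<gamma> x y) \<le> (1 + \<gamma> * L) * dist x y" by (simp add: algebra_simps)
  let ?r = "sqrt (1 + 4 * (L + 1) * \<gamma>)"
  have r: "0 < ?r" using L(1) \<gamma>(1) by (auto intro: add_pos_nonneg)
  have "s * norm (mean_gap b \<gamma> x y) / ?r \<le> s * ((1 + \<gamma> * L) * dist x y) / ?r"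
    using s r gap by (intro divide_right_mono mult_left_mono) auto
  also have "\<dots> = (1 + \<gamma> * L) / ?r * (s * dist x y)" by simp
  also have "\<dots> \<le> (1 - \<gamma> / 2) * (s * dist x y)"
    using s one_step_factor[OF L(1) \<gamma>] by (intro mult_right_mono) auto
  finally have le: "s * norm (mean_gap b \<gamma> x y) / ?r \<le> (1 - \<gamma> / 2) * (s * dist x y)" .
  have "(LINT w|(std_gaussian \<Otimes>\<^sub>M unit_unif).
      torus_cost s (euler_step b \<gamma> x (fst w)) (euler_step b \<gamma> y (coupled_noise b \<gamma> x y w))) \<le>
      Phi0 (s * norm (mean_gap b \<gamma> x y) / ?r)"
    using integral_torus_cost_coupled_le[OF b s(1) \<gamma>(1)] by (simp add: s(2))
  also have "\<dots> \<le> Phi0 ((1 - \<gamma> / 2) * (s * dist x y))" by (rule Phi0_mono[OF le])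
  also have "\<dots> \<le> (1 - (1 - (1 - \<gamma> / 2)) * std_normal_density (s * real CARD('n))) * Phi0 (s * dist x y)"
    using s \<gamma> one_step_factor(2)[OF L(1) \<gamma>] dist_torus_le_card[of x y]
    by (intro Phi0_contraction) auto
  finally show ?thesis by (simp add: torus_cost_def mult.commute)
qed

section \<open>Resampling trials\<close>

lemma measurable_PiM_component_compose:
  assumes "i \<in> I" "f \<in> M i \<rightarrow>\<^sub>M N"
  shows "(\<lambda>\<omega>. f (\<omega> i)) \<in> PiM I M \<rightarrow>\<^sub>M N"
  by (rule measurable_compose[of "\<lambda>\<omega>. \<omega> i" "PiM I M" "M i" f N])
     (auto intro: measurable_component_singleton assms)

text \<open>Product measures are determined by cylinders over finite index sets, and the preimage of
  a cylinder is again one. The result serves both the infinite sequence of trials and the finite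
  family of particles.\<close>

lemma distr_PiM_components:
  assumes M: "\<And>i. i \<in> I \<Longrightarrow> prob_space (M i)" and f: "\<And>i. i \<in> I \<Longrightarrow> f i \<in> M i \<rightarrow>\<^sub>M N i"
  shows "distr (PiM I M) (PiM I N) (\<lambda>\<omega>. \<lambda>i\<in>I. f i (\<omega> i)) = PiM I (\<lambda>i. distr (M i) (N i) (f i))"
    (is "?D = ?P")
proof (rule measure_eqI_PiM_infinite[symmetric])
  have prob: "prob_space (distr (M i) (N i) (f i))" if "i \<in> I" for i
    using M f that by (intro prob_space.prob_space_distr) auto
  have F: "(\<lambda>\<omega>. \<lambda>i\<in>I. f i (\<omega> i)) \<in> PiM I M \<rightarrow>\<^sub>M PiM I N"
    by (intro measurable_restrict measurable_PiM_component_compose f)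
  show "sets ?P = sets (PiM I N)" "sets ?D = sets (PiM I N)" by (simp_all cong: sets_PiM_cong)
  interpret P: prob_space ?P by (intro prob_space_PiM prob)
  show "finite_measure ?P" by unfold_locales
  fix A J assume J: "finite J" "J \<subseteq> I" and A: "\<And>i. i \<in> J \<Longrightarrow> A i \<in> sets (N i)"
  have emb: "prod_emb I N J (Pi\<^sub>E J A) \<in> sets (PiM I N)"
    using J A by (intro sets_PiM_I) auto
  have emb_eq: "prod_emb I (\<lambda>i. distr (M i) (N i) (f i)) J (Pi\<^sub>E J A) = prod_emb I N J (Pi\<^sub>E J A)"
    by (simp add: prod_emb_def)
  have "emeasure ?P (prod_emb I N J (Pi\<^sub>E J A)) = (\<Prod>i\<in>J. emeasure (distr (M i) (N i) (f i)) (A i))"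
    unfolding emb_eq[symmetric] using J A prob by (intro emeasure_PiM_emb) auto
  also have "\<dots> = (\<Prod>i\<in>J. emeasure (M i) (f i -` A i \<inter> space (M i)))"
    using J A f by (intro prod.cong refl emeasure_distr) auto
  also have "\<dots> = emeasure (PiM I M) (prod_emb I M J (\<Pi>\<^sub>E i\<in>J. f i -` A i \<inter> space (M i)))"
    using J A f M by (intro emeasure_PiM_emb[symmetric] measurable_sets[OF f]) auto
  also have "prod_emb I M J (\<Pi>\<^sub>E i\<in>J. f i -` A i \<inter> space (M i)) =
      (\<lambda>\<omega>. \<lambda>i\<in>I. f i (\<omega> i)) -` prod_emb I N J (Pi\<^sub>E J A) \<inter> space (PiM I M)"
    using J f[THEN measurable_space] by (auto simp: prod_emb_def space_PiM PiE_iff subset_eq)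
  also have "emeasure (PiM I M) \<dots> = emeasure ?D (prod_emb I N J (Pi\<^sub>E J A))"
    by (rule emeasure_distr[symmetric, OF F emb])
  finally show "emeasure ?P (prod_emb I N J (Pi\<^sub>E J A)) = emeasure ?D (prod_emb I N J (Pi\<^sub>E J A))" .
qed

section \<open>Trials as functions of a noise sequence\<close>

definition accepts :: "('a \<Rightarrow> real) \<Rightarrow> real \<Rightarrow> (nat \<Rightarrow> 'a \<times> real) \<Rightarrow> nat \<Rightarrow> bool" where
  "accepts l \<gamma> \<xi> k \<longleftrightarrow> kill_prob l \<gamma> (fst (\<xi> k)) \<le> snd (\<xi> k)"

text \<open>The noise is kept apart from the maps that turn it into positions, \<open>g0\<close> for
  the first trial and \<open>g\<close> for later ones. Two systems are then coupled by applying two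
  pairs of maps to the same \<omega>.\<close>

definition trial_seq :: "('w \<Rightarrow> 'a) \<Rightarrow> ('w \<Rightarrow> 'a) \<Rightarrow> (nat \<Rightarrow> 'w \<times> real) \<Rightarrow> nat \<Rightarrow> 'a \<times> real" where
  "trial_seq g0 g \<omega> k = ((if k = 0 then g0 else g) (fst (\<omega> k)), snd (\<omega> k))"

definition trial_result ::
    "('a \<Rightarrow> real) \<Rightarrow> real \<Rightarrow> ('w \<Rightarrow> 'a) \<Rightarrow> ('w \<Rightarrow> 'a) \<Rightarrow> (nat \<Rightarrow> 'w \<times> real) \<Rightarrow> 'a" where
  "trial_result l \<gamma> g0 g \<omega> = fst (trial_seq g0 g \<omega> (survival_index l \<gamma> (trial_seq g0 g \<omega>)))"

lemma survival_index_eq: "survival_index l \<gamma> \<xi> = (LEAST k. accepts l \<gamma> \<xi> k)"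
  by (simp add: survival_index_def accepts_def Inf_nat_def)

lemma accepts_trial_seq_0:
  "accepts l \<gamma> (trial_seq g0 g (case_nat (w, u) \<omega>)) 0 \<longleftrightarrow> kill_prob l \<gamma> (g0 w) \<le> u"
  by (simp add: accepts_def trial_seq_def)

lemma accepts_trial_seq_Suc:
  "accepts l \<gamma> (trial_seq g0 g (case_nat (w, u) \<omega>)) (Suc k) \<longleftrightarrow> accepts l \<gamma> (trial_seq g g \<omega>) k"
  by (simp add: accepts_def trial_seq_def)

lemma trial_result_accept:
  assumes "kill_prob l \<gamma> (g0 w) \<le> u"
  shows "trial_result l \<gamma> g0 g (case_nat (w, u) \<omega>) = g0 w"
proof -
  have "survival_index l \<gamma> (trial_seq g0 g (case_nat (w, u) \<omega>)) = 0"
    unfolding survival_index_eq using assms by (intro Least_eq_0) (simp add: accepts_trial_seq_0)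
  then show ?thesis by (simp add: trial_result_def trial_seq_def)
qed

text \<open>After a rejection, the remaining trials form a sequence whose first trial is already a
  resampled one, hence the pair \<open>g g\<close>. Some later acceptance must exist for
  \<open>LEAST\<close> to shift by one.\<close>

lemma trial_result_reject:
  assumes "u < kill_prob l \<gamma> (g0 w)" and "\<exists>k. accepts l \<gamma> (trial_seq g g \<omega>) k"
  shows "trial_result l \<gamma> g0 g (case_nat (w, u) \<omega>) = trial_result l \<gamma> g g \<omega>"
proof -
  let ?\<xi> = "trial_seq g0 g (case_nat (w, u) \<omega>)"
  obtain k where k: "accepts l \<gamma> ?\<xi> (Suc k)" using assms(2) by (auto simp: accepts_trial_seq_Suc)
  have "\<not> accepts l \<gamma> ?\<xi> 0" using assms(1) by (simp add: accepts_trial_seq_0)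
  from Least_Suc[OF k this]
  have "survival_index l \<gamma> ?\<xi> = Suc (survival_index l \<gamma> (trial_seq g g \<omega>))"
    unfolding survival_index_eq accepts_trial_seq_Suc .
  then show ?thesis by (simp add: trial_result_def trial_seq_def)
qed

lemma measurable_kill_prob [measurable (raw)]:
  assumes [measurable]: "l \<in> borel_measurable N" "f \<in> M \<rightarrow>\<^sub>M N"
  shows "(\<lambda>x. kill_prob l \<gamma> (f x)) \<in> borel_measurable M"
  unfolding kill_prob_def by measurable

lemma measurable_accepts [measurable (raw)]:
  fixes l :: "'a::topological_space \<Rightarrow> real"
  assumes [measurable]: "l \<in> borel_measurable borel" "\<And>k. (\<lambda>x. \<xi> x k) \<in> M \<rightarrow>\<^sub>M borel \<Otimes>\<^sub>M borel"
  shows "Measurable.pred M (\<lambda>x. accepts l \<gamma> (\<xi> x) k)"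
  unfolding accepts_def by measurable

lemma measurable_survivor:
  fixes l :: "'a::topological_space \<Rightarrow> real"
  assumes [measurable]: "l \<in> borel_measurable borel" "\<And>k. (\<lambda>x. \<xi> x k) \<in> M \<rightarrow>\<^sub>M borel \<Otimes>\<^sub>M borel"
  shows "(\<lambda>x. fst (\<xi> x (survival_index l \<gamma> (\<xi> x)))) \<in> M \<rightarrow>\<^sub>M borel"
proof -
  have [measurable]: "(\<lambda>x. survival_index l \<gamma> (\<xi> x)) \<in> M \<rightarrow>\<^sub>M count_space UNIV"
    unfolding survival_index_eq by measurable
  show ?thesis
    by (rule measurable_compose_countable[where f = "\<lambda>k x. fst (\<xi> x k)"]) measurable
qed

text \<open>The maps may depend on a parameter through \<open>f\<close>. In this form the result
  shows later that the laws of the particles depend measurably on the current states.\<close>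

lemma measurable_trial_result:
  fixes l :: "'a::topological_space \<Rightarrow> real"
  assumes [measurable]: "l \<in> borel_measurable borel" "(\<lambda>(x, w). g0 x w) \<in> M \<Otimes>\<^sub>M W \<rightarrow>\<^sub>M borel"
    "(\<lambda>(x, w). g x w) \<in> M \<Otimes>\<^sub>M W \<rightarrow>\<^sub>M borel" "f \<in> L \<rightarrow>\<^sub>M M"
    "h \<in> L \<rightarrow>\<^sub>M (\<Pi>\<^sub>M k\<in>(UNIV :: nat set). W \<Otimes>\<^sub>M borel)"
  shows "(\<lambda>x. trial_result l \<gamma> (g0 (f x)) (g (f x)) (h x)) \<in> L \<rightarrow>\<^sub>M borel"
  unfolding trial_result_def
proof (rule measurable_survivor)
  fix k
  have [measurable]: "(\<lambda>x. h x k) \<in> L \<rightarrow>\<^sub>M W \<Otimes>\<^sub>M borel"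
    by (rule measurable_compose[OF assms(5) measurable_component_singleton]) simp
  have "(\<lambda>x. (\<lambda>(x, w). g' x w) (f x, fst (h x k))) \<in> L \<rightarrow>\<^sub>M borel"
    if [measurable]: "(\<lambda>(x, w). g' x w) \<in> M \<Otimes>\<^sub>M W \<rightarrow>\<^sub>M borel" for g' :: "_ \<Rightarrow> _ \<Rightarrow> 'a"
    by measurable
  from this[OF assms(2)] this[OF assms(3)]
  have [measurable]: "(\<lambda>x. g0 (f x) (fst (h x k))) \<in> L \<rightarrow>\<^sub>M borel" "(\<lambda>x. g (f x) (fst (h x k))) \<in> L \<rightarrow>\<^sub>M borel"
    by simp_all
  show "(\<lambda>x. trial_seq (g0 (f x)) (g (f x)) (h x) k) \<in> L \<rightarrow>\<^sub>M borel \<Otimes>\<^sub>M borel"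
    unfolding trial_seq_def by (cases "k = 0") simp_all
qed (fact assms(1))

abbreviation trial_noise :: "'w measure \<Rightarrow> (nat \<Rightarrow> 'w \<times> real) measure" where
  "trial_noise W \<equiv> (\<Pi>\<^sub>M k\<in>(UNIV :: nat set). W \<Otimes>\<^sub>M unit_unif)"

lemma sets_trial_noise: "sets (trial_noise W) = sets (\<Pi>\<^sub>M k\<in>(UNIV :: nat set). W \<Otimes>\<^sub>M borel)"
  by (intro sets_PiM_cong sets_pair_measure_cong) simp_all

lemma measurable_trial_result_noise:
  fixes l :: "'a::topological_space \<Rightarrow> real"
  assumes "l \<in> borel_measurable borel" "g0 \<in> W \<rightarrow>\<^sub>M borel" "g \<in> W \<rightarrow>\<^sub>M borel"
  shows "trial_result l \<gamma> g0 g \<in> trial_noise W \<rightarrow>\<^sub>M borel"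
proof -
  have "(\<lambda>\<omega>. trial_result l \<gamma> ((\<lambda>_. g0) ()) ((\<lambda>_. g) ()) \<omega>) \<in> trial_noise W \<rightarrow>\<^sub>M borel"
    by (rule measurable_trial_result[where M = "count_space UNIV" and W = W and f = "\<lambda>_. ()"])
       (use assms in \<open>auto intro!: measurable_compose[OF measurable_snd] measurable_ident_sets sets_trial_noise simp: split_beta'\<close>)
  then show ?thesis by simp
qed

text \<open>Only the laws of \<open>g0\<close> and \<open>g\<close> under the noise enter, so every
  coupled realisation of the Euler steps has the resampling kernel as its marginal.\<close>

lemma distr_trial_result:
  fixes g0 g :: "'w \<Rightarrow> 'n::finite torus"
  assumes W: "prob_space W" and l: "l \<in> borel_measurable borel"
    and g0: "g0 \<in> W \<rightarrow>\<^sub>M borel" "distr W borel g0 = euler_kernel b \<gamma> x"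
    and g: "g \<in> W \<rightarrow>\<^sub>M borel" "distr W borel g = \<mu> \<bind> euler_kernel b \<gamma>"
  shows "distr (trial_noise W) borel (trial_result l \<gamma> g0 g) = resample_kernel b l \<gamma> \<mu> x"
proof -
  let ?B = "borel \<Otimes>\<^sub>M borel :: ('n torus \<times> real) measure"
  let ?f = "\<lambda>k w. ((if k = (0 :: nat) then g0 else g) (fst w), snd w :: real)"
  have gk: "(if k = (0 :: nat) then g0 else g) \<in> W \<rightarrow>\<^sub>M borel" for k using g0 g by simp
  have f: "?f k \<in> W \<Otimes>\<^sub>M unit_unif \<rightarrow>\<^sub>M ?B" for k
    by (rule measurable_Pair[OF measurable_compose[OF measurable_fst gk]]) simp
  have T: "(\<lambda>\<omega>. \<lambda>k\<in>UNIV. ?f k (\<omega> k)) = trial_seq g0 g"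
    by (auto simp: trial_seq_def fun_eq_iff)
  have mT: "trial_seq g0 g \<in> trial_noise W \<rightarrow>\<^sub>M (\<Pi>\<^sub>M k\<in>(UNIV :: nat set). ?B)"
    unfolding T[symmetric]
    by (intro measurable_restrict measurable_PiM_component_compose f) auto
  have comp: "(if k = 0 then euler_kernel b \<gamma> x else \<mu> \<bind> euler_kernel b \<gamma>) \<Otimes>\<^sub>M unit_unif =
      distr (W \<Otimes>\<^sub>M unit_unif) ?B (?f k)" for k
  proof -
    have "distr W borel (if k = 0 then g0 else g) \<Otimes>\<^sub>M distr unit_unif borel (\<lambda>u. u) =
        distr (W \<Otimes>\<^sub>M unit_unif) ?B (\<lambda>(w, u). ((if k = 0 then g0 else g) w, u))"
      by (intro pair_measure_distr gk prob_space_imp_sigma_finite prob_space.prob_space_distr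
            prob_space_unit_unif) simp_all
    moreover have "distr unit_unif borel (\<lambda>u. u) = unit_unif"
      by (rule distr_id2) simp
    moreover have "distr W borel (if k = 0 then g0 else g) =
        (if k = 0 then euler_kernel b \<gamma> x else \<mu> \<bind> euler_kernel b \<gamma>)"
      by (simp add: g0(2) g(2))
    ultimately show ?thesis by (simp only: split_beta')
  qed
  have trial: "trial_space b \<gamma> \<mu> x = distr (trial_noise W) (\<Pi>\<^sub>M k\<in>UNIV. ?B) (trial_seq g0 g)"
    unfolding trial_space_def comp T[symmetric]
    by (intro distr_PiM_components[symmetric] prob_space_pair W prob_space_unit_unif f)
  have res: "(\<lambda>\<omega>. fst (\<omega> (survival_index l \<gamma> \<omega>))) \<in> (\<Pi>\<^sub>M k\<in>UNIV. ?B) \<rightarrow>\<^sub>M borel"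
    by (intro measurable_survivor[OF l] measurable_component_singleton) simp
  show ?thesis
    unfolding resample_kernel_def trial
    by (subst distr_distr[OF res mT]) (simp add: comp_def trial_result_def[abs_def])
qed

section \<open>The renewal inequality for coupled trials\<close>

lemma integral_unit_less:
  assumes "0 \<le> r" "r \<le> 1"
  shows "(LINT u|unit_unif. of_bool (u < r)) = r"
proof -
  have "(LINT u|unit_unif. of_bool (u < r)) = (LINT u|unit_unif. (if u \<le> r then 1 else (0 :: real)))"
  proof (rule integral_cong_AE)
    show "AE u in unit_unif. of_bool (u < r) = (if u \<le> r then 1 else (0 :: real))"
      using AE_lborel_singleton[of r] by (intro AE_uniform_measureI) (auto elim!: eventually_mono)
  qed simp_all
  also have "\<dots> = r" using assms by (subst integral_unit_threshold) auto
  finally show ?thesis .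
qed

text \<open>
  The value on the null event that one of the chains never accepts is set to the upper bound of
  the cost; this makes the renewal inequality below hold pointwise.
\<close>

definition trial_cost :: "('a \<Rightarrow> real) \<Rightarrow> real \<Rightarrow> ('a \<Rightarrow> 'a \<Rightarrow> real) \<Rightarrow> ('w \<Rightarrow> 'a) \<Rightarrow> ('w \<Rightarrow> 'a) \<Rightarrow>
    ('w \<Rightarrow> 'a) \<Rightarrow> ('w \<Rightarrow> 'a) \<Rightarrow> (nat \<Rightarrow> 'w \<times> real) \<Rightarrow> real" where
  "trial_cost l \<gamma> D g0 g h0 h \<omega> =
    (if (\<exists>k. accepts l \<gamma> (trial_seq g0 g \<omega>) k) \<and> (\<exists>k. accepts l \<gamma> (trial_seq h0 h \<omega>) k)
     then D (trial_result l \<gamma> g0 g \<omega>) (trial_result l \<gamma> h0 h \<omega>) else 1)"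

text \<open>The common uniform variable has three regimes. Above both killing probabilities both
  chains stop; between them exactly one stops, and the cost is bounded by one; below both, the pair
  restarts with resampled trials on the remaining noise.\<close>

lemma trial_cost_case_nat:
  fixes l :: "'a \<Rightarrow> real" and \<gamma> :: real
  assumes D: "\<And>x y. 0 \<le> D x y" "\<And>x y. D x y \<le> 1"
  defines "p \<equiv> kill_prob l \<gamma>"
  shows "trial_cost l \<gamma> D g0 g h0 h (case_nat (w, u) \<omega>) \<le>
    D (g0 w) (h0 w) * of_bool (\<not> u < max (p (g0 w)) (p (h0 w))) +
    (of_bool (u < max (p (g0 w)) (p (h0 w))) - of_bool (u < min (p (g0 w)) (p (h0 w)))) +
    of_bool (u < min (p (g0 w)) (p (h0 w))) * trial_cost l \<gamma> D g g h h \<omega>"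
    (is "?C \<le> _ * of_bool (\<not> ?b) + (of_bool ?b - of_bool ?a) + _ * ?C'")
proof -
  have split: "(\<exists>k. Q k) \<longleftrightarrow> Q 0 \<or> (\<exists>k. Q (Suc k))" for Q :: "nat \<Rightarrow> bool"
    by (metis not0_implies_Suc)
  have ex: "(\<exists>k. accepts l \<gamma> (trial_seq g0 g (case_nat (w, u) \<omega>)) k) \<longleftrightarrow>
      p (g0 w) \<le> u \<or> (\<exists>k. accepts l \<gamma> (trial_seq g g \<omega>) k)" for g0 g :: "'b \<Rightarrow> 'a"
    unfolding split[of "accepts l \<gamma> _"] accepts_trial_seq_Suc accepts_trial_seq_0 by (simp add: p_def)
  have C1: "?C \<le> 1" "0 \<le> ?C'" using D by (auto simp: trial_cost_def)
  consider "\<not> ?b" | "?b" "\<not> ?a" | "?a" by blast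
  then show ?thesis
  proof cases
    case 1
    then have "p (g0 w) \<le> u" "p (h0 w) \<le> u" by auto
    then show ?thesis
      using 1 by (simp add: trial_cost_def ex trial_result_accept p_def)
  next
    case 2
    then have "of_bool ?b = (1 :: real)" "of_bool (\<not> ?b) = (0 :: real)" "of_bool ?a = (0 :: real)"
      by (simp_all only: of_bool_eq simp_thms)
    then show ?thesis using C1 by (simp only:)
  next
    case 3
    then have lt: "u < p (g0 w)" "u < p (h0 w)" by auto
    then have "?C = ?C'"
      by (auto simp: trial_cost_def ex trial_result_reject p_def)
    moreover have "of_bool ?b = (1 :: real)" "of_bool (\<not> ?b) = (0 :: real)" "of_bool ?a = (1 :: real)"
      using lt by auto
    ultimately show ?thesis by (simp only:)
  qed
qed

lemma measurable_trial_cost: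
  fixes l :: "'a::topological_space \<Rightarrow> real"
  assumes [measurable]: "l \<in> borel_measurable borel" "g0 \<in> W \<rightarrow>\<^sub>M borel" "g \<in> W \<rightarrow>\<^sub>M borel"
    "h0 \<in> W \<rightarrow>\<^sub>M borel" "h \<in> W \<rightarrow>\<^sub>M borel" "(\<lambda>z. D (fst z) (snd z)) \<in> borel_measurable (borel \<Otimes>\<^sub>M borel)"
  shows "trial_cost l \<gamma> D g0 g h0 h \<in> borel_measurable (trial_noise W)"
proof -
  note measurable_trial_result_noise[measurable]
  have [measurable]: "(\<lambda>\<omega>. \<omega> k) \<in> trial_noise W \<rightarrow>\<^sub>M W \<Otimes>\<^sub>M borel" for k :: nat
    using measurable_component_singleton[of k UNIV "\<lambda>_. W \<Otimes>\<^sub>M unit_unif"] by simp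
  have *: "(\<lambda>\<omega>. trial_seq f0 f \<omega> k) \<in> trial_noise W \<rightarrow>\<^sub>M borel \<Otimes>\<^sub>M borel"
    if [measurable]: "f0 \<in> W \<rightarrow>\<^sub>M borel" "f \<in> W \<rightarrow>\<^sub>M borel" for f0 f :: "'b \<Rightarrow> 'a" and k
    unfolding trial_seq_def by (cases "k = 0") simp_all
  have [measurable]: "(\<lambda>\<omega>. D (f \<omega>) (f' \<omega>)) \<in> borel_measurable (trial_noise W)"
    if [measurable]: "f \<in> trial_noise W \<rightarrow>\<^sub>M borel" "f' \<in> trial_noise W \<rightarrow>\<^sub>M borel" for f f'
    using measurable_compose[OF measurable_Pair[OF that] assms(6)] by simp
  have [measurable]: "Measurable.pred (trial_noise W) (\<lambda>\<omega>. accepts l \<gamma> (trial_seq f0 f \<omega>) k)"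
    if "f0 \<in> W \<rightarrow>\<^sub>M borel" "f \<in> W \<rightarrow>\<^sub>M borel" for f0 f :: "'b \<Rightarrow> 'a" and k
    by (intro measurable_accepts * that assms(1))
  show ?thesis unfolding trial_cost_def by measurable
qed

text \<open>Given the first positions, joint acceptance has probability at most 1 - P + \<delta>,
  disagreement at most \<open>\<theta> * D\<close> and joint rejection at most P. That disagreement
  is proportional to \<open>D\<close>, not merely small, is what keeps the estimate
  multiplicative.\<close>

lemma integral_trial_cost_renewal:
  fixes l :: "'a::topological_space \<Rightarrow> real"
  assumes W: "prob_space W"
    and meas [measurable]: "l \<in> borel_measurable borel" "g0 \<in> W \<rightarrow>\<^sub>M borel" "g \<in> W \<rightarrow>\<^sub>M borel"
      "h0 \<in> W \<rightarrow>\<^sub>M borel" "h \<in> W \<rightarrow>\<^sub>M borel" "(\<lambda>z. D (fst z) (snd z)) \<in> borel_measurable (borel \<Otimes>\<^sub>M borel)"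
    and D: "\<And>x y. 0 \<le> D x y" "\<And>x y. D x y \<le> 1"
    and p: "\<And>x. 0 \<le> kill_prob l \<gamma> x" "\<And>x. kill_prob l \<gamma> x \<le> P" "\<And>x. P - \<delta> \<le> kill_prob l \<gamma> x" "P \<le> 1"
    and lip: "\<And>x y. \<bar>kill_prob l \<gamma> x - kill_prob l \<gamma> y\<bar> \<le> \<theta> * D x y"
  shows "(LINT \<omega>|trial_noise W. trial_cost l \<gamma> D g0 g h0 h \<omega>) \<le>
    (1 - P + \<delta> + \<theta>) * (LINT w|W. D (g0 w) (h0 w)) +
    P * (LINT \<omega>|trial_noise W. trial_cost l \<gamma> D g g h h \<omega>)"
proof -
  let ?M = "W \<Otimes>\<^sub>M unit_unif" and ?S = "trial_noise W"
  let ?C = "trial_cost l \<gamma> D g0 g h0 h" and ?C' = "trial_cost l \<gamma> D g g h h"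
  interpret W: prob_space W by fact
  interpret U: prob_space unit_unif by (rule prob_space_unit_unif)
  interpret P: pair_prob_space W unit_unif ..
  interpret S: prob_space ?S by (intro prob_space_PiM prob_space_pair W prob_space_unit_unif)
  interpret seq: sequence_space ?M ..
  interpret MS: pair_prob_space ?M ?S ..
  define E where "E = (LINT \<omega>|?S. ?C' \<omega>)"
  have [measurable]: "?C \<in> borel_measurable ?S" "?C' \<in> borel_measurable ?S"
    by (intro measurable_trial_cost meas)+
  have C: "0 \<le> ?C \<omega>" "?C \<omega> \<le> 1" "0 \<le> ?C' \<omega>" "?C' \<omega> \<le> 1" for \<omega>
    using D by (auto simp: trial_cost_def)
  have E: "0 \<le> E" unfolding E_def using C by (intro Bochner_Integration.integral_nonneg) auto
  define p1 p2 d where "p1 w = max (kill_prob l \<gamma> (g0 w)) (kill_prob l \<gamma> (h0 w))"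
    and "p2 w = min (kill_prob l \<gamma> (g0 w)) (kill_prob l \<gamma> (h0 w))" and "d w = D (g0 w) (h0 w)" for w
  have d_eq: "d = (\<lambda>w. (\<lambda>z. D (fst z) (snd z)) (g0 w, h0 w))" by (simp add: d_def fun_eq_iff)
  have [measurable]: "p1 \<in> borel_measurable W" "p2 \<in> borel_measurable W" "d \<in> borel_measurable W"
    unfolding p1_def p2_def d_eq by measurable
  have d: "0 \<le> d w" "d w \<le> 1" for w using D by (auto simp: d_def)
  have p12: "0 \<le> p1 w" "p1 w \<le> 1" "0 \<le> p2 w" "p2 w \<le> P" "p2 w \<le> 1" "P - \<delta> \<le> p1 w"
      "p1 w - p2 w \<le> \<theta> * d w" "p2 w \<le> p1 w" for w
    using p(1-3)[of "g0 w"] p(1-3)[of "h0 w"] p(4) lip[of "g0 w" "h0 w"] by (auto simp: p1_def p2_def d_def)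
  define H where "H z = d (fst z) * of_bool (\<not> snd z < p1 (fst z)) +
      (of_bool (snd z < p1 (fst z)) - of_bool (snd z < p2 (fst z)))" for z
  define K where "K z = (of_bool (snd z < p2 (fst z)) :: real)" for z
  have [measurable]: "H \<in> borel_measurable ?M" "K \<in> borel_measurable ?M"
    unfolding H_def K_def by measurable
  have H: "\<bar>H z\<bar> \<le> 2" for z using d[of "fst z"] by (auto simp: H_def)
  have K: "\<bar>K z\<bar> \<le> 1" for z by (auto simp: K_def)
  have int: "integrable ?M H" "integrable ?M K" "integrable ?M (\<lambda>z. K z * E)"
    using H order_trans[OF K, of 2] by (auto intro!: P.P.integrable_const_bound[where B = 2] integrable_mult_left)
  have intS: "integrable ?S ?C'" using C by (intro S.integrable_const_bound[where B = 1]) auto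
  have intHK: "integrable (?M \<Otimes>\<^sub>M ?S) (\<lambda>(z, \<omega>). H z + K z * ?C' \<omega>)"
  proof (rule MS.P.integrable_const_bound[where B = 3])
    have "\<bar>H z + K z * ?C' \<omega>\<bar> \<le> 3" for z \<omega>
      using H[of z] K[of z] C(3,4)[of \<omega>] abs_triangle_ineq[of "H z" "K z * ?C' \<omega>"]
        mult_mono[of "\<bar>K z\<bar>" 1 "\<bar>?C' \<omega>\<bar>" 1] by (simp add: abs_mult)
    then show "AE x in ?M \<Otimes>\<^sub>M ?S. norm (case x of (z, \<omega>) \<Rightarrow> H z + K z * ?C' \<omega>) \<le> 3"
      by auto
  qed measurable
  have mc: "(\<lambda>(s, \<omega>). case_nat s \<omega>) \<in> ?M \<Otimes>\<^sub>M ?S \<rightarrow>\<^sub>M ?S" by measurable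
  \<comment> \<open>The first trial is split off: prepending an independent trial to the noise
    sequence does not change its law.\<close>
  have "(LINT \<omega>|?S. ?C \<omega>) = (LINT \<omega>|distr (?M \<Otimes>\<^sub>M ?S) ?S (\<lambda>(s, \<omega>). case_nat s \<omega>). ?C \<omega>)"
    by (simp only: seq.PiM_iter)
  also have "\<dots> = (LINT x|(?M \<Otimes>\<^sub>M ?S). ?C ((\<lambda>(s, \<omega>). case_nat s \<omega>) x))"
    by (rule integral_distr[OF mc]) simp
  also have "\<dots> \<le> (LINT x|(?M \<Otimes>\<^sub>M ?S). (\<lambda>(z, \<omega>). H z + K z * ?C' \<omega>) x)"
  proof (rule integral_mono[OF _ intHK])
    show "integrable (?M \<Otimes>\<^sub>M ?S) (\<lambda>x. ?C ((\<lambda>(s, \<omega>). case_nat s \<omega>) x))"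
      using C by (intro MS.P.integrable_const_bound[where B = 1] measurable_compose[OF mc]) auto
    fix x :: "('b \<times> real) \<times> (nat \<Rightarrow> 'b \<times> real)"
    obtain w u \<omega> where x: "x = ((w, u), \<omega>)" by (metis surj_pair)
    have "?C (case_nat (w, u) \<omega>) \<le> d w * of_bool (\<not> u < p1 w) +
        (of_bool (u < p1 w) - of_bool (u < p2 w)) + of_bool (u < p2 w) * ?C' \<omega>"
      unfolding d_def p1_def p2_def by (rule trial_cost_case_nat) (rule D)+
    then show "?C ((\<lambda>(s, \<omega>). case_nat s \<omega>) x) \<le> (\<lambda>(z, \<omega>). H z + K z * ?C' \<omega>) x"
      by (simp only: x H_def K_def prod.case fst_conv snd_conv)
  qed
  also have "\<dots> = (LINT z|?M. LINT \<omega>|?S. H z + K z * ?C' \<omega>)"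
    using MS.integral_fst'[OF intHK] by simp
  also have "\<dots> = (LINT z|?M. H z + K z * E)"
    using intS by (simp add: E_def S.prob_space)
  also have "\<dots> = (LINT z|?M. H z) + (LINT z|?M. K z) * E"
    using int by simp
  also have "(LINT z|?M. H z) = (LINT w|W. LINT u|unit_unif. H (w, u))"
    using P.integral_fst'[OF int(1)] by simp
  also have "(LINT z|?M. K z) = (LINT w|W. LINT u|unit_unif. K (w, u))"
    using P.integral_fst'[OF int(2)] by simp
  also have "(LINT w|W. LINT u|unit_unif. H (w, u)) = (LINT w|W. d w * (1 - p1 w) + (p1 w - p2 w))"
  proof (intro Bochner_Integration.integral_cong refl)
    fix w
    have i: "integrable unit_unif (\<lambda>u. of_bool (u < r) :: real)" for r
      by (rule U.integrable_const_bound[where B = 1]) auto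
    have "(LINT u|unit_unif. H (w, u)) =
        (LINT u|unit_unif. d w * (1 - of_bool (u < p1 w)) + (of_bool (u < p1 w) - of_bool (u < p2 w)))"
      by (intro Bochner_Integration.integral_cong refl) (simp add: H_def)
    also have "\<dots> = d w * (1 - p1 w) + (p1 w - p2 w)"
      using i p12[of w] U.prob_space by (simp add: integral_unit_less)
    finally show "(LINT u|unit_unif. H (w, u)) = d w * (1 - p1 w) + (p1 w - p2 w)" .
  qed
  also have "(LINT w|W. LINT u|unit_unif. K (w, u)) = (LINT w|W. p2 w)"
    using p12 by (simp add: K_def integral_unit_less)
  also have "(LINT w|W. d w * (1 - p1 w) + (p1 w - p2 w)) \<le> (LINT w|W. (1 - P + \<delta> + \<theta>) * d w)"
  proof (rule integral_mono)
    have "\<bar>d w * (1 - p1 w) + (p1 w - p2 w)\<bar> \<le> 2" for w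
    proof -
      have "0 \<le> d w * (1 - p1 w)" "d w * (1 - p1 w) \<le> 1"
        using d[of w] p12[of w] by (auto intro: mult_le_one)
      then show ?thesis using p12(1-5)[of w] p12(8)[of w] by linarith
    qed
    then show "integrable W (\<lambda>w. d w * (1 - p1 w) + (p1 w - p2 w))"
      by (intro W.integrable_const_bound[where B = 2]) auto
    have "integrable W d" using d by (intro W.integrable_const_bound[where B = 1]) auto
    then show "integrable W (\<lambda>w. (1 - P + \<delta> + \<theta>) * d w)" by simp
    fix w
    have "d w * (1 - p1 w) \<le> d w * (1 - P + \<delta>)"
      using d[of w] p12[of w] by (intro mult_left_mono) auto
    then show "d w * (1 - p1 w) + (p1 w - p2 w) \<le> (1 - P + \<delta> + \<theta>) * d w"
      using p12(7)[of w] by (simp add: algebra_simps)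
  qed
  also have "(LINT w|W. p2 w) * E \<le> P * E"
  proof (intro mult_right_mono E)
    have "0 \<le> P" using p12(3,4) order_trans by blast
    then have "(LINT w|W. p2 w) \<le> (LINT w|W. P)"
      using p12 p(4) by (intro integral_mono W.integrable_const_bound[where B = 1]) auto
    then show "(LINT w|W. p2 w) \<le> P" using W.prob_space by simp
  qed
  finally show ?thesis by (simp add: E_def d_def)
qed

text \<open>From the second trial on the maps no longer change, so with B = 1 - P + \<delta> +
  \<theta> the expected cost of a restarted pair satisfies E \<le> B e + P E, which is solved for E
  since P < 1. One more renewal step accounts for the different first trial.\<close>

lemma integral_trial_result_le:
  fixes l :: "'a::topological_space \<Rightarrow> real"
  assumes W: "prob_space W"
    and meas [measurable]: "l \<in> borel_measurable borel" "g0 \<in> W \<rightarrow>\<^sub>M borel" "g \<in> W \<rightarrow>\<^sub>M borel"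
      "h0 \<in> W \<rightarrow>\<^sub>M borel" "h \<in> W \<rightarrow>\<^sub>M borel" "(\<lambda>z. D (fst z) (snd z)) \<in> borel_measurable (borel \<Otimes>\<^sub>M borel)"
    and D: "\<And>x y. 0 \<le> D x y" "\<And>x y. D x y \<le> 1"
    and p: "\<And>x. 0 \<le> kill_prob l \<gamma> x" "\<And>x. kill_prob l \<gamma> x \<le> P" "\<And>x. P - \<delta> \<le> kill_prob l \<gamma> x" "P < 1"
    and lip: "\<And>x y. \<bar>kill_prob l \<gamma> x - kill_prob l \<gamma> y\<bar> \<le> \<theta> * D x y"
  shows "(LINT \<omega>|trial_noise W. D (trial_result l \<gamma> g0 g \<omega>) (trial_result l \<gamma> h0 h \<omega>)) \<le>
    (1 - P + \<delta> + \<theta>) * ((LINT w|W. D (g0 w) (h0 w)) + P / (1 - P) * (LINT w|W. D (g w) (h w)))"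
proof -
  let ?S = "trial_noise W"
  interpret S: prob_space ?S
    by (intro prob_space_PiM prob_space_pair W prob_space_unit_unif)
  have P: "0 \<le> P" using p(1,2) order_trans by blast
  let ?B = "1 - P + \<delta> + \<theta>"
  define E e where "E = (LINT \<omega>|?S. trial_cost l \<gamma> D g g h h \<omega>)" and "e = (LINT w|W. D (g w) (h w))"
  have [measurable]: "trial_cost l \<gamma> D g0 g h0 h \<in> borel_measurable ?S"
    by (intro measurable_trial_cost meas)
  have m: "(\<lambda>\<omega>. D (trial_result l \<gamma> g0 g \<omega>) (trial_result l \<gamma> h0 h \<omega>)) \<in> borel_measurable ?S"
  proof -
    have "(\<lambda>\<omega>. (trial_result l \<gamma> g0 g \<omega>, trial_result l \<gamma> h0 h \<omega>)) \<in> ?S \<rightarrow>\<^sub>M borel \<Otimes>\<^sub>M borel"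
      by (intro measurable_Pair measurable_trial_result_noise meas)
    from measurable_compose[OF this meas(6)] show ?thesis by simp
  qed
  have "E \<le> ?B * e + P * E"
    unfolding E_def e_def using p(4) by (intro integral_trial_cost_renewal[OF W]) (use assms in auto)
  then have E: "E \<le> ?B * e / (1 - P)" using p(4) by (subst pos_le_divide_eq) (auto simp: algebra_simps)
  have "(LINT \<omega>|?S. D (trial_result l \<gamma> g0 g \<omega>) (trial_result l \<gamma> h0 h \<omega>)) \<le>
      (LINT \<omega>|?S. trial_cost l \<gamma> D g0 g h0 h \<omega>)"
  proof (rule integral_mono)
    show "integrable ?S (\<lambda>\<omega>. D (trial_result l \<gamma> g0 g \<omega>) (trial_result l \<gamma> h0 h \<omega>))"
      using D m by (intro S.integrable_const_bound[where B = 1]) auto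
    have "norm (trial_cost l \<gamma> D g0 g h0 h \<omega>) \<le> 1" for \<omega> using D by (simp add: trial_cost_def)
    then show "integrable ?S (trial_cost l \<gamma> D g0 g h0 h)"
      by (intro S.integrable_const_bound[where B = 1]) auto
    show "D (trial_result l \<gamma> g0 g \<omega>) (trial_result l \<gamma> h0 h \<omega>) \<le> trial_cost l \<gamma> D g0 g h0 h \<omega>" for \<omega>
      using D by (simp add: trial_cost_def)
  qed
  also have "\<dots> \<le> ?B * (LINT w|W. D (g0 w) (h0 w)) + P * E"
    unfolding E_def using p(4) by (intro integral_trial_cost_renewal[OF W]) (use assms in auto)
  also have "\<dots> \<le> ?B * (LINT w|W. D (g0 w) (h0 w)) + P * (?B * e / (1 - P))"
    using E P by (intro add_left_mono mult_left_mono)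
  finally show ?thesis by (simp add: e_def algebra_simps)
qed

section \<open>Couplings and transport costs\<close>

lemma couplingsD:
  assumes "\<pi> \<in> couplings \<mu> \<nu>"
  shows "prob_space \<pi>" "sets \<pi> = sets (\<mu> \<Otimes>\<^sub>M \<nu>)" "distr \<pi> \<mu> fst = \<mu>" "distr \<pi> \<nu> snd = \<nu>"
  using assms by (auto simp: couplings_def space_prob_algebra)

lemma distr_pair_snd:
  assumes "prob_space \<mu>" "prob_space \<nu>"
  shows "distr (\<mu> \<Otimes>\<^sub>M \<nu>) \<nu> snd = \<nu>"
proof (rule measure_eqI)
  interpret \<mu>: prob_space \<mu> by fact
  interpret \<nu>: prob_space \<nu> by fact
  fix A assume "A \<in> sets (distr (\<mu> \<Otimes>\<^sub>M \<nu>) \<nu> snd)"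
  then have A: "A \<in> sets \<nu>" by simp
  have "snd -` A \<inter> space (\<mu> \<Otimes>\<^sub>M \<nu>) = space \<mu> \<times> A"
    using sets.sets_into_space[OF A] by (auto simp: space_pair_measure)
  then show "emeasure (distr (\<mu> \<Otimes>\<^sub>M \<nu>) \<nu> snd) A = emeasure \<nu> A"
    using A by (simp add: emeasure_distr \<nu>.emeasure_pair_measure_Times \<mu>.emeasure_space_1)
qed simp

lemma pair_measure_in_couplings:
  assumes "prob_space \<mu>" "prob_space \<nu>"
  shows "\<mu> \<Otimes>\<^sub>M \<nu> \<in> couplings \<mu> \<nu>"
  using assms prob_space.distr_pair_fst[OF assms(2)] distr_pair_snd[OF assms]
  by (simp add: couplings_def space_prob_algebra prob_space_pair)

section \<open>Transport costs for bounded measurable cost functions\<close>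

context
  fixes M :: "'a measure" and \<rho> :: "'a \<Rightarrow> 'a \<Rightarrow> real" and B :: real
  assumes meas: "(\<lambda>z. \<rho> (fst z) (snd z)) \<in> borel_measurable (M \<Otimes>\<^sub>M M)"
    and nonneg: "\<And>x y. 0 \<le> \<rho> x y" and bound: "\<And>x y. \<rho> x y \<le> B"
begin

lemma integrable_cost:
  assumes "prob_space \<pi>" "sets \<pi> = sets (M \<Otimes>\<^sub>M M)"
  shows "integrable \<pi> (\<lambda>z. \<rho> (fst z) (snd z))"
proof -
  interpret prob_space \<pi> by fact
  have "(\<lambda>z. \<rho> (fst z) (snd z)) \<in> borel_measurable \<pi>"
    unfolding measurable_cong_sets[OF assms(2) refl] by (rule meas)
  then show ?thesis
    using nonneg bound
    by (intro integrable_const_bound[where B = B]) auto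
qed

lemma bdd_below_cost: "bdd_below ((\<lambda>\<pi>. LINT z|\<pi>. \<rho> (fst z) (snd z)) ` couplings \<mu> \<nu>)"
  using nonneg by (intro bdd_belowI[of _ 0]) (auto intro!: Bochner_Integration.integral_nonneg)

lemma wasserstein_le:
  assumes "\<pi> \<in> couplings \<mu> \<nu>"
  shows "wasserstein \<rho> \<mu> \<nu> \<le> (LINT z|\<pi>. \<rho> (fst z) (snd z))"
  unfolding wasserstein_def by (rule cINF_lower[OF bdd_below_cost assms])

lemma le_wasserstein:
  assumes "prob_space \<mu>" "prob_space \<nu>"
    and "\<And>\<pi>. \<pi> \<in> couplings \<mu> \<nu> \<Longrightarrow> c \<le> (LINT z|\<pi>. \<rho> (fst z) (snd z))"
  shows "c \<le> wasserstein \<rho> \<mu> \<nu>"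
  unfolding wasserstein_def using pair_measure_in_couplings[OF assms(1,2)] assms(3)
  by (intro cINF_greatest) auto

lemma wasserstein_bounds:
  assumes "\<mu> \<in> space (prob_algebra M)" "\<nu> \<in> space (prob_algebra M)"
  shows "0 \<le> wasserstein \<rho> \<mu> \<nu>" "wasserstein \<rho> \<mu> \<nu> \<le> B"
proof -
  have P: "prob_space \<mu>" "prob_space \<nu>" "sets \<mu> = sets M" "sets \<nu> = sets M"
    using assms by (auto simp: space_prob_algebra)
  show "0 \<le> wasserstein \<rho> \<mu> \<nu>"
    using nonneg by (intro le_wasserstein P Bochner_Integration.integral_nonneg) auto
  interpret prob_space "\<mu> \<Otimes>\<^sub>M \<nu>" by (rule prob_space_pair[OF P(1,2)])
  have "wasserstein \<rho> \<mu> \<nu> \<le> (LINT z|(\<mu> \<Otimes>\<^sub>M \<nu>). \<rho> (fst z) (snd z))"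
    by (intro wasserstein_le pair_measure_in_couplings P)
  also have "\<dots> \<le> (LINT z|(\<mu> \<Otimes>\<^sub>M \<nu>). B)"
    using P bound by (intro integral_mono integrable_cost prob_space_axioms sets_pair_measure_cong) auto
  also have "\<dots> = B" using prob_space by simp
  finally show "wasserstein \<rho> \<mu> \<nu> \<le> B" .
qed

lemma wasserstein_mono_cost:
  assumes "\<mu> \<in> space (prob_algebra M)" "\<nu> \<in> space (prob_algebra M)" and A: "0 < A"
    and \<sigma>: "\<And>x y. 0 \<le> \<sigma> x y" "\<And>x y. \<sigma> x y \<le> A * \<rho> x y"
  shows "wasserstein \<sigma> \<mu> \<nu> \<le> A * wasserstein \<rho> \<mu> \<nu>"
proof -
  have P: "prob_space \<mu>" "prob_space \<nu>" "sets \<mu> = sets M" "sets \<nu> = sets M"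
    using assms by (auto simp: space_prob_algebra)
  have "wasserstein \<sigma> \<mu> \<nu> / A \<le> wasserstein \<rho> \<mu> \<nu>"
  proof (rule le_wasserstein[OF P(1,2)])
    fix \<pi> assume \<pi>: "\<pi> \<in> couplings \<mu> \<nu>"
    have "sets \<pi> = sets (M \<Otimes>\<^sub>M M)"
      using couplingsD(2)[OF \<pi>] P by (simp cong: sets_pair_measure_cong)
    with couplingsD(1)[OF \<pi>] have int: "integrable \<pi> (\<lambda>z. \<rho> (fst z) (snd z))"
      by (rule integrable_cost)
    have "wasserstein \<sigma> \<mu> \<nu> \<le> (LINT z|\<pi>. \<sigma> (fst z) (snd z))"
      unfolding wasserstein_def using \<sigma>(1) \<pi>
      by (intro cINF_lower bdd_belowI[of _ 0]) (auto intro!: Bochner_Integration.integral_nonneg)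
    \<comment> \<open>If \<open>\<sigma>\<close> is not integrable, its integral is 0 by convention,
      and the inequality holds because the right-hand side is nonnegative.\<close>
    also have "\<dots> \<le> (LINT z|\<pi>. A * \<rho> (fst z) (snd z))"
      using int \<sigma> A nonneg by (intro integral_mono') auto
    also have "\<dots> = A * (LINT z|\<pi>. \<rho> (fst z) (snd z))" by simp
    finally show "wasserstein \<sigma> \<mu> \<nu> / A \<le> (LINT z|\<pi>. \<rho> (fst z) (snd z))"
      using A by (simp add: pos_divide_le_eq mult.commute)
  qed
  then show ?thesis using A by (simp add: pos_divide_le_eq mult.commute)
qed

text \<open>Any coupling of the initial laws followed by the kernel \<open>C\<close> couples the
  images. The pointwise bound is integrated against that coupling before the infimum is taken, so no
  optimal coupling is involved.\<close>

lemma wasserstein_bind_le: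
  assumes \<mu>: "\<mu> \<in> space (prob_algebra M)" and \<nu>: "\<nu> \<in> space (prob_algebra M)"
    and K: "K \<in> M \<rightarrow>\<^sub>M prob_algebra M" and C: "C \<in> M \<Otimes>\<^sub>M M \<rightarrow>\<^sub>M prob_algebra (M \<Otimes>\<^sub>M M)"
    and fst: "\<And>z. z \<in> space (M \<Otimes>\<^sub>M M) \<Longrightarrow> distr (C z) M fst = K (fst z)"
    and snd: "\<And>z. z \<in> space (M \<Otimes>\<^sub>M M) \<Longrightarrow> distr (C z) M snd = K (snd z)"
    and cost: "\<And>z. z \<in> space (M \<Otimes>\<^sub>M M) \<Longrightarrow>
      (LINT w|C z. \<rho> (fst w) (snd w)) \<le> q * \<rho> (fst z) (snd z)"
    and q: "0 \<le> q"
  shows "wasserstein \<rho> (\<mu> \<bind> K) (\<nu> \<bind> K) \<le> q * wasserstein \<rho> \<mu> \<nu>"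
proof -
  let ?\<rho> = "\<lambda>z. \<rho> (fst z) (snd z)" and ?MM = "M \<Otimes>\<^sub>M M"
  have P: "prob_space \<mu>" "prob_space \<nu>" and S: "sets \<mu> = sets M" "sets \<nu> = sets M"
    using \<mu> \<nu> by (auto simp: space_prob_algebra)
  have le: "wasserstein \<rho> (\<mu> \<bind> K) (\<nu> \<bind> K) \<le> q * (LINT z|\<pi>. ?\<rho> z)" if \<pi>: "\<pi> \<in> couplings \<mu> \<nu>" for \<pi>
  proof -
    note \<pi>D = couplingsD[OF \<pi>]
    have S\<pi>: "sets \<pi> = sets ?MM" using \<pi>D(2) S by (simp cong: sets_pair_measure_cong)
    have \<pi>M: "\<pi> \<in> space (prob_algebra ?MM)" using \<pi>D(1) S\<pi> by (simp add: space_prob_algebra)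
    have space\<pi>: "space \<pi> = space ?MM" by (rule sets_eq_imp_space_eq[OF S\<pi>])
    have ne: "space \<pi> \<noteq> {}" by (rule prob_space.not_empty[OF \<pi>D(1)])
    have C': "C \<in> \<pi> \<rightarrow>\<^sub>M subprob_algebra ?MM"
      using measurable_prob_algebraD[OF C] measurable_cong_sets[OF S\<pi> refl] by blast
    have K': "K \<in> M \<rightarrow>\<^sub>M subprob_algebra M" by (rule measurable_prob_algebraD[OF K])
    have proj: "fst \<in> \<pi> \<rightarrow>\<^sub>M M" "snd \<in> \<pi> \<rightarrow>\<^sub>M M"
      by (simp_all add: measurable_cong_sets[OF S\<pi> refl])
    have "distr (\<pi> \<bind> C) M fst = \<pi> \<bind> (\<lambda>z. distr (C z) M fst)"
      by (rule distr_bind[OF C' ne]) simp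
    also have "\<dots> = \<pi> \<bind> (\<lambda>z. K (fst z))"
      by (rule bind_cong) (auto simp: space\<pi> fst)
    also have "\<dots> = distr \<pi> M fst \<bind> K" by (rule bind_distr[symmetric, OF proj(1) K' ne])
    also have "distr \<pi> M fst = \<mu>" using \<pi>D(3) S(1) by (simp cong: distr_cong)
    finally have m1: "distr (\<pi> \<bind> C) M fst = \<mu> \<bind> K" .
    have "distr (\<pi> \<bind> C) M snd = \<pi> \<bind> (\<lambda>z. distr (C z) M snd)"
      by (rule distr_bind[OF C' ne]) simp
    also have "\<dots> = \<pi> \<bind> (\<lambda>z. K (snd z))"
      by (rule bind_cong) (auto simp: space\<pi> snd)
    also have "\<dots> = distr \<pi> M snd \<bind> K" by (rule bind_distr[symmetric, OF proj(2) K' ne])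
    also have "distr \<pi> M snd = \<nu>" using \<pi>D(4) S(2) by (simp cong: distr_cong)
    finally have m2: "distr (\<pi> \<bind> C) M snd = \<nu> \<bind> K" .
    have SK: "sets (\<mu> \<bind> K) = sets M" "sets (\<nu> \<bind> K) = sets M"
      by (rule sets_bind'[OF _ K], fact)+
    have PC: "prob_space (\<pi> \<bind> C)" by (rule prob_space_bind'[OF \<pi>M C])
    have SC: "sets (\<pi> \<bind> C) = sets ?MM" by (rule sets_bind'[OF \<pi>M C])
    have "distr (\<pi> \<bind> C) (\<mu> \<bind> K) fst = distr (\<pi> \<bind> C) M fst"
      "distr (\<pi> \<bind> C) (\<nu> \<bind> K) snd = distr (\<pi> \<bind> C) M snd"
      using SK by (simp_all cong: distr_cong)
    then have coup: "\<pi> \<bind> C \<in> couplings (\<mu> \<bind> K) (\<nu> \<bind> K)"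
      using PC SC SK m1 m2
      by (simp add: couplings_def space_prob_algebra cong: sets_pair_measure_cong)
    have int: "integrable N ?\<rho>" if "N \<in> space (prob_algebra ?MM)" for N
      using that by (intro integrable_cost) (auto simp: space_prob_algebra)
    have nn: "(\<integral>\<^sup>+z. ennreal (?\<rho> z) \<partial>N) = ennreal (LINT z|N. ?\<rho> z)"
      if "N \<in> space (prob_algebra ?MM)" for N
      by (rule nn_integral_eq_integral[OF int[OF that]]) (simp add: nonneg)
    have I: "0 \<le> (LINT z|\<pi>. ?\<rho> z)" using nonneg by (intro Bochner_Integration.integral_nonneg) auto
    have "ennreal (LINT z|(\<pi> \<bind> C). ?\<rho> z) = (\<integral>\<^sup>+z. ennreal (?\<rho> z) \<partial>(\<pi> \<bind> C))"
      using PC SC by (intro nn[symmetric]) (simp add: space_prob_algebra)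
    also have "\<dots> = (\<integral>\<^sup>+z. \<integral>\<^sup>+w. ennreal (?\<rho> w) \<partial>C z \<partial>\<pi>)"
      by (rule nn_integral_bind[OF measurable_compose[OF meas measurable_ennreal] C'])
    also have "\<dots> = (\<integral>\<^sup>+z. ennreal (LINT w|C z. ?\<rho> w) \<partial>\<pi>)"
      using measurable_space[OF C] by (intro nn_integral_cong nn) (simp add: space\<pi>)
    also have "\<dots> \<le> (\<integral>\<^sup>+z. ennreal (q * ?\<rho> z) \<partial>\<pi>)"
      using cost by (intro nn_integral_mono ennreal_leI) (simp add: space\<pi>)
    also have "\<dots> = ennreal (q * (LINT z|\<pi>. ?\<rho> z))"
      using q nonneg int[OF \<pi>M] by (subst nn_integral_eq_integral) auto
    finally have "(LINT z|(\<pi> \<bind> C). ?\<rho> z) \<le> q * (LINT z|\<pi>. ?\<rho> z)"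
      using q I by (simp add: ennreal_le_iff)
    then show ?thesis using wasserstein_le[OF coup] by linarith
  qed
  show ?thesis
  \<comment> \<open>Passing to the infimum divides by \<open>q\<close>. When \<open>q\<close> is 0,
    a single coupling, here the product, already gives the bound zero.\<close>
  proof (cases "q = 0")
    case True
    then show ?thesis using le[OF pair_measure_in_couplings[OF P]] by simp
  next
    case False
    have "wasserstein \<rho> (\<mu> \<bind> K) (\<nu> \<bind> K) / q \<le> wasserstein \<rho> \<mu> \<nu>"
      using le q False by (intro le_wasserstein P) (simp add: divide_le_eq mult.commute)
    then show ?thesis using q False by (simp add: divide_le_eq mult.commute)
  qed
qed

end

section \<open>The particle system\<close>

text \<open>The noise of one trial: the label of the particle drawn from the empirical measure, the
  Gaussian increment, and the uniform variable deciding between meeting and reflection. The uniform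
  variable compared with the killing probability is a different one, added by
  \<open>trial_noise\<close>.\<close>

definition particle_noise :: "nat \<Rightarrow> (nat \<times> (real ^ 'n::finite) \<times> real) measure" where
  "particle_noise N = uniform_count_measure {..<N} \<Otimes>\<^sub>M (std_gaussian \<Otimes>\<^sub>M unit_unif)"

definition step_fst :: "('n::finite torus \<Rightarrow> real ^ 'n) \<Rightarrow> real \<Rightarrow>
    (nat \<Rightarrow> 'n torus) \<times> (nat \<Rightarrow> 'n torus) \<Rightarrow> nat \<Rightarrow> (real ^ 'n) \<times> real \<Rightarrow> 'n torus" where
  "step_fst b \<gamma> z j v = euler_step b \<gamma> (fst z j) (fst v)"

definition step_snd :: "('n::finite torus \<Rightarrow> real ^ 'n) \<Rightarrow> real \<Rightarrow>
    (nat \<Rightarrow> 'n torus) \<times> (nat \<Rightarrow> 'n torus) \<Rightarrow> nat \<Rightarrow> (real ^ 'n) \<times> real \<Rightarrow> 'n torus" where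
  "step_snd b \<gamma> z j v = euler_step b \<gamma> (snd z j) (coupled_noise b \<gamma> (fst z j) (snd z j) v)"

lemma prob_space_gauss_unif: "prob_space (std_gaussian \<Otimes>\<^sub>M unit_unif)"
  by (intro prob_space_pair prob_space_std_gaussian prob_space_unit_unif)

lemma prob_space_particle_noise: "1 \<le> N \<Longrightarrow> prob_space (particle_noise N)"
  unfolding particle_noise_def
  by (intro prob_space_pair prob_space_std_gaussian prob_space_unit_unif prob_space_uniform_count_measure)
     (auto simp: lessThan_empty_iff)

lemma sets_particle_noise [measurable_cong]:
  "sets (particle_noise N) = sets (count_space {..<N} \<Otimes>\<^sub>M (borel \<Otimes>\<^sub>M borel))"
  unfolding particle_noise_def
  by (intro sets_pair_measure_cong sets_uniform_count_measure_count_space sets_std_gaussian sets_unit_unif)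

lemma measurable_coordinate [measurable]:
  "j < N \<Longrightarrow> (\<lambda>x. x j) \<in> torus_power N \<rightarrow>\<^sub>M borel"
  unfolding torus_power_def by (rule measurable_component_singleton) simp

lemma measurable_steps:
  assumes [measurable]: "b \<in> borel \<rightarrow>\<^sub>M borel" "f \<in> M \<rightarrow>\<^sub>M torus_power N \<Otimes>\<^sub>M torus_power N"
    "v \<in> M \<rightarrow>\<^sub>M borel \<Otimes>\<^sub>M borel" and j: "j \<in> M \<rightarrow>\<^sub>M count_space {..<N}"
  shows "(\<lambda>x. step_fst b \<gamma> (f x) (j x) (v x)) \<in> M \<rightarrow>\<^sub>M borel"
    and "(\<lambda>x. step_snd b \<gamma> (f x) (j x) (v x)) \<in> M \<rightarrow>\<^sub>M borel"
proof -
  note measurable_euler_step[measurable] measurable_coupled_noise[measurable]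
  have steps: "(\<lambda>x. step_fst b \<gamma> (f x) i (v x)) \<in> M \<rightarrow>\<^sub>M borel" "(\<lambda>x. step_snd b \<gamma> (f x) i (v x)) \<in> M \<rightarrow>\<^sub>M borel"
    if i [measurable]: "i \<in> {..<N}" for i
  proof -
    have [measurable]: "(\<lambda>x. fst (f x) i) \<in> M \<rightarrow>\<^sub>M borel" "(\<lambda>x. snd (f x) i) \<in> M \<rightarrow>\<^sub>M borel"
      using i by (auto intro: measurable_compose[OF _ measurable_coordinate] simp: measurable_fst'' measurable_snd'')
    show "(\<lambda>x. step_fst b \<gamma> (f x) i (v x)) \<in> M \<rightarrow>\<^sub>M borel" "(\<lambda>x. step_snd b \<gamma> (f x) i (v x)) \<in> M \<rightarrow>\<^sub>M borel"
      unfolding step_fst_def step_snd_def by measurable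
  qed
  show "(\<lambda>x. step_fst b \<gamma> (f x) (j x) (v x)) \<in> M \<rightarrow>\<^sub>M borel"
    by (rule measurable_compose_countable'[OF steps(1) j]) simp_all
  show "(\<lambda>x. step_snd b \<gamma> (f x) (j x) (v x)) \<in> M \<rightarrow>\<^sub>M borel"
    by (rule measurable_compose_countable'[OF steps(2) j]) simp_all
qed

lemma distr_particle_noise_snd:
  assumes N: "1 \<le> N" and f: "f \<in> borel \<Otimes>\<^sub>M borel \<rightarrow>\<^sub>M L"
  shows "distr (particle_noise N) L (\<lambda>w. f (snd w)) = distr (std_gaussian \<Otimes>\<^sub>M unit_unif) L f"
proof -
  have "distr (distr (particle_noise N) (std_gaussian \<Otimes>\<^sub>M unit_unif) snd) L f =
      distr (particle_noise N) L (\<lambda>w. f (snd w))"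
    using f by (subst distr_distr) (simp_all add: comp_def particle_noise_def)
  also have "distr (particle_noise N) (std_gaussian \<Otimes>\<^sub>M unit_unif) snd = std_gaussian \<Otimes>\<^sub>M unit_unif"
    unfolding particle_noise_def using N
    by (intro distr_pair_snd prob_space_gauss_unif prob_space_uniform_count_measure)
       (auto simp: lessThan_empty_iff)
  finally show ?thesis by simp
qed

lemma euler_kernel_measurable:
  assumes b: "b \<in> borel \<rightarrow>\<^sub>M borel"
  shows "euler_kernel b \<gamma> \<in> borel \<rightarrow>\<^sub>M prob_algebra borel"
proof -
  have "(\<lambda>x. distr std_gaussian borel (euler_step b \<gamma> x)) \<in> borel \<rightarrow>\<^sub>M prob_algebra borel"
  proof (rule measurable_distr_prob_space2[where M = borel])
    show "(\<lambda>_. std_gaussian) \<in> borel \<rightarrow>\<^sub>M prob_algebra borel"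
      by (rule measurable_const) (simp add: space_prob_algebra prob_space_std_gaussian)
    show "(\<lambda>(x, y). euler_step b \<gamma> x y) \<in> borel \<Otimes>\<^sub>M borel \<rightarrow>\<^sub>M borel"
      unfolding split_beta' by (intro measurable_euler_step b) auto
  qed
  then show ?thesis by (simp add: euler_kernel_eq[abs_def])
qed

text \<open>A uniform label realises the empirical measure, and given the label the step has an
  Euler law. As \<open>F\<close> is constrained only through its law, the second system, whose noise
  also involves the first, is covered.\<close>

lemma distr_particle_noise_mixture:
  fixes x :: "nat \<Rightarrow> 'n::finite torus" and F :: "nat \<Rightarrow> (real ^ 'n) \<times> real \<Rightarrow> 'n torus"
  assumes N: "1 \<le> N" and b: "b \<in> borel \<rightarrow>\<^sub>M borel"
    and F: "\<And>j. j < N \<Longrightarrow> F j \<in> borel \<Otimes>\<^sub>M borel \<rightarrow>\<^sub>M borel"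
      "\<And>j. j < N \<Longrightarrow> distr (std_gaussian \<Otimes>\<^sub>M unit_unif) borel (F j) = euler_kernel b \<gamma> (x j)"
  shows "distr (particle_noise N) borel (\<lambda>w. F (fst w) (snd w)) = empirical_measure N x \<bind> euler_kernel b \<gamma>"
proof (rule measure_eqI)
  let ?W = "particle_noise N" and ?V = "std_gaussian \<Otimes>\<^sub>M unit_unif :: ((real ^ 'n) \<times> real) measure"
  let ?U = "uniform_count_measure {..<N}"
  interpret V: prob_space ?V by (rule prob_space_gauss_unif)
  interpret U: prob_space ?U using N by (intro prob_space_uniform_count_measure) (auto simp: lessThan_empty_iff)
  have FV: "F j \<in> ?V \<rightarrow>\<^sub>M borel" if "j < N" for j using F(1)[OF that] by simp
  have mF: "(\<lambda>w. F (fst w) (snd w)) \<in> ?W \<rightarrow>\<^sub>M borel"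
    by (subst measurable_cong_sets[OF sets_particle_noise refl], rule measurable_pair_measure_countable1)
       (use F(1) in auto)
  have x: "x \<in> ?U \<rightarrow>\<^sub>M borel" by (simp add: measurable_cong_sets[OF sets_uniform_count_measure_count_space refl])
  have emp: "empirical_measure N x \<in> space (prob_algebra borel)"
    unfolding empirical_measure_def using U.prob_space_distr[OF x] by (simp add: space_prob_algebra)
  note K = euler_kernel_measurable[OF b]
  show "sets (distr ?W borel (\<lambda>w. F (fst w) (snd w))) = sets (empirical_measure N x \<bind> euler_kernel b \<gamma>)"
    by (simp add: sets_bind'[OF emp K])
  fix A assume "A \<in> sets (distr ?W borel (\<lambda>w. F (fst w) (snd w)))"
  then have A [measurable]: "A \<in> sets borel" by simp
  have "emeasure (distr ?W borel (\<lambda>w. F (fst w) (snd w))) A =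
      (\<integral>\<^sup>+w. indicator A (F (fst w) (snd w)) \<partial>?W)"
    by (subst nn_integral_indicator[symmetric], simp, subst nn_integral_distr[OF mF]) simp_all
  also have "\<dots> = (\<integral>\<^sup>+j. \<integral>\<^sup>+v. indicator A (F j v) \<partial>?V \<partial>?U)"
    using measurable_compose[OF mF borel_measurable_indicator[OF A]] unfolding particle_noise_def
    by (subst V.nn_integral_fst[symmetric]) auto
  also have "\<dots> = (\<integral>\<^sup>+j. emeasure (euler_kernel b \<gamma> (x j)) A \<partial>?U)"
  proof (rule nn_integral_cong)
    fix j assume "j \<in> space ?U"
    then have j: "j < N" by (simp add: space_uniform_count_measure)
    have "(\<integral>\<^sup>+v. indicator A (F j v) \<partial>?V) = emeasure (distr ?V borel (F j)) A"
      by (subst nn_integral_indicator[symmetric], simp, subst nn_integral_distr[OF FV[OF j]]) simp_all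
    then show "(\<integral>\<^sup>+v. indicator A (F j v) \<partial>?V) = emeasure (euler_kernel b \<gamma> (x j)) A"
      by (simp add: F(2)[OF j])
  qed
  also have "\<dots> = (\<integral>\<^sup>+y. emeasure (euler_kernel b \<gamma> y) A \<partial>empirical_measure N x)"
    unfolding empirical_measure_def
    by (subst nn_integral_distr[OF x])
       (simp_all add: measurable_compose[OF measurable_prob_algebraD[OF K] measurable_emeasure_subprob_algebra])
  also have "\<dots> = emeasure (empirical_measure N x \<bind> euler_kernel b \<gamma>) A"
    by (rule emeasure_bind_prob_algebra[symmetric, OF emp K A])
  finally show "emeasure (distr ?W borel (\<lambda>w. F (fst w) (snd w))) A =
      emeasure (empirical_measure N x \<bind> euler_kernel b \<gamma>) A" .
qed

section \<open>All particles driven by one noise\<close>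

definition particle_result :: "('n::finite torus \<Rightarrow> real) \<Rightarrow> real \<Rightarrow> nat \<Rightarrow>
    (nat \<Rightarrow> (real ^ 'n) \<times> real \<Rightarrow> 'n torus) \<Rightarrow>
    (nat \<Rightarrow> nat \<Rightarrow> (nat \<times> (real ^ 'n) \<times> real) \<times> real) \<Rightarrow> nat \<Rightarrow> 'n torus" where
  "particle_result l \<gamma> N F \<omega> =
    (\<lambda>i\<in>{..<N}. trial_result l \<gamma> (\<lambda>w. F i (snd w)) (\<lambda>w. F (fst w) (snd w)) (\<omega> i))"

abbreviation system_noise :: "nat \<Rightarrow> (nat \<Rightarrow> nat \<Rightarrow> (nat \<times> (real ^ 'n::finite) \<times> real) \<times> real) measure" where
  "system_noise N \<equiv> (\<Pi>\<^sub>M i\<in>{..<N}. trial_noise (particle_noise N))"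

lemma prob_space_trial_noise: "1 \<le> N \<Longrightarrow> prob_space (trial_noise (particle_noise N))"
  by (intro prob_space_PiM prob_space_pair prob_space_particle_noise prob_space_unit_unif)

lemma prob_space_system_noise: "1 \<le> N \<Longrightarrow> prob_space (system_noise N)"
  by (intro prob_space_PiM prob_space_trial_noise)

lemma measurable_mixture_step:
  fixes F :: "nat \<Rightarrow> (real ^ 'n::finite) \<times> real \<Rightarrow> 'n torus"
  assumes "\<And>j. j < N \<Longrightarrow> F j \<in> borel \<Otimes>\<^sub>M borel \<rightarrow>\<^sub>M borel"
  shows "i < N \<Longrightarrow> (\<lambda>w. F i (snd w)) \<in> particle_noise N \<rightarrow>\<^sub>M borel"
    and "(\<lambda>w. F (fst w) (snd w)) \<in> particle_noise N \<rightarrow>\<^sub>M borel"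
proof -
  show "i < N \<Longrightarrow> (\<lambda>w. F i (snd w)) \<in> particle_noise N \<rightarrow>\<^sub>M borel"
    using measurable_compose[OF measurable_snd assms] by (simp add: measurable_cong_sets[OF sets_particle_noise refl])
  show "(\<lambda>w. F (fst w) (snd w)) \<in> particle_noise N \<rightarrow>\<^sub>M borel"
    by (subst measurable_cong_sets[OF sets_particle_noise refl], rule measurable_pair_measure_countable1)
       (use assms in auto)
qed

lemma distr_particle_result:
  fixes x :: "nat \<Rightarrow> 'n::finite torus" and F :: "nat \<Rightarrow> (real ^ 'n) \<times> real \<Rightarrow> 'n torus"
  assumes N: "1 \<le> N" and b: "b \<in> borel \<rightarrow>\<^sub>M borel" and l: "l \<in> borel_measurable borel"
    and F: "\<And>j. j < N \<Longrightarrow> F j \<in> borel \<Otimes>\<^sub>M borel \<rightarrow>\<^sub>M borel"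
      "\<And>j. j < N \<Longrightarrow> distr (std_gaussian \<Otimes>\<^sub>M unit_unif) borel (F j) = euler_kernel b \<gamma> (x j)"
  shows "distr (system_noise N) (torus_power N) (particle_result l \<gamma> N F) = particle_kernel b l \<gamma> N x"
proof -
  let ?R = "\<lambda>i. trial_result l \<gamma> (\<lambda>w. F i (snd w)) (\<lambda>w. F (fst w) (snd w))"
  have "distr (system_noise N) (torus_power N) (particle_result l \<gamma> N F) =
      distr (system_noise N) (\<Pi>\<^sub>M i\<in>{..<N}. borel) (\<lambda>\<omega>. \<lambda>i\<in>{..<N}. ?R i (\<omega> i))"
    by (simp add: torus_power_def particle_result_def[abs_def])
  also have "\<dots> = (\<Pi>\<^sub>M i\<in>{..<N}. distr (trial_noise (particle_noise N)) borel (?R i))"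
    using N F(1) by (intro distr_PiM_components prob_space_trial_noise measurable_trial_result_noise l
        measurable_mixture_step) auto
  also have "\<dots> = (\<Pi>\<^sub>M i\<in>{..<N}. resample_kernel b l \<gamma> (empirical_measure N x) (x i))"
  proof (rule PiM_cong[OF refl])
    fix i assume "i \<in> {..<N}"
    then have i: "i < N" by simp
    show "distr (trial_noise (particle_noise N)) borel (?R i) =
        resample_kernel b l \<gamma> (empirical_measure N x) (x i)"
      using i by (intro distr_trial_result prob_space_particle_noise N l measurable_mixture_step F
          distr_particle_noise_mixture b distr_particle_noise_snd[THEN trans]) auto
  qed
  finally show ?thesis by (simp add: particle_kernel_def)
qed

lemma measurable_particle_result:
  fixes F :: "'s \<Rightarrow> nat \<Rightarrow> (real ^ 'n::finite) \<times> real \<Rightarrow> 'n torus"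
  assumes l: "l \<in> borel_measurable borel"
    and F: "(\<lambda>(z, w). F z (fst w) (snd w)) \<in> M \<Otimes>\<^sub>M particle_noise N \<rightarrow>\<^sub>M borel"
      "\<And>i. i < N \<Longrightarrow> (\<lambda>(z, w). F z i (snd w)) \<in> M \<Otimes>\<^sub>M particle_noise N \<rightarrow>\<^sub>M borel"
  shows "(\<lambda>(z, \<omega>). particle_result l \<gamma> N (F z) \<omega>) \<in> M \<Otimes>\<^sub>M system_noise N \<rightarrow>\<^sub>M torus_power N"
  unfolding particle_result_def torus_power_def split_beta'
proof (rule measurable_restrict)
  fix i assume i: "i \<in> {..<N}"
  have "(\<lambda>x. snd x i) \<in> M \<Otimes>\<^sub>M system_noise N \<rightarrow>\<^sub>M trial_noise (particle_noise N)"
    by (rule measurable_compose[OF measurable_snd measurable_component_singleton[OF i]])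
  then have h: "(\<lambda>x. snd x i) \<in> M \<Otimes>\<^sub>M system_noise N \<rightarrow>\<^sub>M (\<Pi>\<^sub>M k\<in>(UNIV :: nat set). particle_noise N \<Otimes>\<^sub>M borel)"
    by (simp add: measurable_cong_sets[OF refl sets_trial_noise])
  show "(\<lambda>x. trial_result l \<gamma> (\<lambda>w. F (fst x) i (snd w)) (\<lambda>w. F (fst x) (fst w) (snd w)) (snd x i))
      \<in> M \<Otimes>\<^sub>M system_noise N \<rightarrow>\<^sub>M borel"
    using i by (intro measurable_trial_result[of l "\<lambda>z w. F z i (snd w)" M "particle_noise N"
      "\<lambda>z w. F z (fst w) (snd w)" fst "M \<Otimes>\<^sub>M system_noise N" "\<lambda>x. snd x i"] l F h measurable_fst) auto
qed

lemma step_fst_measurable: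
  assumes "b \<in> borel \<rightarrow>\<^sub>M borel"
  shows "step_fst b \<gamma> z j \<in> borel \<Otimes>\<^sub>M borel \<rightarrow>\<^sub>M borel"
  unfolding step_fst_def[abs_def] by (intro measurable_euler_step assms) auto

lemma step_snd_measurable:
  assumes "b \<in> borel \<rightarrow>\<^sub>M borel"
  shows "step_snd b \<gamma> z j \<in> borel \<Otimes>\<^sub>M borel \<rightarrow>\<^sub>M borel"
  unfolding step_snd_def[abs_def]
  by (intro measurable_euler_step measurable_coupled_noise assms) auto

lemma distr_steps:
  assumes "b \<in> borel \<rightarrow>\<^sub>M borel"
  shows "distr (std_gaussian \<Otimes>\<^sub>M unit_unif) borel (step_fst b \<gamma> z j) = euler_kernel b \<gamma> (fst z j)"
    and "distr (std_gaussian \<Otimes>\<^sub>M unit_unif) borel (step_snd b \<gamma> z j) = euler_kernel b \<gamma> (snd z j)"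
  using distr_euler_step_fst[OF assms] distr_euler_step_coupled[OF assms]
  by (simp_all add: step_fst_def[abs_def] step_snd_def[abs_def])

text \<open>Both systems read the same noise, hence draw the same labels; the first trial of a
  particle ignores the label and moves the particle itself. The pair of states enters only through
  the step maps, which yields measurability in the pair.\<close>

definition coupled_kernel :: "('n::finite torus \<Rightarrow> real ^ 'n) \<Rightarrow> ('n torus \<Rightarrow> real) \<Rightarrow> real \<Rightarrow> nat \<Rightarrow>
    (nat \<Rightarrow> 'n torus) \<times> (nat \<Rightarrow> 'n torus) \<Rightarrow> ((nat \<Rightarrow> 'n torus) \<times> (nat \<Rightarrow> 'n torus)) measure" where
  "coupled_kernel b l \<gamma> N z = distr (system_noise N) (torus_power N \<Otimes>\<^sub>M torus_power N)
    (\<lambda>\<omega>. (particle_result l \<gamma> N (step_fst b \<gamma> z) \<omega>, particle_result l \<gamma> N (step_snd b \<gamma> z) \<omega>))"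

lemma measurable_particle_result_steps:
  fixes b :: "'n::finite torus \<Rightarrow> real ^ 'n"
  assumes b: "b \<in> borel \<rightarrow>\<^sub>M borel" and l: "l \<in> borel_measurable borel"
  shows "(\<lambda>(z, \<omega>). particle_result l \<gamma> N (step_fst b \<gamma> z) \<omega>) \<in>
      (torus_power N \<Otimes>\<^sub>M torus_power N) \<Otimes>\<^sub>M system_noise N \<rightarrow>\<^sub>M torus_power N"
    and "(\<lambda>(z, \<omega>). particle_result l \<gamma> N (step_snd b \<gamma> z) \<omega>) \<in>
      (torus_power N \<Otimes>\<^sub>M torus_power N) \<Otimes>\<^sub>M system_noise N \<rightarrow>\<^sub>M torus_power N"
proof -
  let ?T = "torus_power N \<Otimes>\<^sub>M torus_power N :: ((nat \<Rightarrow> 'n torus) \<times> (nat \<Rightarrow> 'n torus)) measure"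
  let ?W = "count_space {..<N} \<Otimes>\<^sub>M (borel \<Otimes>\<^sub>M borel) :: (nat \<times> (real ^ 'n) \<times> real) measure"
  have cong: "?T \<Otimes>\<^sub>M particle_noise N \<rightarrow>\<^sub>M L = ?T \<Otimes>\<^sub>M ?W \<rightarrow>\<^sub>M L" for L :: "'n torus measure"
    by (intro measurable_cong_sets sets_pair_measure_cong sets_particle_noise refl)
  have v: "(\<lambda>x. snd (snd x)) \<in> ?T \<Otimes>\<^sub>M ?W \<rightarrow>\<^sub>M borel \<Otimes>\<^sub>M borel"
    and j: "(\<lambda>x. fst (snd x)) \<in> ?T \<Otimes>\<^sub>M ?W \<rightarrow>\<^sub>M count_space {..<N}"
    and f: "fst \<in> ?T \<Otimes>\<^sub>M ?W \<rightarrow>\<^sub>M ?T"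
    by measurable
  note steps = measurable_steps[OF b f v]
  show "(\<lambda>(z, \<omega>). particle_result l \<gamma> N (step_fst b \<gamma> z) \<omega>) \<in> ?T \<Otimes>\<^sub>M system_noise N \<rightarrow>\<^sub>M torus_power N"
    by (rule measurable_particle_result[OF l])
       (simp_all only: cong split_beta' steps(1) j lessThan_iff measurable_const space_count_space)
  show "(\<lambda>(z, \<omega>). particle_result l \<gamma> N (step_snd b \<gamma> z) \<omega>) \<in> ?T \<Otimes>\<^sub>M system_noise N \<rightarrow>\<^sub>M torus_power N"
    by (rule measurable_particle_result[OF l])
       (simp_all only: cong split_beta' steps(2) j lessThan_iff measurable_const space_count_space)
qed

lemma system_noise_in_prob_algebra: "1 \<le> N \<Longrightarrow> system_noise N \<in> space (prob_algebra (system_noise N))"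
  by (simp add: space_prob_algebra prob_space_system_noise)

lemma measurable_coupled_kernel:
  assumes N: "1 \<le> N" and b: "b \<in> borel \<rightarrow>\<^sub>M borel" and l: "l \<in> borel_measurable borel"
  shows "coupled_kernel b l \<gamma> N \<in> torus_power N \<Otimes>\<^sub>M torus_power N \<rightarrow>\<^sub>M
    prob_algebra (torus_power N \<Otimes>\<^sub>M torus_power N)"
  unfolding coupled_kernel_def[abs_def]
proof (rule measurable_distr_prob_space2[where M = "system_noise N"])
  show "(\<lambda>_. system_noise N) \<in> torus_power N \<Otimes>\<^sub>M torus_power N \<rightarrow>\<^sub>M prob_algebra (system_noise N)"
    by (rule measurable_const) (rule system_noise_in_prob_algebra[OF N])
  show "(\<lambda>(z, \<omega>). (particle_result l \<gamma> N (step_fst b \<gamma> z) \<omega>, particle_result l \<gamma> N (step_snd b \<gamma> z) \<omega>))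
      \<in> (torus_power N \<Otimes>\<^sub>M torus_power N) \<Otimes>\<^sub>M system_noise N \<rightarrow>\<^sub>M torus_power N \<Otimes>\<^sub>M torus_power N"
    using measurable_particle_result_steps[OF b l, of \<gamma> N] unfolding split_beta'
    by (intro measurable_Pair)
qed

lemma measurable_particle_result_fixed:
  assumes "b \<in> borel \<rightarrow>\<^sub>M borel" "l \<in> borel_measurable borel"
    and z: "z \<in> space (torus_power N \<Otimes>\<^sub>M torus_power N)"
  shows "particle_result l \<gamma> N (step_fst b \<gamma> z) \<in> system_noise N \<rightarrow>\<^sub>M torus_power N"
    and "particle_result l \<gamma> N (step_snd b \<gamma> z) \<in> system_noise N \<rightarrow>\<^sub>M torus_power N"
  using measurable_compose[OF measurable_Pair1'[OF z] measurable_particle_result_steps(1)[OF assms(1,2)]]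
    measurable_compose[OF measurable_Pair1'[OF z] measurable_particle_result_steps(2)[OF assms(1,2)]]
  by simp_all

lemma distr_coupled_kernel:
  assumes N: "1 \<le> N" and b: "b \<in> borel \<rightarrow>\<^sub>M borel" and l: "l \<in> borel_measurable borel"
    and z: "z \<in> space (torus_power N \<Otimes>\<^sub>M torus_power N)"
  shows "distr (coupled_kernel b l \<gamma> N z) (torus_power N) fst = particle_kernel b l \<gamma> N (fst z)"
    and "distr (coupled_kernel b l \<gamma> N z) (torus_power N) snd = particle_kernel b l \<gamma> N (snd z)"
proof -
  note m = measurable_particle_result_fixed[OF b l z]
  have "distr (coupled_kernel b l \<gamma> N z) (torus_power N) fst =
      distr (system_noise N) (torus_power N) (particle_result l \<gamma> N (step_fst b \<gamma> z))"
    unfolding coupled_kernel_def using m by (subst distr_distr) (auto simp: comp_def)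
  also have "\<dots> = particle_kernel b l \<gamma> N (fst z)"
    by (rule distr_particle_result[OF N b l]) (auto intro: step_fst_measurable b distr_steps)
  finally show "distr (coupled_kernel b l \<gamma> N z) (torus_power N) fst = particle_kernel b l \<gamma> N (fst z)" .
  have "distr (coupled_kernel b l \<gamma> N z) (torus_power N) snd =
      distr (system_noise N) (torus_power N) (particle_result l \<gamma> N (step_snd b \<gamma> z))"
    unfolding coupled_kernel_def using m by (subst distr_distr) (auto simp: comp_def)
  also have "\<dots> = particle_kernel b l \<gamma> N (snd z)"
    by (rule distr_particle_result[OF N b l]) (auto intro: step_snd_measurable b distr_steps)
  finally show "distr (coupled_kernel b l \<gamma> N z) (torus_power N) snd = particle_kernel b l \<gamma> N (snd z)" .
qed

text \<open>The kernel is the first marginal of the coupled kernel started on the diagonal, and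
  inherits its measurability.\<close>

lemma measurable_particle_kernel:
  assumes N: "1 \<le> N" and b: "b \<in> borel \<rightarrow>\<^sub>M borel" and l: "l \<in> borel_measurable borel"
  shows "particle_kernel b l \<gamma> N \<in> torus_power N \<rightarrow>\<^sub>M prob_algebra (torus_power N)"
proof -
  have "(\<lambda>x. distr (coupled_kernel b l \<gamma> N (x, x)) (torus_power N) fst)
      \<in> torus_power N \<rightarrow>\<^sub>M prob_algebra (torus_power N)"
  proof -
    have "(\<lambda>x. (x, x)) \<in> torus_power N \<rightarrow>\<^sub>M torus_power N \<Otimes>\<^sub>M (torus_power N :: (nat \<Rightarrow> 'a torus) measure)"
      by measurable
    from measurable_compose[OF this measurable_coupled_kernel[OF N b l]]
    have "(\<lambda>x. coupled_kernel b l \<gamma> N (x, x)) \<in>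
        torus_power N \<rightarrow>\<^sub>M prob_algebra (torus_power N \<Otimes>\<^sub>M torus_power N)" .
    from measurable_compose[OF this measurable_distr_prob_space[OF measurable_fst]] show ?thesis .
  qed
  then show ?thesis
    by (rule measurable_cong[THEN iffD1, rotated])
       (simp add: distr_coupled_kernel(1)[OF N b l] space_pair_measure)
qed

lemma particle_step_in_prob_algebra:
  assumes "1 \<le> N" "b \<in> borel \<rightarrow>\<^sub>M borel" "l \<in> borel_measurable borel"
    and "\<mu> \<in> space (prob_algebra (torus_power N))"
  shows "particle_step b l \<gamma> N \<mu> \<in> space (prob_algebra (torus_power N))"
  using prob_space_bind'[OF assms(4) measurable_particle_kernel[OF assms(1-3)]]
    sets_bind'[OF assms(4) measurable_particle_kernel[OF assms(1-3)]]
  by (simp add: particle_step_def space_prob_algebra)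

lemma measurable_sum_dist:
  "(\<lambda>z. sum_dist N (torus_cost s) (fst z) (snd z)) \<in> borel_measurable (torus_power N \<Otimes>\<^sub>M torus_power N)"
  unfolding sum_dist_def
  by (intro borel_measurable_sum measurable_torus_cost)
     (auto intro: measurable_compose[OF measurable_fst measurable_coordinate]
        measurable_compose[OF measurable_snd measurable_coordinate])

lemma sum_dist_bounds:
  assumes "0 \<le> s"
  shows "0 \<le> sum_dist N (torus_cost s) x y" "sum_dist N (torus_cost s) x y \<le> real N"
  using sum_bounded_above[of "{..<N}" "\<lambda>i. torus_cost s (x i) (y i)" 1]
  by (auto simp: sum_dist_def torus_cost_bounds assms intro!: sum_nonneg)

section \<open>Oscillation of the killing probability and the total cost\<close>

lemma exp_diff_le:
  fixes x y :: real
  assumes "0 \<le> x" "0 \<le> y"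
  shows "exp (- x) - exp (- y) \<le> \<bar>x - y\<bar>"
proof (cases "x \<le> y")
  case True
  have "exp (- x) - exp (- y) = exp (- x) * (1 - exp (- (y - x)))"
    by (simp add: right_diff_distrib mult_exp_exp)
  also have "\<dots> \<le> 1 * (y - x)"
  proof (rule mult_mono)
    show "1 - exp (- (y - x)) \<le> y - x" using exp_ge_add_one_self[of "- (y - x)"] by linarith
  qed (use assms True in auto)
  finally show ?thesis using True by simp
next
  case False
  then have "exp (- x) - exp (- y) \<le> 0" by simp
  then show ?thesis by linarith
qed

lemma kill_prob_diff_le:
  assumes l: "\<And>z. 0 \<le> l z" "L-lipschitz_on UNIV l" and \<gamma>: "0 \<le> \<gamma>"
  shows "\<bar>kill_prob l \<gamma> x - kill_prob l \<gamma> y\<bar> \<le> \<gamma> * L * dist x y"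
proof -
  have le: "kill_prob l \<gamma> x - kill_prob l \<gamma> y \<le> \<gamma> * L * dist x y" for x y
  proof -
    have "kill_prob l \<gamma> x - kill_prob l \<gamma> y \<le> \<bar>\<gamma> * l y - \<gamma> * l x\<bar>"
      using exp_diff_le[of "\<gamma> * l y" "\<gamma> * l x"] l(1) \<gamma> by (simp add: kill_prob_def)
    also have "\<dots> = \<gamma> * dist (l x) (l y)"
      using \<gamma> by (simp add: dist_real_def abs_mult abs_minus_commute flip: right_diff_distrib)
    also have "\<dots> \<le> \<gamma> * (L * dist x y)"
      using \<gamma> lipschitz_onD[OF l(2)] by (intro mult_left_mono) auto
    finally show ?thesis by simp
  qed
  show ?thesis using le[of x y] le[of y x] by (simp add: dist_commute)
qed

text \<open>A Lipschitz function on a bounded space is bounded, and its supremum exceeds each value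
  by at most L times the diameter. As x \<mapsto> exp (- x) is 1-Lipschitz on the half-line, the
  resulting width is independent of the size of the rate.\<close>

lemma kill_prob_bounds:
  fixes l :: "'n::finite torus \<Rightarrow> real"
  assumes l: "\<And>z. 0 \<le> l z" "L-lipschitz_on UNIV l" and \<gamma>: "0 < \<gamma>"
  shows "0 \<le> kill_prob l \<gamma> x" "kill_prob l \<gamma> x \<le> 1 - exp (- (\<gamma> * sup_norm l))"
    "1 - exp (- (\<gamma> * sup_norm l)) - \<gamma> * L * real CARD('n) \<le> kill_prob l \<gamma> x"
proof -
  have L: "0 \<le> L" by (rule lipschitz_on_nonneg[OF l(2)])
  have up: "l z \<le> l x + L * real CARD('n)" for z
  proof -
    have "l z - l x \<le> L * dist z x" using lipschitz_onD[OF l(2), of z x] by (simp add: dist_real_def)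
    also have "\<dots> \<le> L * real CARD('n)" using L by (intro mult_left_mono dist_torus_le_card)
    finally show ?thesis by simp
  qed
  have bdd: "bdd_above (range (\<lambda>z. \<bar>l z\<bar>))" using up l(1) by (intro bdd_aboveI2) simp
  have lx: "l x \<le> sup_norm l" using cSUP_upper[OF UNIV_I bdd, of x] l(1) by (simp add: sup_norm_def)
  have sup: "sup_norm l \<le> l x + L * real CARD('n)"
    unfolding sup_norm_def using up l(1) by (intro cSUP_least) auto
  show "0 \<le> kill_prob l \<gamma> x" using l(1) \<gamma> by (simp add: kill_prob_def)
  show "kill_prob l \<gamma> x \<le> 1 - exp (- (\<gamma> * sup_norm l))" using lx \<gamma> by (simp add: kill_prob_def)
  have "exp (- (\<gamma> * l x)) - exp (- (\<gamma> * sup_norm l)) \<le> \<bar>\<gamma> * l x - \<gamma> * sup_norm l\<bar>"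
    using \<gamma> l(1) lx by (intro exp_diff_le mult_nonneg_nonneg) (auto intro: order_trans[OF l(1)])
  also have "\<dots> = \<gamma> * (sup_norm l - l x)" using \<gamma> lx by (simp add: abs_mult flip: right_diff_distrib)
  also have "\<dots> \<le> \<gamma> * (L * real CARD('n))" using sup \<gamma> by (intro mult_left_mono) auto
  finally show "1 - exp (- (\<gamma> * sup_norm l)) - \<gamma> * L * real CARD('n) \<le> kill_prob l \<gamma> x"
    by (simp add: kill_prob_def)
qed

lemma integral_particle_noise_mixture:
  fixes F :: "nat \<Rightarrow> (real ^ 'n::finite) \<times> real \<Rightarrow> real"
  assumes N: "1 \<le> N" and F: "\<And>j. j < N \<Longrightarrow> F j \<in> borel_measurable (borel \<Otimes>\<^sub>M borel)"
    "\<And>j v. 0 \<le> F j v" "\<And>j v. F j v \<le> 1"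
  shows "(LINT w|particle_noise N. F (fst w) (snd w)) =
    (\<Sum>j<N. LINT v|(std_gaussian \<Otimes>\<^sub>M unit_unif). F j v) / real N"
proof -
  let ?V = "std_gaussian \<Otimes>\<^sub>M unit_unif :: ((real ^ 'n) \<times> real) measure" and ?U = "uniform_count_measure {..<N}"
  interpret V: prob_space ?V by (rule prob_space_gauss_unif)
  interpret U: prob_space ?U using N by (intro prob_space_uniform_count_measure) (auto simp: lessThan_empty_iff)
  interpret UV: pair_prob_space ?U ?V ..
  have "(\<lambda>w. F (fst w) (snd w)) \<in> borel_measurable (particle_noise N)"
    by (subst measurable_cong_sets[OF sets_particle_noise refl], rule measurable_pair_measure_countable1)
       (use F(1) in auto)
  then have int: "integrable (?U \<Otimes>\<^sub>M ?V) (\<lambda>w. F (fst w) (snd w))"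
    using F(2,3) unfolding particle_noise_def by (intro UV.P.integrable_const_bound[where B = 1]) auto
  show ?thesis
    using UV.integral_fst'[OF int] by (simp add: particle_noise_def integral_uniform_count_measure)
qed

text \<open>With S the total cost of the pair of states, a resampled trial has mean cost at most a S
  / N for every particle, because both systems draw the same uniform label. Summation over the
  particles restores a S, and the series of rejections gives 1 + P / (1 - P) = 1 / (1 - P).\<close>

lemma coupled_kernel_cost:
  fixes b :: "'n::finite torus \<Rightarrow> real ^ 'n" and l :: "'n torus \<Rightarrow> real"
  assumes N: "1 \<le> N" and b: "b \<in> borel \<rightarrow>\<^sub>M borel" and l: "l \<in> borel_measurable borel" and s: "0 \<le> s"
    and z: "z \<in> space (torus_power N \<Otimes>\<^sub>M torus_power N)"
    and p: "\<And>x. 0 \<le> kill_prob l \<gamma> x" "\<And>x. kill_prob l \<gamma> x \<le> P" "\<And>x. P - \<delta> \<le> kill_prob l \<gamma> x" "P < 1"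
    and lip: "\<And>x y. \<bar>kill_prob l \<gamma> x - kill_prob l \<gamma> y\<bar> \<le> \<theta> * torus_cost s x y"
    and B: "0 \<le> 1 - P + \<delta> + \<theta>"
    and step: "\<And>x y. (LINT v|(std_gaussian \<Otimes>\<^sub>M unit_unif).
      torus_cost s (euler_step b \<gamma> x (fst v)) (euler_step b \<gamma> y (coupled_noise b \<gamma> x y v))) \<le> a * torus_cost s x y"
  shows "(LINT w|coupled_kernel b l \<gamma> N z. sum_dist N (torus_cost s) (fst w) (snd w)) \<le>
    (1 - P + \<delta> + \<theta>) / (1 - P) * a * sum_dist N (torus_cost s) (fst z) (snd z)"
proof -
  let ?D = "torus_cost s :: 'n torus \<Rightarrow> _" and ?W = "particle_noise N :: (nat \<times> (real ^ 'n) \<times> real) measure"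
  let ?gi = "\<lambda>i w. step_fst b \<gamma> z i (snd w)" and ?gm = "\<lambda>w. step_fst b \<gamma> z (fst w) (snd w)"
  let ?hi = "\<lambda>i w. step_snd b \<gamma> z i (snd w)" and ?hm = "\<lambda>w. step_snd b \<gamma> z (fst w) (snd w)"
  let ?B = "1 - P + \<delta> + \<theta>"
  let ?V = "std_gaussian \<Otimes>\<^sub>M unit_unif :: ((real ^ 'n) \<times> real) measure"
  define S where "S = sum_dist N ?D (fst z) (snd z)"
  define r where "r i \<omega> = ?D (trial_result l \<gamma> (?gi i) ?gm \<omega>) (trial_result l \<gamma> (?hi i) ?hm \<omega>)" for i \<omega>
  note m0 = measurable_mixture_step(1)[OF step_fst_measurable[OF b]] measurable_mixture_step(1)[OF step_snd_measurable[OF b]]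
  note m = measurable_mixture_step(2)[OF step_fst_measurable[OF b]] measurable_mixture_step(2)[OF step_snd_measurable[OF b]]
  have D: "(\<lambda>z. ?D (fst z) (snd z)) \<in> borel_measurable (borel \<Otimes>\<^sub>M borel)" by measurable
  have r_meas: "r i \<in> borel_measurable (trial_noise ?W)" if "i < N" for i
    unfolding r_def[abs_def]
    by (intro measurable_torus_cost measurable_trial_result_noise l m0 m that)
  have P0: "0 \<le> P" using p(1,2) order_trans by blast
  have one: "(LINT v|?V. ?D (step_fst b \<gamma> z j v) (step_snd b \<gamma> z j v)) \<le> a * ?D (fst z j) (snd z j)" for j
    using step by (simp add: step_fst_def step_snd_def)
  have e: "(LINT w|?W. ?D (?gm w) (?hm w)) \<le> a * S / real N"
  proof -
    have "(LINT w|?W. ?D (?gm w) (?hm w)) =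
        (\<Sum>j<N. LINT v|?V. ?D (step_fst b \<gamma> z j v) (step_snd b \<gamma> z j v)) / real N"
      by (rule integral_particle_noise_mixture[OF N, where F = "\<lambda>j v. ?D (step_fst b \<gamma> z j v) (step_snd b \<gamma> z j v)"])
         (auto simp: torus_cost_bounds s intro!: measurable_torus_cost step_fst_measurable step_snd_measurable b)
    also have "\<dots> \<le> (\<Sum>j<N. a * ?D (fst z j) (snd z j)) / real N"
      by (intro divide_right_mono sum_mono one) auto
    also have "\<dots> = a * S / real N" by (simp add: S_def sum_dist_def sum_distrib_left)
    finally show ?thesis .
  qed
  have ri: "(LINT \<omega>|trial_noise ?W. r i \<omega>) \<le> ?B * (a * ?D (fst z i) (snd z i) + P / (1 - P) * (a * S / real N))"
    if i: "i < N" for i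
  proof -
    have e0: "(LINT w|?W. ?D (?gi i w) (?hi i w)) \<le> a * ?D (fst z i) (snd z i)"
    proof -
      have "(LINT w|?W. ?D (?gi i w) (?hi i w)) =
          (\<Sum>j<N. LINT v|?V. ?D (step_fst b \<gamma> z i v) (step_snd b \<gamma> z i v)) / real N"
        by (rule integral_particle_noise_mixture[OF N, where F = "\<lambda>j v. ?D (step_fst b \<gamma> z i v) (step_snd b \<gamma> z i v)"])
           (auto simp: torus_cost_bounds s intro!: measurable_torus_cost step_fst_measurable step_snd_measurable b)
      also have "\<dots> = (LINT v|?V. ?D (step_fst b \<gamma> z i v) (step_snd b \<gamma> z i v))" using N by simp
      finally show ?thesis using one[of i] by simp
    qed
    have "(LINT \<omega>|trial_noise ?W. r i \<omega>) \<le>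
        ?B * ((LINT w|?W. ?D (?gi i w) (?hi i w)) + P / (1 - P) * (LINT w|?W. ?D (?gm w) (?hm w)))"
      unfolding r_def
      by (intro integral_trial_result_le prob_space_particle_noise N l m0 m i D p lip) (auto simp: torus_cost_bounds s)
    also have "\<dots> \<le> ?B * (a * ?D (fst z i) (snd z i) + P / (1 - P) * (a * S / real N))"
      using e0 e P0 p(4) B by (intro mult_left_mono add_mono) auto
    finally show ?thesis .
  qed
  interpret SN: prob_space "system_noise N :: (nat \<Rightarrow> nat \<Rightarrow> (nat \<times> (real ^ 'n) \<times> real) \<times> real) measure"
    by (rule prob_space_system_noise[OF N])
  have "(LINT w|coupled_kernel b l \<gamma> N z. sum_dist N ?D (fst w) (snd w)) =
      (LINT \<omega>|system_noise N. (\<lambda>w. sum_dist N ?D (fst w) (snd w))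
        (particle_result l \<gamma> N (step_fst b \<gamma> z) \<omega>, particle_result l \<gamma> N (step_snd b \<gamma> z) \<omega>))"
    unfolding coupled_kernel_def using measurable_particle_result_fixed[OF b l z]
    by (intro integral_distr measurable_Pair measurable_sum_dist)
  also have "\<dots> = (LINT \<omega>|system_noise N. (\<Sum>i<N. r i (\<omega> i)))"
    by (simp add: sum_dist_def particle_result_def r_def)
  also have "\<dots> = (\<Sum>i<N. LINT \<omega>|system_noise N. r i (\<omega> i))"
  proof (rule Bochner_Integration.integral_sum)
    fix i assume i: "i \<in> {..<N}"
    have "(\<lambda>\<omega>. r i (\<omega> i)) \<in> borel_measurable (system_noise N)"
      using i by (intro measurable_PiM_component_compose[OF i] r_meas) simp
    then show "integrable (system_noise N) (\<lambda>\<omega>. r i (\<omega> i))"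
      using s by (intro SN.integrable_const_bound[where B = 1]) (auto simp: r_def torus_cost_bounds)
  qed
  also have "\<dots> = (\<Sum>i<N. LINT \<omega>|trial_noise ?W. r i \<omega>)"
  proof (rule sum.cong[OF refl])
    fix i assume i: "i \<in> {..<N}"
    have "(LINT \<omega>|trial_noise ?W. r i \<omega>) = (LINT \<omega>|(distr (system_noise N) (trial_noise ?W) (\<lambda>\<omega>. \<omega> i)). r i \<omega>)"
      using i N by (subst distr_PiM_component) (auto intro: prob_space_trial_noise)
    also have "\<dots> = (LINT \<omega>|system_noise N. r i (\<omega> i))"
      using i r_meas by (intro integral_distr measurable_component_singleton) auto
    finally show "(LINT \<omega>|system_noise N. r i (\<omega> i)) = (LINT \<omega>|trial_noise ?W. r i \<omega>)" ..
  qed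
  also have "\<dots> \<le> (\<Sum>i<N. ?B * (a * ?D (fst z i) (snd z i) + P / (1 - P) * (a * S / real N)))"
    by (intro sum_mono ri) simp
  also have "\<dots> = ?B * (a * S + P / (1 - P) * (a * S))"
    using N by (simp add: sum.distrib S_def sum_dist_def flip: sum_distrib_left)
  also have "\<dots> = ?B / (1 - P) * a * S" using p(4) by (simp add: field_simps)
  finally show ?thesis by (simp add: S_def)
qed

theorem theorem2:
  fixes b :: "'n::finite torus \<Rightarrow> real ^ 'n"
  assumes "torus_C1 b"
  shows "\<exists>c1>0. \<exists>c2>0. \<exists>\<gamma>0>0. \<exists>\<rho> :: 'n torus \<Rightarrow> 'n torus \<Rightarrow> real. \<exists>C>0.
    Metric_space UNIV \<rho> \<and> equivalent_dist \<rho> \<and>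
    (\<forall>(l :: 'n torus \<Rightarrow> real) L. (\<forall>z. 0 \<le> l z) \<and> L-lipschitz_on UNIV l \<longrightarrow>
      (let \<kappa> = (\<lambda>\<gamma>. c1 - c2 * L * exp (\<gamma> * sup_norm l)) in
        (\<forall>\<gamma>\<in>{0<..\<gamma>0}. \<forall>N\<ge>1.
           \<forall>\<mu>\<in>space (prob_algebra (torus_power N)). \<forall>\<nu>\<in>space (prob_algebra (torus_power N)).
             wasserstein (sum_dist N \<rho>) (particle_step b l \<gamma> N \<mu>) (particle_step b l \<gamma> N \<nu>)
               \<le> (1 - \<gamma> * \<kappa> \<gamma>) * wasserstein (sum_dist N \<rho>) \<mu> \<nu>) \<and>
        (\<forall>\<gamma>\<in>{0<..\<gamma>0}. \<forall>N\<ge>1. \<forall>m.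
           \<forall>\<mu>\<in>space (prob_algebra (torus_power N)). \<forall>\<nu>\<in>space (prob_algebra (torus_power N)).
             wasserstein (euclid_dist N) ((particle_step b l \<gamma> N ^^ m) \<mu>)
                 ((particle_step b l \<gamma> N ^^ m) \<nu>)
               \<le> C * real N * (1 - \<gamma> * \<kappa> \<gamma>) ^ m)))"
proof -
  obtain L0 where L0: "0 \<le> L0" "\<And>x y. norm (b x - b y) \<le> L0 * dist x y"
    using torus_C1_lipschitz[OF assms] by blast
  have "L0-lipschitz_on UNIV b" using L0 by (intro lipschitz_onI) (auto simp: dist_norm)
  then have b: "b \<in> borel \<rightarrow>\<^sub>M borel"
    by (intro borel_measurable_continuous_onI lipschitz_on_continuous_on)
  define s where "s = sqrt (L0 + 1)"
  have s: "0 < s" using L0(1) by (simp add: s_def)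
  let ?\<rho> = "torus_cost s :: 'n torus \<Rightarrow> 'n torus \<Rightarrow> real"
  define \<phi> where "\<phi> = std_normal_density (s * real CARD('n))"
  have \<phi>: "0 < \<phi>" "\<phi> \<le> 1" by (auto simp: \<phi>_def normal_density_pos std_normal_density_le_1)
  \<comment> \<open>The inverse of the lower slope in \<open>torus_cost_equiv\<close>, so that the
    distance is at most \<open>A\<close> times the cost. It also serves as the constant C of the
    second claim.\<close>
  define A where "A = 1 / (\<phi> * s)"
  have A: "0 < A" using \<phi> s by (simp add: A_def)
  have dist_le: "dist x y \<le> A * ?\<rho> x y" for x y
    using torus_cost_equiv(1)[OF s, of x y] \<phi> s by (simp add: A_def \<phi>_def[symmetric] field_simps)
  \<comment> \<open>In c2, the summand \<open>A\<close> pays for trials where exactly one chain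
    stops, and the dimension for the oscillation of the killing probability.\<close>
  define c1 c2 \<gamma>0 where "c1 = \<phi> / 2" and "c2 = A + real CARD('n)" and "\<gamma>0 = 1 / (L0 + 2)\<^sup>2"
  have pos: "0 < c1" "0 < c2" "0 < \<gamma>0" using \<phi> A L0(1) by (auto simp: c1_def c2_def \<gamma>0_def intro: add_pos_nonneg)
  define \<kappa> where "\<kappa> l L \<gamma> = c1 - c2 * L * exp (\<gamma> * sup_norm l)" for l :: "'n torus \<Rightarrow> real" and L \<gamma>
  have main: "0 \<le> 1 - \<gamma> * \<kappa> l L \<gamma> \<and> l \<in> borel_measurable borel \<and>
      (\<forall>\<mu>\<in>space (prob_algebra (torus_power N)). \<forall>\<nu>\<in>space (prob_algebra (torus_power N)).
        wasserstein (sum_dist N ?\<rho>) (particle_step b l \<gamma> N \<mu>) (particle_step b l \<gamma> N \<nu>)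
          \<le> (1 - \<gamma> * \<kappa> l L \<gamma>) * wasserstein (sum_dist N ?\<rho>) \<mu> \<nu>)"
    if l: "\<And>z. 0 \<le> l z" "L-lipschitz_on UNIV l" and \<gamma>: "0 < \<gamma>" "\<gamma> \<le> \<gamma>0" and N: "1 \<le> N"
    for l :: "'n torus \<Rightarrow> real" and L \<gamma> N
  proof -
    have L: "0 \<le> L" by (rule lipschitz_on_nonneg[OF l(2)])
    have ml: "l \<in> borel_measurable borel"
      by (intro borel_measurable_continuous_onI lipschitz_on_continuous_on[OF l(2)])
    have \<gamma>1: "\<gamma> \<le> 1" using one_step_factor(2)[OF L0(1) \<gamma>(1)] \<gamma>(2) by (simp add: \<gamma>0_def)
    define E where "E = exp (\<gamma> * sup_norm l)"
    define P where "P = 1 - exp (- (\<gamma> * sup_norm l))"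
    have E: "0 < E" "1 - P = 1 / E" by (simp_all add: E_def P_def exp_minus divide_inverse)
    define \<delta> \<theta> where "\<delta> = \<gamma> * L * real CARD('n)" and "\<theta> = \<gamma> * L * A"
    have \<delta>\<theta>: "0 \<le> \<delta>" "0 \<le> \<theta>" "\<delta> + \<theta> = \<gamma> * (c2 * L)"
      using \<gamma> L A by (auto simp: \<delta>_def \<theta>_def c2_def algebra_simps)
    have a: "0 \<le> 1 - c1 * \<gamma>" "1 - c1 * \<gamma> \<le> 1"
      using \<phi> \<gamma> \<gamma>1 mult_mono[of c1 1 \<gamma> 1] by (auto simp: c1_def)
    have q: "1 - \<gamma> * \<kappa> l L \<gamma> = 1 - c1 * \<gamma> + (\<delta> + \<theta>) * E"
      unfolding \<delta>\<theta>(3) by (simp add: \<kappa>_def E_def algebra_simps)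
    \<comment> \<open>The factor exceeds one when \<kappa> is negative, but it is never negative
      itself, since c1 \<gamma> \<le> 1. The iteration below multiplies inequalities by it.\<close>
    have q0: "0 \<le> 1 - \<gamma> * \<kappa> l L \<gamma>" unfolding q using a \<delta>\<theta> E(1) by simp
    have lip: "\<bar>kill_prob l \<gamma> x - kill_prob l \<gamma> y\<bar> \<le> \<theta> * ?\<rho> x y" for x y
    proof -
      have "\<bar>kill_prob l \<gamma> x - kill_prob l \<gamma> y\<bar> \<le> \<gamma> * L * dist x y"
        using l \<gamma>(1) by (intro kill_prob_diff_le) auto
      also have "\<dots> \<le> \<gamma> * L * (A * ?\<rho> x y)"
        using \<gamma> L by (intro mult_left_mono dist_le) auto
      finally show ?thesis by (simp add: \<theta>_def mult.assoc)
    qed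
    have step: "(LINT v|(std_gaussian \<Otimes>\<^sub>M unit_unif).
        ?\<rho> (euler_step b \<gamma> x (fst v)) (euler_step b \<gamma> y (coupled_noise b \<gamma> x y v))) \<le>
        (1 - c1 * \<gamma>) * ?\<rho> x y" for x y
      using coupled_step_contraction[OF b L0 \<gamma>(1), of x y] \<gamma>(2) by (simp add: \<gamma>0_def s_def c1_def \<phi>_def)
    have P1: "P < 1" by (simp add: P_def)
    \<comment> \<open>Resampling multiplies 1 - c1 \<gamma> by 1 + (\<delta> + \<theta>) E. The
      mixed term of the product is nonpositive and is dropped.\<close>
    have factor: "(1 - P + \<delta> + \<theta>) / (1 - P) * (1 - c1 * \<gamma>) \<le> 1 - \<gamma> * \<kappa> l L \<gamma>"
    proof -
      have "(1 - P + \<delta> + \<theta>) / (1 - P) * (1 - c1 * \<gamma>) = (1 - c1 * \<gamma>) + (\<delta> + \<theta>) * E * (1 - c1 * \<gamma>)"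
        using E by (simp add: E(2) field_simps)
      also have "\<dots> \<le> (1 - c1 * \<gamma>) + (\<delta> + \<theta>) * E * 1"
        using a \<delta>\<theta>(1,2) E(1) by (intro add_left_mono mult_left_mono) auto
      finally show ?thesis unfolding q by simp
    qed
    have cost: "(LINT w|coupled_kernel b l \<gamma> N z. sum_dist N ?\<rho> (fst w) (snd w)) \<le>
        (1 - \<gamma> * \<kappa> l L \<gamma>) * sum_dist N ?\<rho> (fst z) (snd z)"
      if z: "z \<in> space (torus_power N \<Otimes>\<^sub>M torus_power N)" for z
    proof -
      have "(LINT w|coupled_kernel b l \<gamma> N z. sum_dist N ?\<rho> (fst w) (snd w)) \<le>
          (1 - P + \<delta> + \<theta>) / (1 - P) * (1 - c1 * \<gamma>) * sum_dist N ?\<rho> (fst z) (snd z)"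
      proof (rule coupled_kernel_cost[OF N b ml _ z _ _ _ P1 lip _ step])
        show "0 \<le> s" using s by simp
        show "0 \<le> kill_prob l \<gamma> x" "kill_prob l \<gamma> x \<le> P" "P - \<delta> \<le> kill_prob l \<gamma> x" for x
          using kill_prob_bounds[OF l \<gamma>(1), of x] by (simp_all add: P_def \<delta>_def)
        show "0 \<le> 1 - P + \<delta> + \<theta>" using \<delta>\<theta> P1 by simp
      qed
      also have "\<dots> \<le> (1 - \<gamma> * \<kappa> l L \<gamma>) * sum_dist N ?\<rho> (fst z) (snd z)"
        using s by (intro mult_right_mono factor sum_dist_bounds) auto
      finally show ?thesis .
    qed
    have "wasserstein (sum_dist N ?\<rho>) (particle_step b l \<gamma> N \<mu>) (particle_step b l \<gamma> N \<nu>)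
        \<le> (1 - \<gamma> * \<kappa> l L \<gamma>) * wasserstein (sum_dist N ?\<rho>) \<mu> \<nu>"
      if "\<mu> \<in> space (prob_algebra (torus_power N))" "\<nu> \<in> space (prob_algebra (torus_power N))" for \<mu> \<nu>
      unfolding particle_step_def
      by (rule wasserstein_bind_le[where C = "coupled_kernel b l \<gamma> N" and B = "real N", OF measurable_sum_dist])
         (use s that cost q0 measurable_particle_kernel[OF N b ml] measurable_coupled_kernel[OF N b ml]
            distr_coupled_kernel[OF N b ml] in \<open>auto simp: sum_dist_bounds\<close>)
    with q0 ml show ?thesis by blast
  qed
  have iterate: "wasserstein (euclid_dist N) ((particle_step b l \<gamma> N ^^ m) \<mu>) ((particle_step b l \<gamma> N ^^ m) \<nu>)
      \<le> A * real N * (1 - \<gamma> * \<kappa> l L \<gamma>) ^ m"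
    if l: "\<And>z. 0 \<le> l z" "L-lipschitz_on UNIV l" and \<gamma>: "0 < \<gamma>" "\<gamma> \<le> \<gamma>0" and N: "1 \<le> N"
      and \<mu>: "\<mu> \<in> space (prob_algebra (torus_power N))" and \<nu>: "\<nu> \<in> space (prob_algebra (torus_power N))"
    for l :: "'n torus \<Rightarrow> real" and L \<gamma> N m \<mu> \<nu>
  proof -
    let ?R = "particle_step b l \<gamma> N" and ?w = "wasserstein (sum_dist N ?\<rho>)"
    define q where "q = 1 - \<gamma> * \<kappa> l L \<gamma>"
    have q: "0 \<le> q" "l \<in> borel_measurable borel"
      and contr: "\<And>\<mu> \<nu>. \<mu> \<in> space (prob_algebra (torus_power N)) \<Longrightarrow> \<nu> \<in> space (prob_algebra (torus_power N)) \<Longrightarrow>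
        ?w (?R \<mu>) (?R \<nu>) \<le> q * ?w \<mu> \<nu>"
      using main[OF l \<gamma> N] by (auto simp: q_def)
    have iter: "(?R ^^ m) \<mu> \<in> space (prob_algebra (torus_power N))"
      if "\<mu> \<in> space (prob_algebra (torus_power N))" for m \<mu>
      using that by (induction m) (auto intro: particle_step_in_prob_algebra N b q(2))
    \<comment> \<open>The bound at \<open>m = 0\<close> is the trivial one: each of the N summands
      of the cost is at most one.\<close>
    have "?w ((?R ^^ m) \<mu>) ((?R ^^ m) \<nu>) \<le> q ^ m * real N"
    proof (induction m)
      case 0
      show ?case
        using wasserstein_bounds(2)[OF measurable_sum_dist _ _ \<mu> \<nu>, of s "real N"] s by (simp add: sum_dist_bounds)
    next
      case (Suc m)
      have "?w ((?R ^^ Suc m) \<mu>) ((?R ^^ Suc m) \<nu>) \<le> q * ?w ((?R ^^ m) \<mu>) ((?R ^^ m) \<nu>)"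
        using contr[OF iter[OF \<mu>] iter[OF \<nu>]] by simp
      also have "\<dots> \<le> q * (q ^ m * real N)" using Suc q(1) by (intro mult_left_mono)
      finally show ?case by simp
    qed
    then have "A * ?w ((?R ^^ m) \<mu>) ((?R ^^ m) \<nu>) \<le> A * (q ^ m * real N)"
      using A by (intro mult_left_mono) auto
    moreover have "wasserstein (euclid_dist N) ((?R ^^ m) \<mu>) ((?R ^^ m) \<nu>) \<le> A * ?w ((?R ^^ m) \<mu>) ((?R ^^ m) \<nu>)"
    proof (rule wasserstein_mono_cost[OF measurable_sum_dist _ _ iter[OF \<mu>] iter[OF \<nu>] A, of s "real N"])
      fix x y :: "nat \<Rightarrow> 'n torus"
      show "0 \<le> sum_dist N ?\<rho> x y" "sum_dist N ?\<rho> x y \<le> real N" using s by (auto simp: sum_dist_bounds)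
      show "0 \<le> euclid_dist N x y" by (simp add: euclid_dist_def)
      have "euclid_dist N x y \<le> (\<Sum>i<N. dist (x i) (y i))"
        unfolding euclid_dist_def by (rule L2_set_le_sum) simp
      also have "\<dots> \<le> (\<Sum>i<N. A * ?\<rho> (x i) (y i))" by (intro sum_mono dist_le)
      finally show "euclid_dist N x y \<le> A * sum_dist N ?\<rho> x y"
        by (simp add: sum_dist_def sum_distrib_left)
    qed
    ultimately show ?thesis by (simp add: q_def mult_ac)
  qed
  show ?thesis
    unfolding Let_def
  proof (rule exI[of _ c1], rule conjI[OF pos(1)], rule exI[of _ c2], rule conjI[OF pos(2)],
      rule exI[of _ \<gamma>0], rule conjI[OF pos(3)], rule exI[of _ ?\<rho>], rule exI[of _ A],
      intro conjI A allI impI ballI)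
    show "Metric_space UNIV ?\<rho>" by (rule Metric_space_torus_cost[OF s])
    show "equivalent_dist ?\<rho>" by (rule equivalent_dist_torus_cost[OF s])
  qed (use main iterate in \<open>auto simp: \<kappa>_def\<close>)
qed

end
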